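(* Let $\mathcal K\subseteq L^2_s(\partial\mathbb B)$ be a closed (right $\mathbb H$-linear) subspace. Then $\mathcal K$ is doubly invariant, i.e. $M_q\mathcal K=\mathcal K$, if and only if there exists a unique function $\varphi\in L^2_s(\partial\mathbb B)$ such that $\mathcal K=\varphi * L^2_s(\partial\mathbb B):=\{\varphi*f : f\in L^2_s(\partial\mathbb B)\}$ and $\varphi$ satisfies $\widetilde\varphi*\varphi^c=\widetilde\varphi$.
   Context: $\mathbb H$ is the skew field of quaternions, $\mathbb B=\{q\in\mathbb H:|q|<1\}$, $\mathbb S=\{q\in\mathbb H: q^2=-1\}$, and $\partial\mathbb B=\{e^{tI}: t\in\mathbb R, I\in\mathbb S\}$ is the unit sphere, where $e^{tI}=\cos t+I\sin t$. It carries the measure $d\Sigma(e^{tI})=d\sigma(I)\,dt$, with $dt$ Lebesgue measure and $\sigma$ the area measure on $\mathbb S$, normalized so that $\sigma(\mathbb S)=\Sigma(\partial\mathbb B)=1$. A function $f:\partial\mathbb B\to\mathbb H$ is a slice function if for all $J\ne K$ in $\mathbb S$ and all $x+yI\in\partial\mathbb B$ ($x,y\in\mathbb R$, $I\in\mathbb S$), $f(x+yI)=\big((J-K)^{-1}J+I(J-K)^{-1}\big)f(x+yJ)-\big((J-K)^{-1}K+I(J-K)^{-1}\big)f(x+yK)$. $L^2_s(\partial\mathbb B)$ is the space of slice functions $f$ with $\int_{\partial\mathbb B}|f|^2\,d\Sigma<\infty$, functions equal $\Sigma$-a.e. being identified. It consists exactly of the functions $f(q)=\sum_{n\in\mathbb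 Z}q^na_n$ ($\Sigma$-a.e.) with $\{a_n\}\in\ell^2(\mathbb Z,\mathbb H)$, and it is a quaternionic right Hilbert space with inner product $\langle\sum q^na_n,\sum q^nb_n\rangle=\sum_n\overline{b_n}a_n$. For $f(q)=\sum_n q^na_n$ and $g(q)=\sum_n q^nb_n$: $f^c(q)=\sum_n q^n\overline{a_n}$ (conjugate); $\widetilde f(q)=f(\bar q)$; and the $*$-product is $f*g(q)=\sum_{n\in\mathbb Z}q^n\sum_{k\in\mathbb Z}a_kb_{n-k}$, equivalently ($\Sigma$-a.e.) $f*g(q)=0$ if $f(q)=0$ and $f*g(q)=f(q)\,g(f(q)^{-1}qf(q))$ if $f(q)\neq0$. The operator $M_q$ is $M_qf=q*f=qf$. *)

theory Defs
  imports "HOL-Analysis.Analysis"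
begin

section \<open>Quaternions\<close>

datatype quat = Quat (qRe: real) (qIm1: real) (qIm2: real) (qIm3: real)

lemma quat_eq_iff:
  "x = y \<longleftrightarrow> qRe x = qRe y \<and> qIm1 x = qIm1 y \<and> qIm2 x = qIm2 y \<and> qIm3 x = qIm3 y"
  by (cases x; cases y) auto

instantiation quat :: ab_group_add
begin
definition "0 = Quat 0 0 0 0"
definition "x + y = Quat (qRe x + qRe y) (qIm1 x + qIm1 y) (qIm2 x + qIm2 y) (qIm3 x + qIm3 y)"
definition "- x = Quat (- qRe x) (- qIm1 x) (- qIm2 x) (- qIm3 x)"
definition "x - y = Quat (qRe x - qRe y) (qIm1 x - qIm1 y) (qIm2 x - qIm2 y) (qIm3 x - qIm3 y)"
instance
  by standard
    (auto simp: quat_eq_iff zero_quat_def plus_quat_def uminus_quat_def minus_quat_def)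
end

lemma zero_quat_sel [simp]: "qRe 0 = 0" "qIm1 0 = 0" "qIm2 0 = 0" "qIm3 0 = 0"
  by (simp_all add: zero_quat_def)

lemma plus_quat_sel [simp]:
  "qRe (x + y) = qRe x + qRe y" "qIm1 (x + y) = qIm1 x + qIm1 y"
  "qIm2 (x + y) = qIm2 x + qIm2 y" "qIm3 (x + y) = qIm3 x + qIm3 y"
  by (simp_all add: plus_quat_def)

lemma uminus_quat_sel [simp]:
  "qRe (- x) = - qRe x" "qIm1 (- x) = - qIm1 x" "qIm2 (- x) = - qIm2 x" "qIm3 (- x) = - qIm3 x"
  by (simp_all add: uminus_quat_def)

lemma minus_quat_sel [simp]:
  "qRe (x - y) = qRe x - qRe y" "qIm1 (x - y) = qIm1 x - qIm1 y"
  "qIm2 (x - y) = qIm2 x - qIm2 y" "qIm3 (x - y) = qIm3 x - qIm3 y"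
  by (simp_all add: minus_quat_def)

instantiation quat :: real_vector
begin
definition "scaleR r x = Quat (r * qRe x) (r * qIm1 x) (r * qIm2 x) (r * qIm3 x)"
instance
  by standard (auto simp: quat_eq_iff scaleR_quat_def algebra_simps)
end

lemma scaleR_quat_sel [simp]:
  "qRe (r *\<^sub>R x) = r * qRe x" "qIm1 (r *\<^sub>R x) = r * qIm1 x"
  "qIm2 (r *\<^sub>R x) = r * qIm2 x" "qIm3 (r *\<^sub>R x) = r * qIm3 x"
  by (simp_all add: scaleR_quat_def)

instantiation quat :: ring_1
begin
definition "1 = Quat 1 0 0 0"
definition "x * y = Quat
  (qRe x * qRe y - qIm1 x * qIm1 y - qIm2 x * qIm2 y - qIm3 x * qIm3 y)
  (qRe x * qIm1 y + qIm1 x * qRe y + qIm2 x * qIm3 y - qIm3 x * qIm2 y)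
  (qRe x * qIm2 y - qIm1 x * qIm3 y + qIm2 x * qRe y + qIm3 x * qIm1 y)
  (qRe x * qIm3 y + qIm1 x * qIm2 y - qIm2 x * qIm1 y + qIm3 x * qRe y)"
instance
  by standard (auto simp: quat_eq_iff one_quat_def times_quat_def algebra_simps)
end

lemma one_quat_sel [simp]: "qRe 1 = 1" "qIm1 1 = 0" "qIm2 1 = 0" "qIm3 1 = 0"
  by (simp_all add: one_quat_def)

lemma times_quat_sel [simp]:
  "qRe (x * y) = qRe x * qRe y - qIm1 x * qIm1 y - qIm2 x * qIm2 y - qIm3 x * qIm3 y"
  "qIm1 (x * y) = qRe x * qIm1 y + qIm1 x * qRe y + qIm2 x * qIm3 y - qIm3 x * qIm2 y"
  "qIm2 (x * y) = qRe x * qIm2 y - qIm1 x * qIm3 y + qIm2 x * qRe y + qIm3 x * qIm1 y"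
  "qIm3 (x * y) = qRe x * qIm3 y + qIm1 x * qIm2 y - qIm2 x * qIm1 y + qIm3 x * qRe y"
  by (simp_all add: times_quat_def)

instance quat :: real_algebra_1
  by standard (auto simp: quat_eq_iff algebra_simps)

definition qcnj :: "quat \<Rightarrow> quat" where
  "qcnj x = Quat (qRe x) (- qIm1 x) (- qIm2 x) (- qIm3 x)"

lemma qcnj_sel [simp]:
  "qRe (qcnj x) = qRe x" "qIm1 (qcnj x) = - qIm1 x"
  "qIm2 (qcnj x) = - qIm2 x" "qIm3 (qcnj x) = - qIm3 x"
  by (simp_all add: qcnj_def)

instantiation quat :: real_inner
begin
definition "inner x y = qRe x * qRe y + qIm1 x * qIm1 y + qIm2 x * qIm2 y + qIm3 x * qIm3 y"
definition "norm (x::quat) = sqrt (inner x x)"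
definition "sgn (x::quat) = x /\<^sub>R norm x"
definition "dist (x::quat) y = norm (x - y)"
definition [code del]:
  "(uniformity :: (quat \<times> quat) filter) = (INF e\<in>{0 <..}. principal {(x, y). dist x y < e})"
definition [code del]:
  "open (U :: quat set) \<longleftrightarrow> (\<forall>x\<in>U. eventually (\<lambda>(x', y). x' = x \<longrightarrow> y \<in> U) uniformity)"
instance
proof
  fix x y z :: quat and r :: real
  show "inner x x = 0 \<longleftrightarrow> x = 0"
  proof
    assume "inner x x = 0"
    then have "qRe x ^ 2 + qIm1 x ^ 2 + qIm2 x ^ 2 + qIm3 x ^ 2 = 0"
      by (simp add: inner_quat_def power2_eq_square)
    then show "x = 0"
      by (simp add: quat_eq_iff add_nonneg_eq_0_iff)
  qed (simp add: inner_quat_def)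
qed (auto simp: inner_quat_def norm_quat_def sgn_quat_def dist_quat_def open_quat_def
      uniformity_quat_def algebra_simps)
end

lemma norm_quat_eq: "norm x = sqrt (qRe x ^ 2 + qIm1 x ^ 2 + qIm2 x ^ 2 + qIm3 x ^ 2)"
  by (simp add: norm_quat_def inner_quat_def power2_eq_square)

lemma norm_quat_power2: "(norm x)\<^sup>2 = qRe x ^ 2 + qIm1 x ^ 2 + qIm2 x ^ 2 + qIm3 x ^ 2"
  by (simp add: norm_quat_eq)

lemma qcnj_mult_self: "qcnj x * x = (norm x)\<^sup>2 *\<^sub>R 1" "x * qcnj x = (norm x)\<^sup>2 *\<^sub>R 1"
  by (simp_all add: quat_eq_iff norm_quat_power2) (simp_all add: power2_eq_square)

lemma norm_mult_quat: "norm (x * y) = norm x * norm (y::quat)"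
  unfolding norm_quat_eq real_sqrt_mult [symmetric]
  by (rule arg_cong [where f = sqrt]) (simp add: power2_eq_square algebra_simps)

instantiation quat :: real_normed_div_algebra
begin
definition "inverse x = qcnj x /\<^sub>R (norm x)\<^sup>2"
definition "x div y = x * inverse y" for x y :: quat
instance
proof
  fix x y :: quat
  show "x div y = x * inverse y" by (simp add: divide_quat_def)
  show "inverse (0::quat) = 0" by (simp add: inverse_quat_def)
  show "norm (x * y) = norm x * norm y" by (rule norm_mult_quat)
  assume "x \<noteq> 0"
  then show "inverse x * x = 1" "x * inverse x = 1"
    by (simp_all add: inverse_quat_def qcnj_mult_self)
qed
end

instantiation quat :: euclidean_space
begin
definition "Basis = {Quat 1 0 0 0, Quat 0 1 0 0, Quat 0 0 1 0, Quat 0 0 0 1}"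
instance
proof
  show "(Basis :: quat set) \<noteq> {}" "finite (Basis :: quat set)"
    by (simp_all add: Basis_quat_def)
next
  fix u v :: quat
  assume "u \<in> Basis" "v \<in> Basis"
  then show "inner u v = (if u = v then 1 else 0)"
    unfolding Basis_quat_def inner_quat_def by (elim insertE emptyE) simp_all
next
  fix x :: quat
  show "(\<forall>u\<in>Basis. inner x u = 0) \<longleftrightarrow> x = 0"
    by (simp add: Basis_quat_def inner_quat_def quat_eq_iff [of x])
qed
end


section \<open>The unit sphere and its measure\<close>

definition im_units :: "quat set" where
  "im_units = {q. q\<^sup>2 = - 1}"

definition qsphere :: "quat set" where
  "qsphere = {q. norm q = 1}"

definition qexp :: "real \<Rightarrow> quat \<Rightarrow> quat" where
  "qexp t I = of_real (cos t) + of_real (sin t) * I"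

definition vec_quat :: "real ^ 3 \<Rightarrow> quat" where
  "vec_quat v = Quat 0 (v $ 1) (v $ 2) (v $ 3)"

text \<open>
  The imaginary units are the unit sphere of the three-dimensional space of purely imaginary
  quaternions. The area of a Borel set of this sphere is three times the volume of the cone over
  it (with apex 0, inside the unit ball); hence the normalized area measure is the image of
  normalized Lebesgue measure on the punctured unit ball under radial projection.
\<close>

definition area_measure :: "quat measure" where
  "area_measure =
    distr (uniform_measure (restrict_space lborel (ball 0 1 - {0})) (ball 0 1 - {0}))
      (restrict_space borel im_units) (\<lambda>v. vec_quat (v /\<^sub>R norm v))"

definition angle_measure :: "real measure" where
  "angle_measure = uniform_measure lborel {0..2 * pi}"

text \<open>
  The parametrization \<open>(t, I) \<mapsto> cos t + I sin t\<close> over a full period covers the sphere twice, by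
  \<open>(t, I)\<close> and \<open>(- t, - I)\<close>; with \<open>dt\<close> normalized to total mass 1 the image measure has total mass 1.
\<close>

definition sphere_measure :: "quat measure" where
  "sphere_measure = distr (angle_measure \<Otimes>\<^sub>M area_measure) (restrict_space borel qsphere)
    (\<lambda>(t, I). qexp t I)"

lemma im_units_iff: "I \<in> im_units \<longleftrightarrow> qRe I = 0 \<and> qIm1 I ^ 2 + qIm2 I ^ 2 + qIm3 I ^ 2 = 1"
proof
  assume "I \<in> im_units"
  then have *: "I * I = - 1" by (simp add: im_units_def power2_eq_square)
  from * have "norm I * norm I = 1" by (metis norm_minus_cancel norm_mult norm_one)
  then have n: "qRe I ^ 2 + qIm1 I ^ 2 + qIm2 I ^ 2 + qIm3 I ^ 2 = 1"
    using norm_quat_power2 [of I] by (simp add: power2_eq_square)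
  from * have "qRe I ^ 2 - qIm1 I ^ 2 - qIm2 I ^ 2 - qIm3 I ^ 2 = - 1"
    by (simp add: quat_eq_iff power2_eq_square)
  with n have "qRe I ^ 2 = 0" by linarith
  with n show "qRe I = 0 \<and> qIm1 I ^ 2 + qIm2 I ^ 2 + qIm3 I ^ 2 = 1" by simp
next
  assume "qRe I = 0 \<and> qIm1 I ^ 2 + qIm2 I ^ 2 + qIm3 I ^ 2 = 1"
  then show "I \<in> im_units"
    by (simp add: im_units_def quat_eq_iff power2_eq_square)
qed

lemma im_units_square: "I \<in> im_units \<Longrightarrow> I * I = - 1"
  by (simp add: im_units_def power2_eq_square)

lemma im_units_square_left: "I \<in> im_units \<Longrightarrow> I * (I * a) = - a"
  by (metis im_units_square mult.assoc mult_minus1)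

lemma im_units_norm: "I \<in> im_units \<Longrightarrow> norm I = 1"
  by (simp add: im_units_iff norm_quat_eq)

lemma im_units_uminus: "I \<in> im_units \<Longrightarrow> - I \<in> im_units"
  by (simp add: im_units_def)

lemma im_units_conj: "I \<in> im_units \<Longrightarrow> p \<noteq> 0 \<Longrightarrow> inverse p * I * p \<in> im_units"
proof -
  assume I: "I \<in> im_units" and p: "p \<noteq> 0"
  have "(inverse p * I * p) * (inverse p * I * p) = inverse p * (I * (p * inverse p) * I) * p"
    by (simp only: mult.assoc)
  also have "\<dots> = - 1" using I p by (simp add: im_units_square)
  finally show ?thesis by (simp add: im_units_def power2_eq_square)
qed

lemma norm_slice: "I \<in> im_units \<Longrightarrow> (norm (of_real x + of_real y * I))\<^sup>2 = x\<^sup>2 + y\<^sup>2"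
  by (simp add: im_units_iff norm_quat_power2 of_real_def power_mult_distrib)
     (simp flip: distrib_left add: add.assoc)

lemma slice_in_qsphere: "I \<in> im_units \<Longrightarrow> of_real x + of_real y * I \<in> qsphere \<longleftrightarrow> x\<^sup>2 + y\<^sup>2 = 1"
proof -
  assume "I \<in> im_units"
  then have "x\<^sup>2 + y\<^sup>2 = (norm (of_real x + of_real y * I))\<^sup>2" by (simp add: norm_slice)
  then show ?thesis
    using norm_ge_zero [of "of_real x + of_real y * I"]
    by (auto simp: qsphere_def power2_eq_1_iff simp del: norm_ge_zero)
qed

lemma qexp_in_qsphere: "I \<in> im_units \<Longrightarrow> qexp t I \<in> qsphere"
  by (simp add: qexp_def slice_in_qsphere)

lemma qsphere_cases:
  assumes "q \<in> qsphere"
  obtains x y I where "I \<in> im_units" "x\<^sup>2 + y\<^sup>2 = 1" "q = of_real x + of_real y * I"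
proof -
  define y where "y = sqrt (qIm1 q ^ 2 + qIm2 q ^ 2 + qIm3 q ^ 2)"
  have y2: "y\<^sup>2 = qIm1 q ^ 2 + qIm2 q ^ 2 + qIm3 q ^ 2" by (simp add: y_def)
  have s: "(qRe q)\<^sup>2 + y\<^sup>2 = 1"
    using assms norm_quat_power2 [of q] by (simp add: qsphere_def y2)
  show thesis
  proof (cases "y = 0")
    case True
    with y2 have "qIm1 q = 0 \<and> qIm2 q = 0 \<and> qIm3 q = 0"
      by (simp add: add_nonneg_eq_0_iff)
    with True show thesis
      by (intro that [of "Quat 0 1 0 0" "qRe q" y] s)
         (simp_all add: im_units_iff quat_eq_iff of_real_def)
  next
    case False
    define I where "I = Quat 0 (qIm1 q / y) (qIm2 q / y) (qIm3 q / y)"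
    have "I \<in> im_units"
      using False by (simp add: I_def im_units_iff power_divide y2 flip: add_divide_distrib) (simp flip: y2)
    moreover have "q = of_real (qRe q) + of_real y * I"
      using False by (simp add: I_def quat_eq_iff of_real_def)
    ultimately show thesis using that s by blast
  qed
qed


section \<open>Slice functions\<close>

text \<open>
  A function on the unit sphere is represented by a function on all quaternions, whose values off
  the sphere are irrelevant.
\<close>

definition slice_function :: "(quat \<Rightarrow> quat) \<Rightarrow> bool" where
  "slice_function f \<longleftrightarrow>
    (\<forall>J\<in>im_units. \<forall>K\<in>im_units. J \<noteq> K \<longrightarrow>
      (\<forall>x y. \<forall>I\<in>im_units. of_real x + of_real y * I \<in> qsphere \<longrightarrow>
        f (of_real x + of_real y * I) =
          (inverse (J - K) * J + I * inverse (J - K)) * f (of_real x + of_real y * J)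
          - (inverse (J - K) * K + I * inverse (J - K)) * f (of_real x + of_real y * K)))"

text \<open>
  The star product of \<open>\<Sum> q\<^sup>n a\<^sub>n\<close> and \<open>\<Sum> q\<^sup>n b\<^sub>n\<close>, which has the convolution of \<open>a\<close> and \<open>b\<close> as
  coefficients, in its pointwise form. The pointwise form makes sense for all slice functions; the
  product of two square-integrable ones need not be square-integrable.
\<close>

definition star_fun :: "(quat \<Rightarrow> quat) \<Rightarrow> (quat \<Rightarrow> quat) \<Rightarrow> quat \<Rightarrow> quat" where
  "star_fun f g q = (if f q = 0 then 0 else f q * g (inverse (f q) * q * f q))"

lemma slice_functionI:
  assumes "\<And>x y I. I \<in> im_units \<Longrightarrow> x\<^sup>2 + y\<^sup>2 = 1 \<Longrightarrow>
    f (of_real x + of_real y * I) = F x y + I * G x y"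
  shows "slice_function f"
  unfolding slice_function_def
proof (intro ballI impI allI)
  fix J K I :: quat and x y :: real
  assume J: "J \<in> im_units" and K: "K \<in> im_units" and JK: "J \<noteq> K" and I: "I \<in> im_units"
    and "of_real x + of_real y * I \<in> qsphere"
  then have xy: "x\<^sup>2 + y\<^sup>2 = 1" by (simp add: slice_in_qsphere)
  let ?d = "inverse (J - K)"
  have "(?d * J + I * ?d) * f (of_real x + of_real y * J)
      - (?d * K + I * ?d) * f (of_real x + of_real y * K)
    = (?d * J + I * ?d) * (F x y + J * G x y) - (?d * K + I * ?d) * (F x y + K * G x y)"
    using assms J K xy by simp
  also have "\<dots> = ?d * (J - K) * F x y + ?d * (J * J - K * K) * G x y + I * (?d * (J - K)) * G x y"
    by (simp add: algebra_simps)
  also have "\<dots> = F x y + I * G x y"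
    using JK J K by (simp add: im_units_square)
  finally show "f (of_real x + of_real y * I)
    = (?d * J + I * ?d) * f (of_real x + of_real y * J)
      - (?d * K + I * ?d) * f (of_real x + of_real y * K)"
    using assms I xy by simp
qed

lemma slice_functionE:
  assumes "slice_function f"
  obtains F G where "\<And>x y I. I \<in> im_units \<Longrightarrow> x\<^sup>2 + y\<^sup>2 = 1 \<Longrightarrow>
    f (of_real x + of_real y * I) = F x y + I * G x y"
proof -
  let ?J = "Quat 0 1 0 0" and ?K = "Quat 0 (- 1) 0 0"
  let ?d = "inverse (?J - ?K)"
  have JK: "?J \<in> im_units" "?K \<in> im_units" "?J \<noteq> ?K"
    by (simp_all add: im_units_iff)
  show thesis
  proof
    fix x y :: real and I :: quat
    assume I: "I \<in> im_units" and "x\<^sup>2 + y\<^sup>2 = 1"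
    then have "of_real x + of_real y * I \<in> qsphere" by (simp add: slice_in_qsphere)
    with assms JK I have "f (of_real x + of_real y * I) =
        (?d * ?J + I * ?d) * f (of_real x + of_real y * ?J)
        - (?d * ?K + I * ?d) * f (of_real x + of_real y * ?K)"
      unfolding slice_function_def by blast
    then show "f (of_real x + of_real y * I) =
      (?d * ?J * f (of_real x + of_real y * ?J) - ?d * ?K * f (of_real x + of_real y * ?K))
      + I * (?d * (f (of_real x + of_real y * ?J) - f (of_real x + of_real y * ?K)))"
      by (simp add: algebra_simps)
  qed
qed

lemma slice_function_add:
  assumes "slice_function f" "slice_function g"
  shows "slice_function (\<lambda>q. f q + g q)"
proof -
  obtain A B where f: "\<And>x y I. I \<in> im_units \<Longrightarrow> x\<^sup>2 + y\<^sup>2 = 1 \<Longrightarrow>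
    f (of_real x + of_real y * I) = A x y + I * B x y"
    by (rule slice_functionE [OF assms(1)]) blast
  obtain C D where g: "\<And>x y I. I \<in> im_units \<Longrightarrow> x\<^sup>2 + y\<^sup>2 = 1 \<Longrightarrow>
    g (of_real x + of_real y * I) = C x y + I * D x y"
    by (rule slice_functionE [OF assms(2)]) blast
  show ?thesis
    by (rule slice_functionI [of _ "\<lambda>x y. A x y + C x y" "\<lambda>x y. B x y + D x y"])
       (simp add: f g algebra_simps)
qed

lemma slice_function_mult_right:
  assumes "slice_function f"
  shows "slice_function (\<lambda>q. f q * a)"
proof -
  obtain A B where f: "\<And>x y I. I \<in> im_units \<Longrightarrow> x\<^sup>2 + y\<^sup>2 = 1 \<Longrightarrow>
    f (of_real x + of_real y * I) = A x y + I * B x y"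
    by (rule slice_functionE [OF assms]) blast
  show ?thesis
    by (rule slice_functionI [of _ "\<lambda>x y. A x y * a" "\<lambda>x y. B x y * a"])
       (simp add: f algebra_simps)
qed

lemma slice_function_uminus:
  assumes "slice_function f"
  shows "slice_function (\<lambda>q. - f q)"
  using slice_function_mult_right [OF assms, of "- 1"] by simp

lemma slice_function_const: "slice_function (\<lambda>_. a)"
  by (rule slice_functionI [of _ "\<lambda>_ _. a" "\<lambda>_ _. 0"]) simp

lemma of_real_quat_comm: "a * of_real r = of_real r * (a :: quat)"
  by (simp add: quat_eq_iff of_real_def)

lemma of_real_quat_left_comm: "a * (of_real r * b) = of_real r * (a * b :: quat)"
  by (metis mult.assoc of_real_quat_comm)

lemma slice_function_mult_q:
  assumes "slice_function f"
  shows "slice_function (\<lambda>q. q * f q)"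
proof -
  obtain A B where f: "\<And>x y I. I \<in> im_units \<Longrightarrow> x\<^sup>2 + y\<^sup>2 = 1 \<Longrightarrow>
    f (of_real x + of_real y * I) = A x y + I * B x y"
    by (rule slice_functionE [OF assms]) blast
  show ?thesis
    by (rule slice_functionI [of _ "\<lambda>x y. of_real x * A x y - of_real y * B x y"
          "\<lambda>x y. of_real x * B x y + of_real y * A x y"])
       (simp add: f algebra_simps of_real_quat_left_comm im_units_square_left)
qed

lemma slice_function_qcnj:
  assumes "slice_function f"
  shows "slice_function (\<lambda>q. f (qcnj q))"
proof -
  obtain A B where f: "\<And>x y I. I \<in> im_units \<Longrightarrow> x\<^sup>2 + y\<^sup>2 = 1 \<Longrightarrow>
    f (of_real x + of_real y * I) = A x y + I * B x y"
    by (rule slice_functionE [OF assms]) blast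
  have cnj: "qcnj (of_real x + of_real y * I) = of_real x + of_real (- y) * I"
    if "I \<in> im_units" for x y I
    using that by (simp add: quat_eq_iff im_units_iff of_real_def)
  show ?thesis
  proof (rule slice_functionI [of _ "\<lambda>x y. A x (- y)" "\<lambda>x y. B x (- y)"])
    fix x y :: real and I :: quat
    assume "I \<in> im_units" "x\<^sup>2 + y\<^sup>2 = 1"
    then show "f (qcnj (of_real x + of_real y * I)) = A x (- y) + I * B x (- y)"
      using f [of I x "- y"] cnj by simp
  qed
qed

lemma slice_function_mult_qcnj:
  assumes "slice_function f"
  shows "slice_function (\<lambda>q. qcnj q * f q)"
proof -
  have "slice_function (\<lambda>q. q * f (qcnj q))"
    by (intro slice_function_mult_q slice_function_qcnj assms)
  from slice_function_qcnj [OF this] show ?thesis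
    by (simp add: qcnj_def)
qed

lemma slice_function_cong:
  assumes "slice_function f" "\<And>q. q \<in> qsphere \<Longrightarrow> f q = g q"
  shows "slice_function g"
proof -
  obtain A B where f: "\<And>x y I. I \<in> im_units \<Longrightarrow> x\<^sup>2 + y\<^sup>2 = 1 \<Longrightarrow>
    f (of_real x + of_real y * I) = A x y + I * B x y"
    by (rule slice_functionE [OF assms(1)]) blast
  show ?thesis
    by (rule slice_functionI [of _ A B]) (simp add: f slice_in_qsphere flip: assms(2))
qed

lemma inverse_qsphere: "q \<in> qsphere \<Longrightarrow> inverse q = qcnj q"
  by (simp add: inverse_quat_def qsphere_def)

lemma slice_function_powi: "slice_function (\<lambda>q. q powi n * a)"
proof -
  have pos: "slice_function (\<lambda>q. q ^ m * a)" for m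
  proof (induction m)
    case 0
    show ?case by (simp add: slice_function_const)
  next
    case (Suc m)
    from slice_function_mult_q [OF Suc] show ?case by (simp add: mult.assoc)
  qed
  have neg: "slice_function (\<lambda>q. qcnj q ^ m * a)" for m
    by (rule slice_function_qcnj [OF pos])
  show ?thesis
  proof (cases "n \<ge> 0")
    case True
    then show ?thesis using pos by (simp add: power_int_def)
  next
    case False
    show ?thesis
      by (rule slice_function_cong [OF neg [of "nat (- n)"]])
         (use False in \<open>simp add: power_int_def inverse_qsphere\<close>)
  qed
qed

lemma conj_slice:
  assumes "p \<noteq> 0"
  shows "inverse p * (of_real x + of_real y * I) * p = of_real x + of_real y * (inverse p * I * (p :: quat))"
proof -
  have "inverse p * (of_real x + of_real y * I) * p
    = inverse p * of_real x * p + inverse p * (of_real y * I) * p"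
    by (simp add: algebra_simps)
  also have "inverse p * of_real x * p = of_real x"
    using assms by (simp add: of_real_quat_comm [of "inverse p"] mult.assoc)
  also have "inverse p * (of_real y * I) * p = of_real y * (inverse p * I * p)"
    by (simp add: of_real_quat_left_comm mult.assoc)
  finally show ?thesis .
qed

lemma slice_function_star:
  assumes "slice_function f" "slice_function g"
  shows "slice_function (star_fun f g)"
proof -
  obtain A B where f: "\<And>x y I. I \<in> im_units \<Longrightarrow> x\<^sup>2 + y\<^sup>2 = 1 \<Longrightarrow>
    f (of_real x + of_real y * I) = A x y + I * B x y"
    by (rule slice_functionE [OF assms(1)]) blast
  obtain C D where g: "\<And>x y I. I \<in> im_units \<Longrightarrow> x\<^sup>2 + y\<^sup>2 = 1 \<Longrightarrow>
    g (of_real x + of_real y * I) = C x y + I * D x y"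
    by (rule slice_functionE [OF assms(2)]) blast
  show ?thesis
  proof (rule slice_functionI [of _ "\<lambda>x y. A x y * C x y - B x y * D x y"
          "\<lambda>x y. A x y * D x y + B x y * C x y"])
    fix x y :: real and I :: quat
    assume I: "I \<in> im_units" and xy: "x\<^sup>2 + y\<^sup>2 = 1"
    define p where "p = f (of_real x + of_real y * I)"
    have p: "p = A x y + I * B x y" using f I xy by (simp add: p_def)
    have "star_fun f g (of_real x + of_real y * I) = p * C x y + I * p * D x y"
    proof (cases "p = 0")
      case True
      then show ?thesis by (simp add: star_fun_def p_def)
    next
      case False
      have "star_fun f g (of_real x + of_real y * I)
        = p * g (of_real x + of_real y * (inverse p * I * p))"
        using False by (simp add: star_fun_def conj_slice flip: p_def)
      also have "\<dots> = p * (C x y + inverse p * I * p * D x y)"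
        using g xy im_units_conj [OF I False] by simp
      also have "\<dots> = p * C x y + (p * inverse p) * (I * p * D x y)"
        by (simp only: distrib_left mult.assoc)
      finally show ?thesis using False by simp
    qed
    then show "star_fun f g (of_real x + of_real y * I)
      = A x y * C x y - B x y * D x y + I * (A x y * D x y + B x y * C x y)"
      by (simp add: p algebra_simps im_units_square_left I)
  qed
qed

lemma continuous_on_qcnj: "continuous_on A qcnj"
proof -
  have "qcnj = (\<lambda>x. 2 *\<^sub>R (inner x 1) *\<^sub>R 1 - x)"
    by (simp add: fun_eq_iff quat_eq_iff inner_quat_def)
  then show ?thesis by (rule ssubst) (intro continuous_intros)
qed

lemma measurable_qcnj [measurable]: "qcnj \<in> borel_measurable borel"
  by (intro borel_measurable_continuous_onI continuous_on_qcnj)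

lemma im_units_borel [measurable]: "im_units \<in> sets borel"
proof -
  have "im_units = {q \<in> space borel. q\<^sup>2 = - 1}" by (simp add: im_units_def)
  also have "\<dots> \<in> sets borel" by measurable
  finally show ?thesis .
qed

lemma qsphere_borel [measurable]: "qsphere \<in> sets borel"
proof -
  have "qsphere = {q \<in> space borel. norm q = 1}" by (simp add: qsphere_def)
  also have "\<dots> \<in> sets borel" by measurable
  finally show ?thesis .
qed

lemma space_area_measure [simp]: "space area_measure = im_units"
  by (simp add: area_measure_def space_restrict_space)

lemma sets_area_measure: "sets area_measure = sets (restrict_space borel im_units)"
  by (simp add: area_measure_def)

lemma space_sphere_measure [simp]: "space sphere_measure = qsphere"
  by (simp add: sphere_measure_def space_restrict_space)

lemma sets_sphere_measure: "sets sphere_measure = sets (restrict_space borel qsphere)"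
  by (simp add: sphere_measure_def)

lemma space_angle_measure [simp]: "space angle_measure = UNIV"
  by (simp add: angle_measure_def)

lemma sets_angle_measure: "sets angle_measure = sets borel"
  by (simp add: angle_measure_def)

lemma emeasure_angle_measure: "emeasure angle_measure UNIV = 1"
  by (simp add: angle_measure_def emeasure_uniform_measure_1)

lemma measurable_vec_quat [measurable]: "vec_quat \<in> borel_measurable borel"
proof -
  have "vec_quat = (\<lambda>v. (v $ 1) *\<^sub>R Quat 0 1 0 0 + (v $ 2) *\<^sub>R Quat 0 0 1 0 + (v $ 3) *\<^sub>R Quat 0 0 0 1)"
    by (simp add: fun_eq_iff quat_eq_iff vec_quat_def)
  then have "continuous_on UNIV vec_quat" by (rule ssubst) (intro continuous_intros)
  then show ?thesis by (rule borel_measurable_continuous_onI)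
qed

lemma vec_quat_im_units: "vec_quat v \<in> im_units \<longleftrightarrow> norm v = 1"
proof -
  have "norm v ^ 2 = (v $ 1)\<^sup>2 + (v $ 2)\<^sup>2 + (v $ 3)\<^sup>2"
    by (simp add: norm_vec_def L2_set_def sum_3)
  moreover have "norm v = 1 \<longleftrightarrow> norm v ^ 2 = 1"
    using norm_ge_zero [of v] by (auto simp: power2_eq_1_iff simp del: norm_ge_zero)
  ultimately show ?thesis by (simp add: vec_quat_def im_units_iff)
qed

abbreviation (input) "ball_measure \<equiv>
  uniform_measure (restrict_space lborel (ball 0 1 - {0})) (ball 0 1 - {0} :: (real ^ 3) set)"

lemma punctured_ball_measure:
  "emeasure lborel (ball 0 1 - {0} :: (real ^ 3) set) \<noteq> 0"
  "emeasure lborel (ball 0 1 - {0} :: (real ^ 3) set) < \<infinity>"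
proof -
  have "emeasure lborel (ball 0 1 - {0} :: (real ^ 3) set) = emeasure lborel (ball 0 1 :: (real ^ 3) set)"
    by (subst emeasure_Diff) auto
  also have "\<dots> = ennreal (measure lborel (ball 0 1 :: (real ^ 3) set))"
    using emeasure_lborel_ball_finite [of "0 :: real ^ 3" 1] by (intro emeasure_eq_ennreal_measure) auto
  finally have *: "emeasure lborel (ball 0 1 - {0} :: (real ^ 3) set)
    = ennreal (measure lborel (ball 0 1 :: (real ^ 3) set))" .
  have "measure lborel (ball 0 1 :: (real ^ 3) set) > 0"
    using content_ball_pos [of 1 "0 :: real ^ 3"] by simp
  with * show "emeasure lborel (ball 0 1 - {0} :: (real ^ 3) set) \<noteq> 0"
    "emeasure lborel (ball 0 1 - {0} :: (real ^ 3) set) < \<infinity>" by auto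
qed

lemma measurable_radial:
  "(\<lambda>v. vec_quat (v /\<^sub>R norm v)) \<in> ball_measure \<rightarrow>\<^sub>M restrict_space borel im_units"
proof -
  have "(\<lambda>v. vec_quat (v /\<^sub>R norm v)) \<in> restrict_space lborel (ball 0 1 - {0}) \<rightarrow>\<^sub>M restrict_space borel im_units"
    by (intro measurable_restrict_space2 measurable_restrict_space1)
       (auto simp: vec_quat_im_units space_restrict_space)
  then show ?thesis by (simp cong: measurable_cong_sets)
qed

lemma emeasure_area_measure: "emeasure area_measure im_units = 1"
proof -
  have "(\<lambda>v. vec_quat (v /\<^sub>R norm v)) -` im_units \<inter> space ball_measure = ball 0 1 - {0}"
    by (auto simp: space_restrict_space vec_quat_im_units)
  moreover have "im_units \<in> sets (restrict_space borel im_units)"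
    by (auto simp: sets_restrict_space_iff)
  ultimately have "emeasure area_measure im_units = emeasure ball_measure (ball 0 1 - {0})"
    unfolding area_measure_def by (simp add: emeasure_distr [OF measurable_radial])
  also have "\<dots> = 1"
    using punctured_ball_measure
    by (intro emeasure_uniform_measure_1) (auto simp: emeasure_restrict_space)
  finally show ?thesis .
qed

interpretation area: finite_measure area_measure
  by standard (simp add: emeasure_area_measure)

interpretation angle: finite_measure angle_measure
  by standard (simp add: emeasure_angle_measure)

interpretation angle_area: pair_sigma_finite angle_measure area_measure ..

lemma area_measure_singleton: "J \<in> im_units \<Longrightarrow> emeasure area_measure {J} = 0"
proof -
  assume J: "J \<in> im_units"
  define w :: "real ^ 3" where "w = vector [qIm1 J, qIm2 J, qIm3 J]"
  let ?A = "(\<lambda>v. vec_quat (v /\<^sub>R norm v)) -` {J} \<inter> space ball_measure"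
  have sub: "?A \<subseteq> span {w}"
  proof
    fix v assume "v \<in> ?A"
    then have "vec_quat (v /\<^sub>R norm v) = J" and v0: "v \<noteq> 0" by (auto simp: space_restrict_space)
    then have "v /\<^sub>R norm v = w"
      by (auto simp: vec_eq_iff forall_3 w_def vec_quat_def)
    then have "v = norm v *\<^sub>R w" using v0 by auto
    then show "v \<in> span {w}" by (metis insertI1 span_base span_scale)
  qed
  have "dim (span {w}) < DIM(real ^ 3)"
  proof -
    have "dim (span {w}) \<le> card {w}" by (intro dim_le_card) auto
    then show ?thesis by simp
  qed
  then have "negligible (span {w})" by (rule negligible_lowdim)
  then have null: "?A \<in> null_sets lebesgue"
    using sub negligible_subset negligible_iff_null_sets by blast
  have J': "{J} \<in> sets (restrict_space borel im_units)"
    using J by (auto simp: sets_restrict_space_iff)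
  have A: "?A \<in> sets ball_measure" by (rule measurable_sets [OF measurable_radial J'])
  then have "?A \<in> sets lborel" by (auto simp: sets_restrict_space_iff)
  with null have "emeasure lborel ?A = 0" by (auto simp: null_sets_def)
  have *: "(ball 0 1 - {0}) \<inter> ?A = ?A" by (auto simp: space_restrict_space)
  have "emeasure area_measure {J} = emeasure ball_measure ?A"
    unfolding area_measure_def by (simp add: emeasure_distr [OF measurable_radial J'])
  also have "\<dots> = 0"
    using A \<open>emeasure lborel ?A = 0\<close>
    by (subst emeasure_uniform_measure)
       (auto simp: Int_ac sets_restrict_space_iff emeasure_restrict_space space_restrict_space)
  finally show ?thesis .
qed

lemma AE_area_measure_two:
  assumes "AE I in area_measure. P I"
  obtains J K where "J \<in> im_units" "K \<in> im_units" "J \<noteq> K" "P J" "P K"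
proof -
  have ex: "\<exists>I\<in>im_units. Q I" if "AE I in area_measure. Q I" for Q
  proof (rule ccontr)
    assume *: "\<not> (\<exists>I\<in>im_units. Q I)"
    have "AE I in area_measure. I \<in> im_units"
      using AE_space [of area_measure] by simp
    with that have "AE I in area_measure. \<not> True"
      by eventually_elim (use * in blast)
    from emeasure_eq_0_AE [OF this] have "emeasure area_measure im_units = 0" by simp
    then show False by (simp add: emeasure_area_measure)
  qed
  from ex [OF assms] obtain J where J: "J \<in> im_units" "P J" by blast
  have "{J} \<in> null_sets area_measure"
    using J by (auto simp: area_measure_singleton sets_area_measure sets_restrict_space_iff)
  then have "AE I in area_measure. I \<notin> {J}" by (rule AE_not_in)
  with assms have "AE I in area_measure. P I \<and> I \<noteq> J" by eventually_elim auto
  from ex [OF this] J that show thesis by blast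
qed

lemma measurable_qexp:
  "(\<lambda>(t, I). qexp t I) \<in> angle_measure \<Otimes>\<^sub>M area_measure \<rightarrow>\<^sub>M restrict_space borel qsphere"
proof (rule measurable_restrict_space2)
  show "(\<lambda>(t, I). qexp t I) \<in> space (angle_measure \<Otimes>\<^sub>M area_measure) \<rightarrow> qsphere"
    by (auto simp: space_pair_measure qexp_in_qsphere)
  have [measurable_cong]: "sets angle_measure = sets borel" by (rule sets_angle_measure)
  have [measurable]: "(\<lambda>x. x) \<in> area_measure \<rightarrow>\<^sub>M borel"
    by (simp add: measurable_restrict_space1 cong: measurable_cong_sets [OF sets_area_measure])
  show "(\<lambda>(t, I). qexp t I) \<in> angle_measure \<Otimes>\<^sub>M area_measure \<rightarrow>\<^sub>M borel"
    unfolding qexp_def of_real_def by measurable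
qed

lemma AE_sphere_measureD:
  assumes "AE q in sphere_measure. P q"
  shows "AE t in angle_measure. AE I in area_measure. P (qexp t I)"
proof -
  have "AE x in angle_measure \<Otimes>\<^sub>M area_measure. P (case x of (t, I) \<Rightarrow> qexp t I)"
    using assms measurable_qexp unfolding sphere_measure_def by (rule AE_distrD [rotated])
  then have "AE t in angle_measure. AE I in area_measure. P (case (t, I) of (t, I) \<Rightarrow> qexp t I)"
    by (rule angle_area.AE_pair)
  then show ?thesis by simp
qed

lemma AE_sphere_measureI:
  assumes "{q \<in> qsphere. P q} \<in> sets (restrict_space borel qsphere)"
    and "AE t in angle_measure. \<forall>I\<in>im_units. P (qexp t I)"
  shows "AE q in sphere_measure. P q"
proof -
  have meas: "{q \<in> space (restrict_space borel qsphere). P q} \<in> sets (restrict_space borel qsphere)"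
    using assms(1) by (simp add: space_restrict_space)
  have meas2: "{x \<in> space (angle_measure \<Otimes>\<^sub>M area_measure). P (case x of (t, I) \<Rightarrow> qexp t I)}
    \<in> sets (angle_measure \<Otimes>\<^sub>M area_measure)"
    using measurable_sets [OF measurable_qexp meas]
    by (rule back_subst [of "\<lambda>A. A \<in> _"]) (auto simp: space_pair_measure space_restrict_space qexp_in_qsphere)
  have "AE t in angle_measure. AE I in area_measure. P (case (t, I) of (t, I) \<Rightarrow> qexp t I)"
    using assms(2) by eventually_elim auto
  then have "AE x in angle_measure \<Otimes>\<^sub>M area_measure. P (case x of (t, I) \<Rightarrow> qexp t I)"
    using meas2 by (intro angle_area.AE_pair_measure) auto
  then show ?thesis
    unfolding sphere_measure_def by (simp add: AE_distr_iff [OF measurable_qexp meas])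
qed

lemma measurable_sphere_measure: "measurable sphere_measure N = measurable (restrict_space borel qsphere) N"
  by (rule measurable_cong_sets [OF sets_sphere_measure refl])

lemma slice_AE_eq_circles:
  assumes "slice_function f" "slice_function g" "AE q in sphere_measure. f q = g q"
  shows "AE t in angle_measure. \<forall>I\<in>im_units. f (qexp t I) = g (qexp t I)"
proof -
  have "AE t in angle_measure. AE I in area_measure. f (qexp t I) = g (qexp t I)"
    by (rule AE_sphere_measureD [OF assms(3)])
  then show ?thesis
  proof eventually_elim
    case (elim t)
    then obtain J K where JK: "J \<in> im_units" "K \<in> im_units" "J \<noteq> K"
      "f (qexp t J) = g (qexp t J)" "f (qexp t K) = g (qexp t K)"
      by (rule AE_area_measure_two)
    show ?case
    proof
      fix I assume I: "I \<in> im_units"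
      then have "qexp t I \<in> qsphere" by (rule qexp_in_qsphere)
      have "h (qexp t I) = (inverse (J - K) * J + I * inverse (J - K)) * h (qexp t J)
          - (inverse (J - K) * K + I * inverse (J - K)) * h (qexp t K)" if "slice_function h" for h
        using that JK(1-3) I \<open>qexp t I \<in> qsphere\<close> unfolding slice_function_def qexp_def by blast
      from this [OF assms(1)] this [OF assms(2)] JK(4,5) show "f (qexp t I) = g (qexp t I)"
        by simp
    qed
  qed
qed

lemma measurable_star_fun:
  assumes f: "f \<in> borel_measurable sphere_measure" and g: "g \<in> borel_measurable sphere_measure"
  shows "star_fun f g \<in> borel_measurable sphere_measure"
proof -
  have id [measurable]: "(\<lambda>q. q) \<in> borel_measurable sphere_measure"
    by (simp add: measurable_sphere_measure measurable_restrict_space1)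
  note f [measurable]
  define h where "h q = (if f q = 0 then 1 else inverse (f q) * q * f q)" for q
  have "h \<in> sphere_measure \<rightarrow>\<^sub>M restrict_space borel qsphere"
  proof (rule measurable_restrict_space2)
    show "h \<in> space sphere_measure \<rightarrow> qsphere"
      by (auto simp: h_def qsphere_def norm_mult norm_inverse)
    show "h \<in> borel_measurable sphere_measure"
      unfolding h_def by measurable
  qed
  then have [measurable]: "(\<lambda>q. g (h q)) \<in> borel_measurable sphere_measure"
    by (rule measurable_compose) (use g in \<open>simp add: measurable_sphere_measure\<close>)
  have "star_fun f g = (\<lambda>q. f q * g (h q))"
    by (auto simp: star_fun_def h_def fun_eq_iff)
  then show ?thesis by simp
qed

lemma star_fun_AE_cong:
  assumes "slice_function f" "slice_function f'" "slice_function g" "slice_function g'"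
    and meas [measurable]: "f \<in> borel_measurable sphere_measure" "f' \<in> borel_measurable sphere_measure"
      "g \<in> borel_measurable sphere_measure" "g' \<in> borel_measurable sphere_measure"
    and "AE q in sphere_measure. f q = f' q" "AE q in sphere_measure. g q = g' q"
  shows "AE q in sphere_measure. star_fun f g q = star_fun f' g' q"
proof (rule AE_sphere_measureI)
  have [measurable]: "star_fun f g \<in> borel_measurable sphere_measure"
    "star_fun f' g' \<in> borel_measurable sphere_measure"
    by (intro measurable_star_fun meas)+
  have "{q \<in> space sphere_measure. star_fun f g q = star_fun f' g' q} \<in> sets sphere_measure"
    by measurable
  then show "{q \<in> qsphere. star_fun f g q = star_fun f' g' q} \<in> sets (restrict_space borel qsphere)"
    by (simp add: sets_sphere_measure)
  have "AE t in angle_measure. \<forall>I\<in>im_units. f (qexp t I) = f' (qexp t I)"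
    by (rule slice_AE_eq_circles) fact+
  moreover have "AE t in angle_measure. \<forall>I\<in>im_units. g (qexp t I) = g' (qexp t I)"
    by (rule slice_AE_eq_circles) fact+
  ultimately show "AE t in angle_measure. \<forall>I\<in>im_units.
    star_fun f g (qexp t I) = star_fun f' g' (qexp t I)"
  proof eventually_elim
    case (elim t)
    show ?case
    proof
      fix I assume I: "I \<in> im_units"
      have "g (inverse p * qexp t I * p) = g' (inverse p * qexp t I * p)" if "p \<noteq> 0" for p
        using elim(2) im_units_conj [OF I that] by (simp add: qexp_def conj_slice [OF that])
      with elim(1) I show "star_fun f g (qexp t I) = star_fun f' g' (qexp t I)"
        by (simp add: star_fun_def)
    qed
  qed
qed

lemma qcnj_AE_cong:
  assumes "slice_function f" "slice_function f'"
    and meas: "f \<in> borel_measurable sphere_measure" "f' \<in> borel_measurable sphere_measure"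
    and "AE q in sphere_measure. f q = f' q"
  shows "AE q in sphere_measure. f (qcnj q) = f' (qcnj q)"
    and "(\<lambda>q. f (qcnj q)) \<in> borel_measurable sphere_measure"
proof -
  have "qcnj \<in> restrict_space borel qsphere \<rightarrow>\<^sub>M restrict_space borel qsphere"
    by (intro measurable_restrict_space2 measurable_restrict_space1 measurable_qcnj)
       (auto simp: qsphere_def norm_quat_eq space_restrict_space)
  then have m [measurable]: "(\<lambda>q. h (qcnj q)) \<in> borel_measurable sphere_measure"
    if "h \<in> borel_measurable sphere_measure" for h :: "quat \<Rightarrow> quat"
    using that unfolding measurable_sphere_measure by (rule measurable_compose)
  then show "(\<lambda>q. f (qcnj q)) \<in> borel_measurable sphere_measure" using meas by blast
  note [measurable] = m [OF meas(1)] m [OF meas(2)]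
  show "AE q in sphere_measure. f (qcnj q) = f' (qcnj q)"
  proof (rule AE_sphere_measureI)
    have "{q \<in> space sphere_measure. f (qcnj q) = f' (qcnj q)} \<in> sets sphere_measure"
      by measurable
    then show "{q \<in> qsphere. f (qcnj q) = f' (qcnj q)} \<in> sets (restrict_space borel qsphere)"
      by (simp add: sets_sphere_measure)
    have "AE t in angle_measure. \<forall>I\<in>im_units. f (qexp t I) = f' (qexp t I)"
      by (rule slice_AE_eq_circles) fact+
    then show "AE t in angle_measure. \<forall>I\<in>im_units. f (qcnj (qexp t I)) = f' (qcnj (qexp t I))"
    proof eventually_elim
      case (elim t)
      have "qcnj (qexp t I) = qexp t (- I)" if "I \<in> im_units" for I
        using that by (simp add: quat_eq_iff im_units_iff of_real_def qexp_def)
      with elim show ?case using im_units_uminus by simp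
    qed
  qed
qed


subsection \<open>Slice functions modulo equality almost everywhere\<close>

text \<open>
  Equality almost everywhere is only considered between slice functions. This is what makes the
  pointwise formula for the star product independent of representatives: two slice functions that
  agree almost everywhere agree on the whole set \<open>{cos t + I sin t | I}\<close> for almost every \<open>t\<close>.
\<close>

definition slice_rel :: "(quat \<Rightarrow> quat) \<Rightarrow> (quat \<Rightarrow> quat) \<Rightarrow> bool" where
  "slice_rel f g \<longleftrightarrow>
    slice_function f \<and> f \<in> borel_measurable sphere_measure \<and>
    slice_function g \<and> g \<in> borel_measurable sphere_measure \<and>
    (AE q in sphere_measure. f q = g q)"

quotient_type slice_class = "quat \<Rightarrow> quat" / partial: slice_rel
proof (rule part_equivpI)
  show "\<exists>f. slice_rel f f"
    by (intro exI [of _ "\<lambda>_. 0"]) (simp add: slice_rel_def slice_function_const)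
  show "symp slice_rel"
    by (auto simp: symp_def slice_rel_def eq_commute)
  show "transp slice_rel"
    unfolding transp_def slice_rel_def by (auto elim!: AE_mp)
qed

instantiation slice_class :: ab_group_add
begin

lift_definition zero_slice_class :: slice_class is "\<lambda>_. 0"
  by (simp add: slice_rel_def slice_function_const)

lift_definition plus_slice_class :: "slice_class \<Rightarrow> slice_class \<Rightarrow> slice_class" is
  "\<lambda>f g q. f q + g q"
  by (auto simp: slice_rel_def intro: slice_function_add)

lift_definition uminus_slice_class :: "slice_class \<Rightarrow> slice_class" is "\<lambda>f q. - f q"
  by (auto simp: slice_rel_def intro: slice_function_uminus)

definition minus_slice_class :: "slice_class \<Rightarrow> slice_class \<Rightarrow> slice_class" where
  "minus_slice_class f g = f + (- g)"

instance
proof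
  fix a b c :: slice_class
  show "a + b + c = a + (b + c)"
    by transfer (auto simp: slice_rel_def add.assoc intro: slice_function_add)
  show "a + b = b + a"
    by transfer (auto simp: slice_rel_def add.commute intro: slice_function_add)
  show "0 + a = a"
    by transfer (simp add: slice_rel_def)
  show "- a + a = 0"
    by transfer (simp add: slice_rel_def slice_function_const)
  show "a - b = a + (- b)"
    by (rule minus_slice_class_def)
qed

end

lift_definition scale_right :: "slice_class \<Rightarrow> quat \<Rightarrow> slice_class" is "\<lambda>f a q. f q * a"
  by (auto simp: slice_rel_def intro: slice_function_mult_right)

lift_definition qmonom :: "int \<Rightarrow> quat \<Rightarrow> slice_class" is "\<lambda>n a q. q powi n * a"
proof -
  fix n :: int and a :: quat
  have [measurable]: "(\<lambda>q. q) \<in> borel_measurable sphere_measure"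
    by (simp add: measurable_sphere_measure measurable_restrict_space1)
  have "(\<lambda>q. q powi n * a) \<in> borel_measurable sphere_measure"
    unfolding power_int_def by (cases "n \<ge> 0") simp_all
  then show "slice_rel (\<lambda>q. q powi n * a) (\<lambda>q. q powi n * a)"
    by (simp add: slice_rel_def slice_function_powi)
qed

lift_definition Mq :: "slice_class \<Rightarrow> slice_class" is "\<lambda>f q. q * f q"
proof -
  fix f g :: "quat \<Rightarrow> quat"
  have [measurable]: "(\<lambda>q. q) \<in> borel_measurable sphere_measure"
    by (simp add: measurable_sphere_measure measurable_restrict_space1)
  assume "slice_rel f g"
  then show "slice_rel (\<lambda>q. q * f q) (\<lambda>q. q * g q)"
    by (auto simp: slice_rel_def intro: slice_function_mult_q)
qed

lift_definition tilde :: "slice_class \<Rightarrow> slice_class" is "\<lambda>f q. f (qcnj q)"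
  unfolding slice_rel_def using qcnj_AE_cong slice_function_qcnj by blast

lift_definition star :: "slice_class \<Rightarrow> slice_class \<Rightarrow> slice_class" (infixl "\<star>" 70) is star_fun
proof -
  fix f f' g g'
  assume "slice_rel f f'" "slice_rel g g'"
  then show "slice_rel (star_fun f g) (star_fun f' g')"
    using star_fun_AE_cong [of f f' g g']
    by (simp add: slice_rel_def slice_function_star measurable_star_fun)
qed

lift_definition sqnorm :: "slice_class \<Rightarrow> ennreal" is
  "\<lambda>f. \<integral>\<^sup>+ q. ennreal ((norm (f q))\<^sup>2) \<partial>sphere_measure"
  by (auto simp: slice_rel_def intro!: nn_integral_cong_AE)

lemma Mq_eq_star: "Mq f = qmonom 1 1 \<star> f"
proof transfer
  fix f assume "slice_rel f f"
  moreover have "star_fun (\<lambda>q. q powi 1 * 1) f = (\<lambda>q. q * f q)"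
    by (auto simp: star_fun_def fun_eq_iff)
  moreover have [measurable]: "(\<lambda>q. q) \<in> borel_measurable sphere_measure"
    by (simp add: measurable_sphere_measure measurable_restrict_space1)
  ultimately show "slice_rel (\<lambda>q. q * f q) (star_fun (\<lambda>q. q powi 1 * 1) f)"
    by (auto simp: slice_rel_def intro: slice_function_mult_q)
qed


section \<open>The Hilbert space of square-integrable slice functions\<close>

definition L2s :: "slice_class set" where
  "L2s = {f. sqnorm f < \<infinity>}"

definition L2s_tendsto :: "(nat \<Rightarrow> slice_class) \<Rightarrow> slice_class \<Rightarrow> bool" where
  "L2s_tendsto X f \<longleftrightarrow> (\<lambda>n. sqnorm (X n - f)) \<longlonglongrightarrow> 0"

definition right_subspace :: "slice_class set \<Rightarrow> bool" where
  "right_subspace K \<longleftrightarrow> 0 \<in> K \<and> (\<forall>f\<in>K. \<forall>g\<in>K. f + g \<in> K) \<and> (\<forall>f\<in>K. \<forall>a. scale_right f a \<in> K)"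

definition L2s_closed :: "slice_class set \<Rightarrow> bool" where
  "L2s_closed K \<longleftrightarrow> (\<forall>X f. (\<forall>n. X n \<in> K) \<and> f \<in> L2s \<and> L2s_tendsto X f \<longrightarrow> f \<in> K)"

text \<open>
  \<open>has_coeffs f a\<close> means that \<open>f\<close> is the sum of the series with terms \<open>q\<^sup>n a\<^sub>n\<close>, with convergence of
  the symmetric partial sums in the norm. The monomials \<open>q\<^sup>n\<close> are orthonormal, so the coefficients
  are then unique and square-summable.
\<close>

definition has_coeffs :: "slice_class \<Rightarrow> (int \<Rightarrow> quat) \<Rightarrow> bool" where
  "has_coeffs f a \<longleftrightarrow> L2s_tendsto (\<lambda>N. \<Sum>n = - int N..int N. qmonom n (a n)) f"

text \<open>
  The conjugate is only meaningful on \<open>L2s\<close>, where coefficients exist.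
\<close>

definition slice_conj :: "slice_class \<Rightarrow> slice_class" where
  "slice_conj f = (THE g. \<exists>a. has_coeffs f a \<and> has_coeffs g (\<lambda>n. qcnj (a n)))"

end

theory Submission
  imports Defs
begin

text \<open>
  The values of a slice function on the sphere of points with real part \<open>x\<close> are \<open>a + I b\<close> with
  quaternions \<open>a\<close>, \<open>b\<close> that depend on \<open>x\<close> alone. Replacing \<open>I\<close> by a central unit \<open>\<iota>\<close> turns a slice
  function into a function \<open>F = a + \<iota> b\<close> of the real variable \<open>x\<close> with values in the complexified
  quaternions, which are the complex two-by-two matrices. Under this translation the star product
  becomes the pointwise product (\<open>has_comps_star\<close>), the square norm becomes the integral of
  \<open>|a|\<^sup>2 + |b|\<^sup>2\<close> against the law of the real part (\<open>has_comps_sqnorm\<close>), multiplication by \<open>q\<close> becomes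
  multiplication by a scalar of modulus one, and the condition on \<open>\<phi>\<close> says that its values \<open>P\<close> satisfy
  \<open>P P\<^sup>* = P\<close>, i.e. are orthogonal projections (\<open>tilde_star_conj_iff_projection\<close>). The theorem is thus
  the description of the right ideals of a matrix algebra, measurably in \<open>x\<close>: each is generated by
  exactly one orthogonal projection.

  If \<open>K\<close> is doubly invariant, the projection is obtained without any choice by projecting the constant
  function 1 orthogonally on \<open>K\<close>. Its residue is orthogonal to \<open>q\<^sup>n g a\<close> for all \<open>g\<close> in \<open>K\<close>, integers
  \<open>n\<close> and quaternions \<open>a\<close>, and uniqueness of Fourier coefficients (\<open>fourier_unique\<close>) upgrades this to
  pointwise identities, which say that the values are projections and act as the identity on \<open>K\<close>
  (\<open>ex_projection_onto\<close>). Since a projection is bounded, multiplication by it is continuous, and the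
  density of trigonometric polynomials (\<open>fourier_series_converges\<close>) shows that all its multiples lie
  in \<open>K\<close> (\<open>projection_star_mem\<close>). A projection is determined by its range, whence uniqueness
  (\<open>projection_eqI\<close>). In the other direction, \<open>K = \<phi> \<star> L2s\<close> is doubly invariant because powers of \<open>q\<close>
  commute with \<open>\<phi>\<close> and act bijectively on the space (\<open>shift_star\<close>, \<open>shift_shift\<close>).

  The analytic groundwork consists of the projection theorem and orthonormal expansions in real
  Hilbert spaces, the completeness of the space of square-integrable slice functions, and the fact that
  an integrable function on a compact interval is determined by its moments.
\<close>

section \<open>Hilbert spaces, square means and moments\<close>

lemma parallelogram:
  fixes u v :: "'a::real_inner"
  shows "(norm (u - v))\<^sup>2 + (norm (u + v))\<^sup>2 = 2 * (norm u)\<^sup>2 + 2 * (norm v)\<^sup>2"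
  by (simp add: power2_norm_eq_inner inner_add_left inner_add_right inner_diff_left
      inner_diff_right inner_commute)

text \<open>
  A sequence in \<open>V\<close> whose distance to \<open>f\<close> approaches the infimum is Cauchy by the parallelogram law,
  because the midpoint of two of its members is again in \<open>V\<close> and hence no closer to \<open>f\<close> than the
  infimum. Its limit is a nearest point, and a nearest point has orthogonal residue.
\<close>

lemma orthogonal_projection_exists:
  fixes V :: "'a::{real_inner, complete_space} set"
  assumes V: "subspace V" "closed V"
  shows "\<exists>p\<in>V. \<forall>h\<in>V. inner (f - p) h = 0"
proof -
  define d where "d = (INF g\<in>V. (norm (f - g))\<^sup>2)"
  have bdd: "bdd_below ((\<lambda>g. (norm (f - g))\<^sup>2) ` V)" by (rule bdd_belowI [of _ 0]) auto
  have V0: "V \<noteq> {}" using subspace_0 [OF V(1)] by blast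
  have d_le: "d \<le> (norm (f - g))\<^sup>2" if "g \<in> V" for g
    unfolding d_def using bdd that by (intro cINF_lower)
  have "\<exists>g\<in>V. (norm (f - g))\<^sup>2 < d + 1 / Suc n" for n
    using cINF_less_iff [OF V0 bdd, of "d + 1 / Suc n"] unfolding d_def by simp
  then obtain g where g: "\<And>n. g n \<in> V" "\<And>n. (norm (f - g n))\<^sup>2 < d + 1 / Suc n" by metis
  have near: "(norm (g m - g n))\<^sup>2 \<le> 2 / Suc m + 2 / Suc n" for m n
  proof -
    have mid: "(1/2) *\<^sub>R (g m + g n) \<in> V" by (intro subspace_scale subspace_add V g)
    have "(norm ((f - g n) - (f - g m)))\<^sup>2 + (norm ((f - g n) + (f - g m)))\<^sup>2
        = 2 * (norm (f - g n))\<^sup>2 + 2 * (norm (f - g m))\<^sup>2" by (rule parallelogram)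
    moreover have "(f - g n) + (f - g m) = 2 *\<^sub>R (f - (1/2) *\<^sub>R (g m + g n))"
      by (simp add: scaleR_2 scaleR_diff_right algebra_simps)
    ultimately show ?thesis
      using d_le [OF mid] g(2) [of n] g(2) [of m] by (simp add: power_mult_distrib)
  qed
  have "Cauchy g"
  proof (rule metric_CauchyI)
    fix e :: real assume "e > 0"
    then obtain N where N: "4 / e\<^sup>2 < real N" using reals_Archimedean2 by blast
    have "dist (g m) (g n) < e" if "m \<ge> N" "n \<ge> N" for m n
    proof -
      have e2: "4 / real (Suc N) < e\<^sup>2"
        using N \<open>e > 0\<close> by (simp add: field_simps) (smt (verit) zero_less_power)
      have "2 / real (Suc m) \<le> 2 / real (Suc N)" "2 / real (Suc n) \<le> 2 / real (Suc N)"
        using that by (auto intro!: divide_left_mono)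
      then have "(norm (g m - g n))\<^sup>2 < e\<^sup>2" using near [of m n] e2 by simp
      then show ?thesis using \<open>e > 0\<close> by (simp add: dist_norm power2_less_imp_less)
    qed
    then show "\<exists>N. \<forall>m\<ge>N. \<forall>n\<ge>N. dist (g m) (g n) < e" by blast
  qed
  then obtain p where p: "g \<longlonglongrightarrow> p" using Cauchy_convergent convergent_def by blast
  then have pV: "p \<in> V" using closed_sequentially [OF V(2)] g(1) by blast
  have "(\<lambda>n. d + 1 / Suc n) \<longlonglongrightarrow> d + 0"
    by (intro tendsto_add tendsto_const) (rule LIMSEQ_Suc [OF lim_1_over_n])
  moreover have "(\<lambda>n. (norm (f - g n))\<^sup>2) \<longlonglongrightarrow> (norm (f - p))\<^sup>2"
    by (intro tendsto_intros p)
  ultimately have pd: "(norm (f - p))\<^sup>2 \<le> d"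
    using g(2) by (intro LIMSEQ_le [of _ _ _ "d"]) (auto intro: less_imp_le)
  have "inner (f - p) h = 0" if h: "h \<in> V" for h
  proof (cases "h = 0")
    case False
    define c where "c = inner (f - p) h / (norm h)\<^sup>2"
    have "p + c *\<^sub>R h \<in> V" by (intro subspace_add subspace_scale V pV h)
    then have "(norm (f - p))\<^sup>2 \<le> (norm ((f - p) - c *\<^sub>R h))\<^sup>2"
      using order_trans [OF pd d_le] by (simp only: diff_diff_eq)
    also have "\<dots> = (norm (f - p))\<^sup>2 - 2 * c * inner (f - p) h + c\<^sup>2 * (norm h)\<^sup>2"
      by (simp add: power2_norm_eq_inner inner_diff_left inner_diff_right inner_commute algebra_simps)
        (simp add: power2_eq_square)
    also have "\<dots> = (norm (f - p))\<^sup>2 - (inner (f - p) h)\<^sup>2 / (norm h)\<^sup>2"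
      using False by (simp add: c_def power2_eq_square)
    finally have "(inner (f - p) h)\<^sup>2 / (norm h)\<^sup>2 \<le> 0" by simp
    then show ?thesis using False by (simp add: divide_le_0_iff)
  qed simp
  with pV show ?thesis by blast
qed

text \<open>
  The squared distance of two partial sums is the corresponding block of the series of squared
  coefficients, which converges by Bessel's inequality. Hence the partial sums are Cauchy. The limit
  is the projection of \<open>f\<close> on the closed span of the \<open>e i\<close>; that it is \<open>f\<close> itself is a separate
  matter of completeness of the system.
\<close>

lemma orthonormal_expansion:
  fixes e :: "'i \<Rightarrow> 'a::{real_inner, complete_space}" and A :: "nat \<Rightarrow> 'i set"
  assumes orth: "\<And>N i j. i \<in> A N \<Longrightarrow> j \<in> A N \<Longrightarrow> inner (e i) (e j) = (if i = j then 1 else 0)"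
    and fin: "\<And>N. finite (A N)" and mono: "incseq A"
  obtains g where "(\<lambda>N. \<Sum>i\<in>A N. inner f (e i) *\<^sub>R e i) \<longlonglongrightarrow> g"
    "\<And>N i. i \<in> A N \<Longrightarrow> inner (f - g) (e i) = 0"
proof -
  define S where "S N = (\<Sum>i\<in>A N. inner f (e i) *\<^sub>R e i)" for N
  define T where "T N = (\<Sum>i\<in>A N. (inner f (e i))\<^sup>2)" for N
  have inner_S: "inner (\<Sum>i\<in>B. inner f (e i) *\<^sub>R e i) (e j) = (if j \<in> B then inner f (e j) else 0)"
    if B: "B \<subseteq> A N" and j: "j \<in> A N" for B N j
  proof -
    have "finite B" using B fin finite_subset by blast
    have "inner (\<Sum>i\<in>B. inner f (e i) *\<^sub>R e i) (e j) = (\<Sum>i\<in>B. if i = j then inner f (e i) else 0)"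
      unfolding inner_sum_left using B j by (intro sum.cong) (auto simp: orth [of _ N])
    also have "\<dots> = (if j \<in> B then inner f (e j) else 0)" using \<open>finite B\<close> by (simp add: sum.delta)
    finally show ?thesis .
  qed
  have norm_S: "(norm (\<Sum>i\<in>B. inner f (e i) *\<^sub>R e i))\<^sup>2 = (\<Sum>i\<in>B. (inner f (e i))\<^sup>2)"
    if B: "B \<subseteq> A N" for B N
  proof -
    have "(norm (\<Sum>i\<in>B. inner f (e i) *\<^sub>R e i))\<^sup>2
      = (\<Sum>j\<in>B. inner f (e j) * inner (\<Sum>i\<in>B. inner f (e i) *\<^sub>R e i) (e j))"
      unfolding power2_norm_eq_inner by (subst inner_sum_right) simp
    also have "\<dots> = (\<Sum>j\<in>B. (inner f (e j))\<^sup>2)"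
      using B by (intro sum.cong refl) (simp add: inner_S [OF B] subset_iff power2_eq_square)
    finally show ?thesis .
  qed
  have T_le: "T N \<le> (norm f)\<^sup>2" for N
  proof -
    have "inner f (S N) = T N"
      by (simp add: S_def T_def inner_sum_right power2_eq_square)
    moreover have "(norm (S N))\<^sup>2 = T N" using norm_S [of "A N" N] by (simp add: S_def T_def)
    moreover have "(norm (f - S N))\<^sup>2 = (norm f)\<^sup>2 - 2 * inner f (S N) + (norm (S N))\<^sup>2"
      by (simp add: power2_norm_eq_inner inner_diff_left inner_diff_right inner_commute)
    ultimately have "(norm (f - S N))\<^sup>2 = (norm f)\<^sup>2 - T N" by simp
    then show ?thesis by (smt (verit) zero_le_power2)
  qed
  have diff: "(norm (S N - S M))\<^sup>2 = T N - T M" if "M \<le> N" for M N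
  proof -
    have sub: "A M \<subseteq> A N" using mono that by (auto simp: incseq_def)
    have "S N - S M = (\<Sum>i\<in>A N - A M. inner f (e i) *\<^sub>R e i)"
      using sum_diff [OF fin sub, of "\<lambda>i. inner f (e i) *\<^sub>R e i"] by (simp add: S_def)
    moreover have "T N - T M = (\<Sum>i\<in>A N - A M. (inner f (e i))\<^sup>2)"
      using sum_diff [OF fin sub, of "\<lambda>i. (inner f (e i))\<^sup>2"] by (simp add: T_def)
    ultimately show ?thesis using norm_S [of "A N - A M" N] by simp
  qed
  have "incseq T"
    using diff by (intro incseq_SucI) (metis diff_ge_0_iff_ge le_SucI order_refl zero_le_power2)
  then obtain L where "T \<longlonglongrightarrow> L" using incseq_convergent T_le by blast
  then have CT: "Cauchy T" by (rule LIMSEQ_imp_Cauchy)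
  have "Cauchy S"
  proof (rule metric_CauchyI)
    fix r :: real assume "r > 0"
    then obtain N where N: "\<And>m n. m \<ge> N \<Longrightarrow> n \<ge> N \<Longrightarrow> dist (T m) (T n) < r\<^sup>2"
      using metric_CauchyD [OF CT, of "r\<^sup>2"] by auto
    have "dist (S m) (S n) < r" if "m \<ge> N" "n \<ge> N" for m n
    proof -
      have "(norm (S m - S n))\<^sup>2 = \<bar>T m - T n\<bar>"
      proof (cases "n \<le> m")
        case True
        then show ?thesis using diff [OF True] by (metis abs_of_nonneg zero_le_power2)
      next
        case False
        then show ?thesis using diff [of m n]
          by (metis abs_minus_commute abs_of_nonneg nle_le norm_minus_commute zero_le_power2)
      qed
      then have "(norm (S m - S n))\<^sup>2 < r\<^sup>2" using N [OF that] by (simp add: dist_real_def)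
      then show ?thesis using \<open>r > 0\<close> by (simp add: dist_norm power2_less_imp_less)
    qed
    then show "\<exists>N. \<forall>m\<ge>N. \<forall>n\<ge>N. dist (S m) (S n) < r" by blast
  qed
  then obtain g where g: "S \<longlonglongrightarrow> g" using Cauchy_convergent convergent_def by blast
  have "inner (f - g) (e i) = 0" if i: "i \<in> A N" for N i
  proof -
    have "(\<lambda>n. inner (S n) (e i)) \<longlonglongrightarrow> inner g (e i)" by (intro tendsto_intros g)
    moreover have "\<forall>\<^sub>F n in sequentially. inner (S n) (e i) = inner f (e i)"
      using eventually_ge_at_top [of N]
    proof eventually_elim
      case (elim n)
      then have "i \<in> A n" using mono i by (auto simp: incseq_def)
      then show ?case using inner_S [of "A n" n i] by (simp add: S_def)
    qed
    then have "(\<lambda>n. inner (S n) (e i)) \<longlonglongrightarrow> inner f (e i)" by (rule tendsto_eventually)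
    ultimately have "inner g (e i) = inner f (e i)" by (rule LIMSEQ_unique)
    then show ?thesis by (simp add: inner_diff_left)
  qed
  with g show thesis using that unfolding S_def by blast
qed

text \<open>
  The Riesz-Fischer argument: consecutive differences that decay geometrically in square mean
  are summable almost everywhere, so the sequence converges pointwise, and Fatou's lemma turns the
  pointwise limit into a limit in square mean.
\<close>

lemma L2_fast_Cauchy_limit:
  fixes F :: "nat \<Rightarrow> 'a \<Rightarrow> 'b::{banach, second_countable_topology}"
  assumes fin: "finite_measure M"
    and [measurable]: "\<And>n. F n \<in> borel_measurable M"
    and fast: "\<And>m n. n \<le> m \<Longrightarrow> (\<integral>\<^sup>+ x. ennreal ((norm (F n x - F m x))\<^sup>2) \<partial>M) \<le> ennreal ((1/4) ^ n)"
  obtains G where "G \<in> borel_measurable M" "AE x in M. (\<lambda>n. F n x) \<longlonglongrightarrow> G x"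
    "\<And>n. (\<integral>\<^sup>+ x. ennreal ((norm (F n x - G x))\<^sup>2) \<partial>M) \<le> ennreal ((1/4) ^ n)"
proof -
  interpret finite_measure M by fact
  define D where "D n x = norm (F n x - F (Suc n) x)" for n x
  have D0: "0 \<le> D n x" for n x by (simp add: D_def)
  have [measurable]: "D n \<in> borel_measurable M" for n unfolding D_def by measurable
  define c where "c = measure M (space M)"
  have L1: "(\<integral>\<^sup>+ x. ennreal (D n x) \<partial>M) \<le> ennreal ((1 + c) * (1/2) ^ n)" for n
  proof -
    \<comment> \<open>The weights \<open>2 ^ n\<close> balance the two terms after integration; this replaces the
      Cauchy-Schwarz inequality in passing from square mean to mean.\<close>
    have pw: "D n x \<le> 2 ^ n * (D n x)\<^sup>2 + (1/2) ^ n" for x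
    proof -
      have "0 \<le> (2 ^ n * D n x - 1)\<^sup>2" by simp
      then have "2 * (2 ^ n * D n x) \<le> (2 ^ n * D n x)\<^sup>2 + 1"
        by (simp add: power2_diff)
      then have "2 ^ n * D n x \<le> (2 ^ n * D n x)\<^sup>2 + 1"
        using D0 [of n x] by (smt (verit) mult_nonneg_nonneg zero_le_power)
      then have "2 ^ n * D n x \<le> 2 ^ n * (2 ^ n * (D n x)\<^sup>2 + (1/2) ^ n)"
        by (simp add: power_mult_distrib power2_eq_square algebra_simps power_one_over)
      then show ?thesis by simp
    qed
    have "(\<integral>\<^sup>+ x. ennreal (D n x) \<partial>M) \<le> (\<integral>\<^sup>+ x. ennreal (2 ^ n) * ennreal ((D n x)\<^sup>2) + ennreal ((1/2) ^ n) \<partial>M)"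
      by (intro nn_integral_mono) (use pw in \<open>simp flip: ennreal_mult ennreal_plus\<close>)
    also have "\<dots> = ennreal (2 ^ n) * (\<integral>\<^sup>+ x. ennreal ((D n x)\<^sup>2) \<partial>M) + ennreal ((1/2) ^ n) * emeasure M (space M)"
      by (subst nn_integral_add) (auto simp: nn_integral_cmult)
    also have "\<dots> \<le> ennreal (2 ^ n) * ennreal ((1/4) ^ n) + ennreal ((1/2) ^ n) * ennreal c"
      using fast [of n "Suc n"] by (intro add_mono mult_left_mono) (auto simp: D_def c_def emeasure_eq_measure)
    also have "\<dots> = ennreal ((1 + c) * (1/2) ^ n)"
    proof -
      have "(2::real) ^ n * (1/4) ^ n = (1/2) ^ n" by (simp flip: power_mult_distrib)
      then show ?thesis
        by (simp add: c_def algebra_simps flip: ennreal_mult ennreal_plus)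
    qed
    finally show ?thesis .
  qed
  have "(\<integral>\<^sup>+ x. (\<Sum>n. ennreal (D n x)) \<partial>M) = (\<Sum>n. \<integral>\<^sup>+ x. ennreal (D n x) \<partial>M)"
    by (rule nn_integral_suminf) measurable
  also have "\<dots> \<le> (\<Sum>n. ennreal ((1 + c) * (1/2) ^ n))"
    by (intro suminf_le L1) auto
  also have "\<dots> = ennreal (\<Sum>n. (1 + c) * (1/2) ^ n)"
    by (intro suminf_ennreal2 summable_mult summable_geometric) (auto simp: c_def)
  finally have "(\<integral>\<^sup>+ x. (\<Sum>n. ennreal (D n x)) \<partial>M) \<noteq> \<infinity>" by (auto simp: top_unique)
  then have "AE x in M. (\<Sum>n. ennreal (D n x)) \<noteq> \<infinity>" by (intro nn_integral_PInf_AE) auto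
  then have conv: "AE x in M. convergent (\<lambda>n. F n x)"
  proof eventually_elim
    case (elim x)
    then have "summable (\<lambda>n. D n x)" by (intro summable_suminf_not_top D0) auto
    then have "summable (\<lambda>n. F (Suc n) x - F n x)"
      by (intro summable_norm_cancel [of "\<lambda>n. F (Suc n) x - F n x"]) (simp add: D_def norm_minus_commute)
    then have "convergent (\<lambda>n. \<Sum>i<n. F (Suc i) x - F i x)" by (simp add: summable_iff_convergent)
    then have "convergent (\<lambda>n. (\<Sum>i<n. F (Suc i) x - F i x) + F 0 x)"
      by (intro convergent_add convergent_const)
    then show ?case by (simp add: sum_lessThan_telescope [of "\<lambda>n. F n x"])
  qed
  define G where "G x = lim (\<lambda>n. F n x)" for x
  have [measurable]: "G \<in> borel_measurable M" unfolding G_def by measurable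
  have lim: "AE x in M. (\<lambda>n. F n x) \<longlonglongrightarrow> G x"
    using conv by eventually_elim (simp add: G_def convergent_LIMSEQ_iff)
  have "(\<integral>\<^sup>+ x. ennreal ((norm (F n x - G x))\<^sup>2) \<partial>M) \<le> ennreal ((1/4) ^ n)" for n
  proof -
    have "(\<integral>\<^sup>+ x. ennreal ((norm (F n x - G x))\<^sup>2) \<partial>M)
      = (\<integral>\<^sup>+ x. liminf (\<lambda>m. ennreal ((norm (F n x - F m x))\<^sup>2)) \<partial>M)"
    proof (rule nn_integral_cong_AE, use lim in eventually_elim)
      case (elim x)
      then have "(\<lambda>m. ennreal ((norm (F n x - F m x))\<^sup>2)) \<longlonglongrightarrow> ennreal ((norm (F n x - G x))\<^sup>2)"
        by (intro tendsto_intros)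
      then show ?case by (intro lim_imp_Liminf [symmetric]) simp_all
    qed
    also have "\<dots> \<le> liminf (\<lambda>m. \<integral>\<^sup>+ x. ennreal ((norm (F n x - F m x))\<^sup>2) \<partial>M)"
      by (rule nn_integral_liminf) measurable
    also have "\<dots> \<le> ennreal ((1/4) ^ n)"
      by (rule Liminf_le) (use fast in \<open>auto simp: eventually_sequentially\<close>)
    finally show ?thesis .
  qed
  with lim show thesis by (intro that [of G]) auto
qed

text \<open>
  By Weierstrass, vanishing moments make \<open>h\<close> orthogonal to every continuous function on the compact
  interval; indicators of rays are bounded limits of such functions, and the rays generate the
  Borel sets.
\<close>

lemma integrable_moments_zero:
  fixes h :: "real \<Rightarrow> real"
  assumes fin: "finite_measure M" and sets: "sets M = sets borel"
    and supp: "AE x in M. x \<in> {a..b}" and h: "integrable M h"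
    and mom: "\<And>n. (\<integral>x. x ^ n * h x \<partial>M) = 0"
  shows "AE x in M. h x = 0"
proof -
  interpret finite_measure M by fact
  note [measurable_cong] = sets
  have [measurable]: "h \<in> borel_measurable M" using h by auto
  have space [simp]: "space M = UNIV" using sets_eq_imp_space_eq [OF sets] by simp
  have bnd: "integrable M (\<lambda>x. g x * h x)"
    if "g \<in> borel_measurable borel" "\<And>x. x \<in> {a..b} \<Longrightarrow> \<bar>g x\<bar> \<le> B" for g B
  proof (rule Bochner_Integration.integrable_bound [OF integrable_mult_right [OF h, of B]])
    show "AE x in M. norm (g x * h x) \<le> norm (B * h x)"
      using supp
    proof eventually_elim
      case (elim x)
      then have "\<bar>g x\<bar> \<le> \<bar>B\<bar>" using that(2) by (meson abs_ge_self order_trans)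
      then show ?case by (simp add: abs_mult mult_right_mono)
    qed
    show "(\<lambda>x. g x * h x) \<in> borel_measurable M" using that(1) by measurable
  qed
  have poly: "(\<integral>x. p x * h x \<partial>M) = 0" if p: "real_polynomial_function p" for p
  proof -
    obtain c n where p: "p = (\<lambda>x. \<Sum>i\<le>n. c i * x ^ i)"
      using p unfolding real_polynomial_function_iff_sum by auto
    have int: "integrable M (\<lambda>x. x ^ i * h x)" for i
    proof (rule bnd)
      fix x assume "x \<in> {a..b}"
      then have "\<bar>x\<bar> \<le> max \<bar>a\<bar> \<bar>b\<bar>" by auto
      then show "\<bar>x ^ i\<bar> \<le> max \<bar>a\<bar> \<bar>b\<bar> ^ i" unfolding power_abs by (rule power_mono) simp
    qed simp
    have "(\<integral>x. p x * h x \<partial>M) = (\<integral>x. (\<Sum>i\<le>n. c i * (x ^ i * h x)) \<partial>M)"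
      by (simp add: p sum_distrib_right mult.assoc)
    also have "\<dots> = (\<Sum>i\<le>n. \<integral>x. c i * (x ^ i * h x) \<partial>M)"
      by (rule Bochner_Integration.integral_sum) (simp add: int)
    also have "\<dots> = 0" by (simp add: mom)
    finally show ?thesis .
  qed
  have cont: "(\<integral>x. g x * h x \<partial>M) = 0" if g: "continuous_on UNIV g" for g
  proof -
    have "\<bar>\<integral>x. g x * h x \<partial>M\<bar> \<le> 0 + e" if "e > 0" for e
    proof -
      define c where "c = (\<integral>x. \<bar>h x\<bar> \<partial>M)"
      have "c \<ge> 0" by (simp add: c_def)
      define d where "d = e / (c + 1)"
      have "d > 0" using \<open>e > 0\<close> \<open>c \<ge> 0\<close> by (simp add: d_def)
      obtain p where p: "real_polynomial_function p" "\<And>x. x \<in> {a..b} \<Longrightarrow> \<bar>g x - p x\<bar> < d"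
        using Stone_Weierstrass_real_polynomial_function [of "{a..b}" g d] \<open>d > 0\<close>
          continuous_on_subset [OF g] by auto
      have pc: "continuous_on UNIV p"
        using p(1) continuous_on_polymonial_function real_polynomial_function_eq by blast
      have [measurable]: "g \<in> borel_measurable borel" "p \<in> borel_measurable borel"
        using g pc by (auto intro: borel_measurable_continuous_onI)
      obtain B where B: "\<And>x. x \<in> {a..b} \<Longrightarrow> \<bar>p x\<bar> \<le> B"
      proof -
        have "compact (p ` {a..b})"
          by (intro compact_continuous_image continuous_on_subset [OF pc]) auto
        then show thesis using that compact_imp_bounded bounded_iff by (metis image_eqI real_norm_def)
      qed
      have i1: "integrable M (\<lambda>x. p x * h x)" by (rule bnd [OF _ B]) auto
      have i2: "integrable M (\<lambda>x. (g x - p x) * h x)"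
        by (rule bnd [of _ d]) (use p(2) in \<open>auto intro: less_imp_le\<close>)
      have "(\<integral>x. g x * h x \<partial>M) = (\<integral>x. (g x - p x) * h x + p x * h x \<partial>M)"
        by (simp add: algebra_simps)
      also have "\<dots> = (\<integral>x. (g x - p x) * h x \<partial>M)"
        using i1 i2 poly [OF p(1)] by simp
      also have "\<bar>\<dots>\<bar> \<le> (\<integral>x. \<bar>(g x - p x) * h x\<bar> \<partial>M)" by (rule integral_abs_bound)
      also have "\<dots> \<le> (\<integral>x. d * \<bar>h x\<bar> \<partial>M)"
      proof (rule integral_mono_AE)
        show "AE x in M. \<bar>(g x - p x) * h x\<bar> \<le> d * \<bar>h x\<bar>"
          using supp by eventually_elim (use p(2) in \<open>auto simp: abs_mult less_imp_le intro!: mult_right_mono\<close>)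
      qed (use i2 h in auto)
      also have "\<dots> = d * c" by (simp add: c_def)
      also have "\<dots> \<le> e" using \<open>e > 0\<close> \<open>c \<ge> 0\<close> by (simp add: d_def field_simps)
      finally show ?thesis by simp
    qed
    then have "\<bar>\<integral>x. g x * h x \<partial>M\<bar> \<le> 0" by (rule field_le_epsilon)
    then show ?thesis by simp
  qed
  have ray: "(\<integral>x. indicator {..t} x * h x \<partial>M) = 0" for t :: real
  proof -
    define g where "g n x = max 0 (1 - real n * max 0 (x - t))" for n x
    have lim: "(\<lambda>n. g n x) \<longlonglongrightarrow> indicator {..t} x" for x
    proof (cases "x \<le> t")
      case True
      then show ?thesis by (simp add: g_def)
    next
      case False
      then obtain N where N: "1 / (x - t) < real N" using reals_Archimedean2 by blast
      have "\<forall>\<^sub>F n in sequentially. g n x = 0"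
        using eventually_ge_at_top [of N]
      proof eventually_elim
        case (elim n)
        have "1 < real N * (x - t)" using N False by (simp add: field_simps)
        also have "\<dots> \<le> real n * (x - t)" using elim False by (intro mult_right_mono) auto
        finally show ?case using False by (simp add: g_def)
      qed
      then show ?thesis using False by (simp add: tendsto_eventually)
    qed
    have "(\<lambda>n. \<integral>x. g n x * h x \<partial>M) \<longlonglongrightarrow> (\<integral>x. indicator {..t} x * h x \<partial>M)"
    proof (rule integral_dominated_convergence [where w = "\<lambda>x. \<bar>h x\<bar>"])
      show "AE x in M. (\<lambda>n. g n x * h x) \<longlonglongrightarrow> indicator {..t} x * h x"
        by (intro AE_I2 tendsto_mult lim tendsto_const)
      show "AE x in M. norm (g n x * h x) \<le> \<bar>h x\<bar>" for n
        by (auto simp: g_def abs_mult intro!: mult_left_le_one_le)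
      show "(\<lambda>x. g n x * h x) \<in> borel_measurable M" for n unfolding g_def by measurable
    qed (use h in auto)
    moreover have "(\<integral>x. g n x * h x \<partial>M) = 0" for n
      by (rule cont) (auto simp: g_def intro!: continuous_intros)
    ultimately show ?thesis by (simp add: LIMSEQ_const_iff)
  qed
  have int_ind: "integrable M (\<lambda>x. indicator A x * h x)" if "A \<in> sets borel" for A
    by (rule bnd [of _ 1]) (use that in \<open>auto simp: indicator_def\<close>)
  have total: "(\<integral>x. h x \<partial>M) = 0" using mom [of 0] by simp
  have all: "(\<integral>x. indicator A x * h x \<partial>M) = 0" if "A \<in> sets borel" for A
  proof -
    have "Int_stable (range (\<lambda>t. {..t :: real}))" "range (\<lambda>t. {..t :: real}) \<subseteq> Pow UNIV"
      by (auto simp: Int_stable_def)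
    moreover have "A \<in> sigma_sets UNIV (range (\<lambda>t. {..t :: real}))"
      using that by (simp add: borel_eq_atMost)
    ultimately show ?thesis
    proof (induction A rule: sigma_sets_induct_disjoint)
      case (compl A)
      then have A: "A \<in> sets borel" by (simp add: borel_eq_atMost)
      have "(\<integral>x. indicator (UNIV - A) x * h x \<partial>M) = (\<integral>x. h x - indicator A x * h x \<partial>M)"
        by (intro Bochner_Integration.integral_cong) (auto simp: indicator_def)
      also have "\<dots> = 0" using h int_ind [OF A] total compl by simp
      finally show ?case .
    next
      case (union A)
      then have A: "A i \<in> sets M" for i by (auto simp: borel_eq_atMost sets)
      have "(LINT x:(\<Union>i. A i)|M. h x) = (\<Sum>i. (LINT x:(A i)|M. h x))"
        by (rule lebesgue_integral_countable_add)
          (use A union(1) int_ind [of "\<Union>i. A i"] in \<open>auto simp: disjoint_family_on_def set_integrable_def sets\<close>)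
      then show ?case using union by (simp add: set_lebesgue_integral_def)
    qed (use ray in auto)
  qed
  show ?thesis
    using density_zero [OF h] all by (simp add: set_lebesgue_integral_def sets)
qed

section \<open>Complexified quaternions\<close>

text \<open>
  The algebra \<open>H \<otimes> C\<close>, isomorphic to the complex two-by-two matrices: the pair \<open>(a, b)\<close> stands for
  \<open>a + \<iota> b\<close> with a central imaginary unit \<open>\<iota>\<close>. A slice function takes the value \<open>a + I b\<close> at
  \<open>x + I y\<close>, with \<open>a\<close> and \<open>b\<close> independent of \<open>I\<close>, so it is a function of \<open>x\<close> with values in this algebra.
\<close>

type_synonym biquat = "quat \<times> quat"

definition bmul :: "biquat \<Rightarrow> biquat \<Rightarrow> biquat" (infixl "\<odot>" 70) where
  "X \<odot> Y = (fst X * fst Y - snd X * snd Y, fst X * snd Y + snd X * fst Y)"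

text \<open>
  The conjugate transpose, when the algebra is identified with the two-by-two matrices: quaternionic
  conjugation extended antilinearly in \<open>\<iota>\<close>.
\<close>

definition badj :: "biquat \<Rightarrow> biquat" where
  "badj X = (qcnj (fst X), - qcnj (snd X))"

text \<open>
  The elements \<open>c + \<iota> s\<close> with \<open>c\<close> and \<open>s\<close> real, that is, the complex scalars.
\<close>

definition central :: "biquat \<Rightarrow> bool" where
  "central Z \<longleftrightarrow> (\<exists>c s. Z = (of_real c, of_real s))"

lemma qcnj_qcnj [simp]: "qcnj (qcnj a) = a"
  by (simp add: quat_eq_iff)

lemma qcnj_add: "qcnj (a + b) = qcnj a + qcnj b"
  by (simp add: quat_eq_iff)

lemma qcnj_minus: "qcnj (a - b) = qcnj a - qcnj b"
  by (simp add: quat_eq_iff)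

lemma qcnj_uminus [simp]: "qcnj (- a) = - qcnj a"
  by (simp add: quat_eq_iff)

lemma qcnj_mult: "qcnj (a * b) = qcnj b * qcnj a"
  by (simp add: quat_eq_iff)

lemma qcnj_scaleR: "qcnj (r *\<^sub>R a) = r *\<^sub>R qcnj a"
  by (simp add: quat_eq_iff)

lemma norm_qcnj [simp]: "norm (qcnj a) = norm a"
  by (simp add: norm_quat_eq)

lemma qcnj_0 [simp]: "qcnj 0 = 0" and qcnj_1 [simp]: "qcnj 1 = 1"
  by (simp_all add: quat_eq_iff)

lemma bmul_assoc: "X \<odot> Y \<odot> Z = X \<odot> (Y \<odot> Z)"
  by (simp add: bmul_def algebra_simps)

lemma bmul_add_right: "X \<odot> (Y + Z) = X \<odot> Y + X \<odot> Z"
  and bmul_diff_right: "X \<odot> (Y - Z) = X \<odot> Y - X \<odot> Z"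
  and bmul_one_left [simp]: "(1, 0) \<odot> X = X"
  and bmul_one_right [simp]: "X \<odot> (1, 0) = X"
  by (simp_all add: bmul_def algebra_simps prod_eq_iff)

lemma badj_badj [simp]: "badj (badj X) = X"
  by (simp add: badj_def)

lemma badj_bmul: "badj (X \<odot> Y) = badj Y \<odot> badj X"
  by (simp add: badj_def bmul_def qcnj_mult qcnj_add qcnj_minus)

lemma inner_quat_mult_left: "inner (a * b) c = inner b (qcnj a * (c :: quat))"
  by (simp add: inner_quat_def algebra_simps)

text \<open>
  The real inner product on pairs is, up to a factor, the real part of the trace of \<open>Z X\<^sup>*\<close>; this is
  why left multiplication has the conjugate transpose as its adjoint.
\<close>

lemma inner_bmul_left: "inner (X \<odot> Y) Z = inner Y (badj X \<odot> Z)"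
  by (simp add: bmul_def badj_def inner_prod_def inner_add_left inner_add_right
      inner_diff_left inner_diff_right inner_quat_mult_left)

lemma central_bmul_commute: "central Z \<Longrightarrow> Z \<odot> X = X \<odot> Z"
  by (auto simp: central_def bmul_def of_real_quat_comm algebra_simps)

lemma norm_biquat_sq: "(norm X)\<^sup>2 = (norm (fst X))\<^sup>2 + (norm (snd X))\<^sup>2" for X :: biquat
  by (simp add: norm_prod_def)

text \<open>
  Four products of components, each bounded by the product of the norms.
\<close>

lemma norm_bmul_le: "norm (X \<odot> Y) \<le> 4 * (norm X * norm Y)"
proof -
  have *: "norm a * norm b \<le> norm X * norm Y" if "a \<in> {fst X, snd X}" "b \<in> {fst Y, snd Y}" for a b
  proof (rule mult_mono)
    show "norm a \<le> norm X" using that(1) norm_fst_le [of "fst X" "snd X"] norm_snd_le [of "snd X" "fst X"] by auto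
    show "norm b \<le> norm Y" using that(2) norm_fst_le [of "fst Y" "snd Y"] norm_snd_le [of "snd Y" "fst Y"] by auto
  qed auto
  have "norm (X \<odot> Y) \<le> norm (fst X * fst Y - snd X * snd Y) + norm (fst X * snd Y + snd X * fst Y)"
    unfolding bmul_def by (rule norm_Pair_le)
  also have "\<dots> \<le> (norm (fst X * fst Y) + norm (snd X * snd Y)) + (norm (fst X * snd Y) + norm (snd X * fst Y))"
    by (intro add_mono norm_triangle_ineq norm_triangle_ineq4)
  also have "\<dots> \<le> 4 * (norm X * norm Y)"
    using *[of "fst X" "fst Y"] *[of "snd X" "snd Y"] *[of "fst X" "snd Y"] *[of "snd X" "fst Y"]
    by (simp add: norm_mult)
  finally show ?thesis .
qed

text \<open>
  The single equation \<open>P P\<^sup>* = P\<close> characterizes the orthogonal projections, since its left-hand side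
  is self-adjoint.
\<close>

lemma projection_self_adjoint:
  assumes "P \<odot> badj P = P"
  shows "badj P = P" "P \<odot> P = P"
proof -
  have "badj P = badj (P \<odot> badj P)" using assms by simp
  also have "\<dots> = P \<odot> badj P" by (simp add: badj_bmul)
  finally show "badj P = P" using assms by simp
  with assms show "P \<odot> P = P" by simp
qed

text \<open>
  Here the unit of the algebra has norm 1, and \<open>\<parallel>P\<parallel>\<^sup>2 = \<langle>P\<^sup>* P, 1\<rangle> = \<langle>P, 1\<rangle> \<le> \<parallel>P\<parallel>\<close>.
\<close>

lemma projection_norm_le:
  assumes "P \<odot> badj P = P"
  shows "norm P \<le> 1"
proof -
  have "(norm P)\<^sup>2 = inner (P \<odot> (1, 0)) P" by (simp add: power2_norm_eq_inner)
  also have "\<dots> = inner (1, 0) (badj P \<odot> P)" by (rule inner_bmul_left)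
  also have "\<dots> = inner (1, 0) P" using projection_self_adjoint [OF assms] by simp
  also have "\<dots> \<le> norm (1 :: quat, 0 :: quat) * norm P" by (rule norm_cauchy_schwarz)
  finally have "norm P * norm P \<le> 1 * norm P" by (simp add: norm_prod_def power2_eq_square)
  then show ?thesis by (cases "norm P = 0") (auto simp: mult_le_cancel_right)
qed

lemma continuous_on_bmul:
  "continuous_on UNIV (\<lambda>x. fst x \<odot> snd x)"
  unfolding bmul_def by (intro continuous_intros)

lemma measurable_bmul [measurable]:
  assumes [measurable]: "F \<in> borel_measurable M" "G \<in> borel_measurable M"
  shows "(\<lambda>x. F x \<odot> G x) \<in> borel_measurable M"
proof -
  have "(\<lambda>x. (F x, G x)) \<in> M \<rightarrow>\<^sub>M borel \<Otimes>\<^sub>M borel" by measurable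
  then have "(\<lambda>x. (F x, G x)) \<in> M \<rightarrow>\<^sub>M borel" by (simp add: borel_prod)
  from measurable_compose [OF this borel_measurable_continuous_onI [OF continuous_on_bmul]]
  show ?thesis by simp
qed

lemma measurable_badj [measurable]: "badj \<in> borel_measurable borel"
  unfolding badj_def
  by (intro borel_measurable_continuous_onI continuous_intros
      continuous_on_compose2 [OF continuous_on_qcnj [of UNIV]]) auto

section \<open>Coordinates of slice functions\<close>

text \<open>
  The point of the upper half circle in the slice of \<open>Quat 0 1 0 0\<close> with real part \<open>x\<close>. The default
  value 1 keeps the function inside the sphere, where the functions that are composed with it are
  known to be measurable.
\<close>

definition circle_point :: "real \<Rightarrow> quat" where
  "circle_point x = (if \<bar>x\<bar> \<le> 1 then Quat x (sqrt (1 - x\<^sup>2)) 0 0 else 1)"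

text \<open>
  The two components of a slice function as functions of the real part, computed from the values
  at two conjugate points.
\<close>

definition comps :: "(quat \<Rightarrow> quat) \<Rightarrow> real \<Rightarrow> biquat" where
  "comps f x = ((1/2) *\<^sub>R (f (circle_point x) + f (qcnj (circle_point x))),
     (1/2) *\<^sub>R (Quat 0 (- 1) 0 0 * (f (circle_point x) - f (qcnj (circle_point x)))))"

text \<open>
  The inverse of \<open>comps\<close>: the sign of the imaginary part of \<open>q\<close> is the imaginary unit \<open>I\<close> with
  \<open>q = x + I y\<close> and \<open>y > 0\<close>. At \<open>q = 1\<close> and \<open>q = - 1\<close> that sign is 0, as it must be because there every
  \<open>I\<close> represents the same point.
\<close>

definition slice_of :: "(real \<Rightarrow> biquat) \<Rightarrow> quat \<Rightarrow> quat" where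
  "slice_of F q = fst (F (qRe q)) + sgn (q - of_real (qRe q)) * snd (F (qRe q))"

text \<open>
  The distribution of the real part of a random point of the sphere (see \<open>distr_sphere_qRe\<close>).
\<close>

definition re_law :: "real measure" where
  "re_law = distr angle_measure borel cos"

lemma circle_point_in_qsphere: "circle_point x \<in> qsphere"
proof (cases "\<bar>x\<bar> \<le> 1")
  case True
  then have "x\<^sup>2 \<le> 1" by (simp add: abs_square_le_1)
  with True show ?thesis by (simp add: circle_point_def qsphere_def norm_quat_eq)
qed (simp add: circle_point_def qsphere_def)

lemma qcnj_in_qsphere [simp]: "qcnj q \<in> qsphere \<longleftrightarrow> q \<in> qsphere"
  by (simp add: qsphere_def)

lemma qRe_sphere: "q \<in> qsphere \<Longrightarrow> \<bar>qRe q\<bar> \<le> 1"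
proof -
  assume "q \<in> qsphere"
  then have "(qRe q)\<^sup>2 + (qIm1 q)\<^sup>2 + (qIm2 q)\<^sup>2 + (qIm3 q)\<^sup>2 = 1"
    using norm_quat_power2 [of q] by (simp add: qsphere_def)
  then have "(qRe q)\<^sup>2 \<le> 1" by (smt (verit) zero_le_power2)
  then show ?thesis by (simp add: abs_square_le_1)
qed

text \<open>
  Together with \<open>slice_comps\<close> below this reduces the computation of components to the values on the
  upper half circles: \<open>(a, b)\<close> are the components at \<open>x\<close> as soon as \<open>f = a + I b\<close> there for all \<open>I\<close>.
\<close>

lemma comps_eqI:
  assumes x: "\<bar>x\<bar> \<le> 1"
    and f: "\<And>I. I \<in> im_units \<Longrightarrow> f (of_real x + of_real (sqrt (1 - x\<^sup>2)) * I) = a + I * b"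
  shows "comps f x = (a, b)"
proof -
  let ?i = "Quat 0 1 0 0"
  have i: "?i \<in> im_units" by (simp add: im_units_iff)
  have e: "circle_point x = of_real x + of_real (sqrt (1 - x\<^sup>2)) * ?i"
    "qcnj (circle_point x) = of_real x + of_real (sqrt (1 - x\<^sup>2)) * (- ?i)"
    using x by (simp_all add: circle_point_def quat_eq_iff of_real_def)
  have "f (circle_point x) = a + ?i * b" unfolding e(1) by (rule f [OF i])
  moreover have "f (qcnj (circle_point x)) = a + (- ?i) * b"
    unfolding e(2) by (rule f [OF im_units_uminus [OF i]])
  ultimately show ?thesis
    by (simp add: comps_def quat_eq_iff)
qed

lemma slice_comps:
  assumes "slice_function f" "\<bar>x\<bar> \<le> 1" "I \<in> im_units"
  shows "f (of_real x + of_real (sqrt (1 - x\<^sup>2)) * I) = fst (comps f x) + I * snd (comps f x)"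
proof -
  obtain F G where f: "\<And>x y I. I \<in> im_units \<Longrightarrow> x\<^sup>2 + y\<^sup>2 = 1 \<Longrightarrow>
    f (of_real x + of_real y * I) = F x y + I * G x y"
    by (rule slice_functionE [OF assms(1)]) blast
  have "x\<^sup>2 \<le> 1" using assms(2) by (simp add: abs_square_le_1)
  then have s: "x\<^sup>2 + (sqrt (1 - x\<^sup>2))\<^sup>2 = 1" by simp
  have "comps f x = (F x (sqrt (1 - x\<^sup>2)), G x (sqrt (1 - x\<^sup>2)))"
    by (rule comps_eqI [OF assms(2) f [OF _ s]])
  then show ?thesis using f [OF assms(3) s] by simp
qed

lemma sphere_upper_half:
  assumes "q \<in> qsphere"
  obtains I where "I \<in> im_units" "q = of_real (qRe q) + of_real (sqrt (1 - (qRe q)\<^sup>2)) * I"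
proof -
  obtain x y I where I: "I \<in> im_units" and xy: "x\<^sup>2 + y\<^sup>2 = 1" and q: "q = of_real x + of_real y * I"
    by (rule qsphere_cases [OF assms])
  have re: "qRe q = x" using I by (simp add: q im_units_iff of_real_def)
  have y: "sqrt (1 - x\<^sup>2) = \<bar>y\<bar>" using xy by (simp add: algebra_simps flip: real_sqrt_abs)
  show thesis
  proof (cases "y \<ge> 0")
    case True
    with y have "q = of_real (qRe q) + of_real (sqrt (1 - (qRe q)\<^sup>2)) * I"
      unfolding re by (simp add: q)
    with I show thesis by (rule that)
  next
    case False
    with y have "q = of_real (qRe q) + of_real (sqrt (1 - (qRe q)\<^sup>2)) * (- I)"
      unfolding re by (simp add: q)
    with im_units_uminus [OF I] show thesis by (rule that)
  qed
qed

lemma sgn_im_unit: "I \<in> im_units \<Longrightarrow> sgn I = I"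
  by (simp add: sgn_div_norm im_units_norm)

lemma slice_function_slice_of: "slice_function (slice_of F)"
proof (rule slice_functionI [of _ "\<lambda>x y. fst (F x)" "\<lambda>x y. of_real (sgn y) * snd (F x)"])
  fix x y :: real and I :: quat
  assume I: "I \<in> im_units"
  have re: "qRe (of_real x + of_real y * I) = x"
    using I by (simp add: im_units_iff of_real_def)
  have "sgn (of_real y * I) = of_real (sgn y) * I"
    by (simp add: of_real_def sgn_scaleR sgn_im_unit I)
  then show "slice_of F (of_real x + of_real y * I) = fst (F x) + I * (of_real (sgn y) * snd (F x))"
    unfolding slice_of_def re by (simp add: of_real_quat_comm [of I] flip: mult.assoc)
qed

lemma comps_slice_of: "\<bar>x\<bar> < 1 \<Longrightarrow> comps (slice_of F) x = F x"
proof -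
  assume x: "\<bar>x\<bar> < 1"
  then have s: "sqrt (1 - x\<^sup>2) > 0" by (simp add: abs_square_less_1)
  have "comps (slice_of F) x = (fst (F x), snd (F x))"
  proof (rule comps_eqI)
    fix I assume I: "I \<in> im_units"
    have re: "qRe (of_real x + of_real (sqrt (1 - x\<^sup>2)) * I) = x"
      using I by (simp add: im_units_iff of_real_def)
    have "sgn (of_real (sqrt (1 - x\<^sup>2)) * I) = I"
      using s by (simp add: of_real_def sgn_scaleR sgn_im_unit I del: real_sqrt_gt_0_iff)
    then show "slice_of F (of_real x + of_real (sqrt (1 - x\<^sup>2)) * I) = fst (F x) + I * snd (F x)"
      unfolding slice_of_def re by simp
  qed (use x in simp)
  then show ?thesis by simp
qed

lemma measurable_qRe [measurable]: "qRe \<in> borel_measurable borel"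
proof -
  have "qRe = (\<lambda>q. inner q 1)" by (simp add: fun_eq_iff inner_quat_def)
  then show ?thesis by (rule ssubst) measurable
qed

lemma measurable_circle_point: "circle_point \<in> borel \<rightarrow>\<^sub>M restrict_space borel qsphere"
proof (rule measurable_restrict_space2)
  show "circle_point \<in> space borel \<rightarrow> qsphere" using circle_point_in_qsphere by auto
  have "circle_point = (\<lambda>x. if \<bar>x\<bar> \<le> 1 then x *\<^sub>R 1 + sqrt (1 - x\<^sup>2) *\<^sub>R Quat 0 1 0 0 else 1)"
    by (auto simp: circle_point_def fun_eq_iff quat_eq_iff)
  then show "circle_point \<in> borel_measurable borel" by (rule ssubst) measurable
qed

lemma measurable_qcnj_sphere: "qcnj \<in> restrict_space borel qsphere \<rightarrow>\<^sub>M restrict_space borel qsphere"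
  by (intro measurable_restrict_space2 measurable_restrict_space1 measurable_qcnj)
     (auto simp: space_restrict_space)

lemma measurable_comps:
  assumes "f \<in> borel_measurable sphere_measure"
  shows "comps f \<in> borel_measurable borel"
proof -
  have f: "f \<in> borel_measurable (restrict_space borel qsphere)"
    using assms by (simp add: measurable_sphere_measure)
  note [measurable] = measurable_compose [OF measurable_circle_point f]
    measurable_compose [OF measurable_compose [OF measurable_circle_point measurable_qcnj_sphere] f]
  show ?thesis unfolding comps_def by (intro borel_measurable_Pair) measurable
qed

lemma measurable_slice_of:
  assumes [measurable]: "F \<in> borel_measurable borel"
  shows "slice_of F \<in> borel_measurable sphere_measure"
proof -
  have [measurable]: "(\<lambda>q. q) \<in> borel_measurable sphere_measure"
    by (simp add: measurable_sphere_measure measurable_restrict_space1)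
  have "(\<lambda>q. F (qRe q)) \<in> borel_measurable sphere_measure" by measurable
  then have [measurable]: "(\<lambda>q. fst (F (qRe q))) \<in> borel_measurable sphere_measure"
    "(\<lambda>q. snd (F (qRe q))) \<in> borel_measurable sphere_measure"
    by (rule measurable_compose, intro borel_measurable_continuous_onI continuous_intros)+
  show ?thesis unfolding slice_of_def sgn_div_norm of_real_def by measurable
qed

interpretation re_law: finite_measure re_law
proof
  show "emeasure re_law (space re_law) \<noteq> \<infinity>"
    by (simp add: re_law_def emeasure_distr measurable_cong_sets [OF sets_angle_measure refl] emeasure_angle_measure)
qed

lemma space_re_law [simp]: "space re_law = UNIV" and sets_re_law: "sets re_law = sets borel"
  by (simp_all add: re_law_def)

lemma measurable_re_law: "measurable re_law N = measurable borel N"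
  by (rule measurable_cong_sets [OF sets_re_law refl])

lemma measurable_angle: "measurable angle_measure N = measurable borel N"
  by (rule measurable_cong_sets [OF sets_angle_measure refl])

lemma AE_angleI:
  assumes "finite X" "\<And>t. t \<in> {0..2 * pi} - X \<Longrightarrow> P t"
  shows "AE t in angle_measure. P t"
proof -
  have "AE t in lborel. t \<notin> X"
    using assms(1) by (intro AE_not_in) (rule finite_imp_null_set_lborel)
  then have "AE t in lborel. t \<in> {0..2 * pi} \<longrightarrow> P t"
    by eventually_elim (use assms(2) in auto)
  then show ?thesis unfolding angle_measure_def by (intro AE_uniform_measureI) auto
qed

lemma AE_re_law_interior: "AE x in re_law. \<bar>x\<bar> < 1"
proof -
  have "AE t in angle_measure. \<bar>cos t\<bar> < 1"
  proof (rule AE_angleI [of "{0, pi, 2 * pi}"])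
    fix t :: real assume t: "t \<in> {0..2 * pi} - {0, pi, 2 * pi}"
    have "sin t \<noteq> 0"
    proof (cases "t < pi")
      case True
      then show ?thesis using t sin_gt_zero [of t] by auto
    next
      case False
      then show ?thesis using t sin_lt_zero [of t] by auto
    qed
    then have "(cos t)\<^sup>2 < 1" using sin_cos_squared_add [of t] by (smt (verit) zero_less_power2)
    then show "\<bar>cos t\<bar> < 1" by (simp add: abs_square_less_1)
  qed simp
  then show ?thesis
    unfolding re_law_def by (subst AE_distr_iff) (auto simp: measurable_angle)
qed

lemma qRe_qexp: "I \<in> im_units \<Longrightarrow> qRe (qexp t I) = cos t"
  by (simp add: qexp_def im_units_iff of_real_def)

lemma nn_integral_sphere:
  assumes [measurable]: "u \<in> borel_measurable sphere_measure"
  shows "(\<integral>\<^sup>+ q. u q \<partial>sphere_measure)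
    = (\<integral>\<^sup>+ I. (\<integral>\<^sup>+ t. u (qexp t I) \<partial>angle_measure) \<partial>area_measure)"
proof -
  have u: "u \<in> borel_measurable (restrict_space borel qsphere)"
    using assms by (simp add: measurable_sphere_measure)
  have "(\<integral>\<^sup>+ q. u q \<partial>sphere_measure)
    = (\<integral>\<^sup>+ z. (case z of (t, I) \<Rightarrow> u (qexp t I)) \<partial>(angle_measure \<Otimes>\<^sub>M area_measure))"
    unfolding sphere_measure_def
    by (subst nn_integral_distr [OF measurable_qexp]) (simp_all add: u case_prod_unfold)
  also have "\<dots> = (\<integral>\<^sup>+ I. (\<integral>\<^sup>+ t. u (qexp t I) \<partial>angle_measure) \<partial>area_measure)"
    using measurable_compose [OF measurable_qexp u]
    by (subst angle_area.nn_integral_snd [symmetric]) (simp_all add: case_prod_unfold)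
  finally show ?thesis .
qed

lemma nn_integral_angle_reflect:
  assumes [measurable]: "u \<in> borel_measurable borel"
  shows "(\<integral>\<^sup>+ t. u (2 * pi - t) \<partial>angle_measure) = (\<integral>\<^sup>+ t. u t \<partial>angle_measure)"
proof -
  have "(\<integral>\<^sup>+ t. u t * indicator {0..2*pi} t \<partial>lborel)
    = (\<integral>\<^sup>+ t. u (2 * pi - t) * indicator {0..2*pi} (2 * pi - t) \<partial>lborel)"
    by (subst nn_integral_real_affine [where c = "- 1" and t = "2 * pi"]) auto
  also have "\<dots> = (\<integral>\<^sup>+ t. u (2 * pi - t) * indicator {0..2*pi} t \<partial>lborel)"
    by (intro nn_integral_cong) (auto simp: indicator_def)
  finally show ?thesis unfolding angle_measure_def by (simp add: nn_integral_uniform_measure)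
qed

lemma qcnj_qexp: "I \<in> im_units \<Longrightarrow> qcnj (qexp t I) = qexp (2 * pi - t) I"
  by (simp add: quat_eq_iff im_units_iff of_real_def qexp_def cos_diff sin_diff)

text \<open>
  On each circle the conjugation is the reflection \<open>t \<mapsto> 2 \<pi> - t\<close>, which preserves the angle measure.
\<close>

lemma nn_integral_sphere_qcnj:
  assumes [measurable]: "u \<in> borel_measurable sphere_measure"
  shows "(\<integral>\<^sup>+ q. u (qcnj q) \<partial>sphere_measure) = (\<integral>\<^sup>+ q. u q \<partial>sphere_measure)"
proof -
  have u: "u \<in> borel_measurable (restrict_space borel qsphere)"
    using assms by (simp add: measurable_sphere_measure)
  have u': "(\<lambda>q. u (qcnj q)) \<in> borel_measurable sphere_measure"
    using measurable_compose [OF measurable_qcnj_sphere u] by (simp add: measurable_sphere_measure)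
  have "(\<integral>\<^sup>+ t. u (qexp (2 * pi - t) I) \<partial>angle_measure) = (\<integral>\<^sup>+ t. u (qexp t I) \<partial>angle_measure)"
    if I: "I \<in> im_units" for I
  proof (rule nn_integral_angle_reflect)
    have "(\<lambda>t. qexp t I) \<in> borel \<rightarrow>\<^sub>M restrict_space borel qsphere"
    proof (rule measurable_restrict_space2)
      show "(\<lambda>t. qexp t I) \<in> borel_measurable borel"
        unfolding qexp_def of_real_def by measurable
    qed (simp add: qexp_in_qsphere I)
    then show "(\<lambda>t. u (qexp t I)) \<in> borel_measurable borel" using u by (rule measurable_compose)
  qed
  then show ?thesis
    unfolding nn_integral_sphere [OF assms] nn_integral_sphere [OF u']
    by (intro nn_integral_cong [where M = area_measure]) (simp add: qcnj_qexp)
qed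

lemma distr_sphere_qRe: "distr sphere_measure borel qRe = re_law"
proof (rule measure_eqI)
  fix A :: "real set" assume "A \<in> sets (distr sphere_measure borel qRe)"
  then have [measurable]: "A \<in> sets borel" by simp
  have [measurable]: "qRe \<in> borel_measurable sphere_measure"
    by (simp add: measurable_sphere_measure measurable_restrict_space1)
  have cos [measurable]: "cos \<in> angle_measure \<rightarrow>\<^sub>M borel" by (simp add: measurable_angle)
  have "emeasure (distr sphere_measure borel qRe) A = (\<integral>\<^sup>+ q. indicator A (qRe q) \<partial>sphere_measure)"
    by (simp add: nn_integral_distr flip: nn_integral_indicator)
  also have "\<dots> = (\<integral>\<^sup>+ I. (\<integral>\<^sup>+ t. indicator A (qRe (qexp t I)) \<partial>angle_measure) \<partial>area_measure)"
    by (rule nn_integral_sphere) measurable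
  also have "\<dots> = (\<integral>\<^sup>+ I. (\<integral>\<^sup>+ t. indicator A (cos t) \<partial>angle_measure) \<partial>area_measure)"
    by (intro nn_integral_cong) (simp add: qRe_qexp)
  also have "\<dots> = (\<integral>\<^sup>+ t. indicator A (cos t) \<partial>angle_measure)"
    by (simp add: emeasure_area_measure)
  also have "\<dots> = emeasure re_law A"
    by (simp add: re_law_def nn_integral_distr [OF cos] flip: nn_integral_indicator)
  finally show "emeasure (distr sphere_measure borel qRe) A = emeasure re_law A" .
qed (simp add: sets_re_law)

text \<open>
  The values at \<open>q\<close> and its conjugate are \<open>a + I b\<close> and \<open>a - I b\<close>, so the parallelogram law removes the
  mixed term and with it the dependence on \<open>I\<close>.
\<close>

lemma slice_norm_sum:
  assumes "slice_function f" "q \<in> qsphere"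
  shows "(norm (f q))\<^sup>2 + (norm (f (qcnj q)))\<^sup>2 = 2 * (norm (comps f (qRe q)))\<^sup>2"
proof -
  obtain I where I: "I \<in> im_units" and q: "q = of_real (qRe q) + of_real (sqrt (1 - (qRe q)\<^sup>2)) * I"
    by (rule sphere_upper_half [OF assms(2)])
  define x where "x = qRe q"
  have x: "\<bar>x\<bar> \<le> 1" using qRe_sphere [OF assms(2)] by (simp add: x_def)
  have q: "q = of_real x + of_real (sqrt (1 - x\<^sup>2)) * I" using q unfolding x_def .
  then have qc: "qcnj q = of_real x + of_real (sqrt (1 - x\<^sup>2)) * (- I)"
    using I by (simp add: quat_eq_iff im_units_iff of_real_def)
  have "f q = fst (comps f x) + I * snd (comps f x)"
    unfolding q by (rule slice_comps [OF assms(1) x I])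
  moreover have "f (qcnj q) = fst (comps f x) - I * snd (comps f x)"
    unfolding qc using slice_comps [OF assms(1) x im_units_uminus [OF I]] by simp
  ultimately have "(norm (f q))\<^sup>2 + (norm (f (qcnj q)))\<^sup>2
    = 2 * (norm (fst (comps f x)))\<^sup>2 + 2 * (norm (I * snd (comps f x)))\<^sup>2"
    using parallelogram [of "fst (comps f x)" "I * snd (comps f x)"] by simp
  then show ?thesis
    using im_units_norm [OF I] by (simp add: norm_mult norm_biquat_sq x_def)
qed

text \<open>
  The isometry between slice functions on the sphere and pairs of functions of one real variable:
  averaging the square over \<open>q\<close> and its conjugate is harmless because the measure is invariant under
  conjugation.
\<close>

lemma nn_integral_norm_comps:
  assumes f: "slice_function f" and [measurable]: "f \<in> borel_measurable sphere_measure"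
  shows "(\<integral>\<^sup>+ q. ennreal ((norm (f q))\<^sup>2) \<partial>sphere_measure)
    = (\<integral>\<^sup>+ x. ennreal ((norm (comps f x))\<^sup>2) \<partial>re_law)"
proof -
  have [measurable]: "qRe \<in> borel_measurable sphere_measure"
    by (simp add: measurable_sphere_measure measurable_restrict_space1)
  have [measurable]: "(\<lambda>q. f (qcnj q)) \<in> borel_measurable sphere_measure"
    by (rule qcnj_AE_cong(2) [OF f f]) auto
  note [measurable] = measurable_comps [OF assms(2)]
  let ?N = "\<integral>\<^sup>+ q. ennreal ((norm (f q))\<^sup>2) \<partial>sphere_measure"
  have "2 * ?N = ?N + (\<integral>\<^sup>+ q. ennreal ((norm (f (qcnj q)))\<^sup>2) \<partial>sphere_measure)"
    by (subst nn_integral_sphere_qcnj [where u = "\<lambda>q. ennreal ((norm (f q))\<^sup>2)"]) (auto simp: mult_2)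
  also have "\<dots> = (\<integral>\<^sup>+ q. ennreal ((norm (f q))\<^sup>2) + ennreal ((norm (f (qcnj q)))\<^sup>2) \<partial>sphere_measure)"
    by (rule nn_integral_add [symmetric]) measurable
  also have "\<dots> = (\<integral>\<^sup>+ q. 2 * ennreal ((norm (comps f (qRe q)))\<^sup>2) \<partial>sphere_measure)"
    by (intro nn_integral_cong)
      (simp add: slice_norm_sum [OF f] ennreal_mult flip: ennreal_plus)
  also have "\<dots> = 2 * (\<integral>\<^sup>+ q. ennreal ((norm (comps f (qRe q)))\<^sup>2) \<partial>sphere_measure)"
    by (rule nn_integral_cmult) measurable
  also have "(\<integral>\<^sup>+ q. ennreal ((norm (comps f (qRe q)))\<^sup>2) \<partial>sphere_measure)
    = (\<integral>\<^sup>+ x. ennreal ((norm (comps f x))\<^sup>2) \<partial>distr sphere_measure borel qRe)"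
    by (subst nn_integral_distr) auto
  finally show ?thesis by (simp add: distr_sphere_qRe ennreal_mult_cancel_left)
qed

lemma integral_cos_angle:
  assumes "k \<noteq> 0"
  shows "(\<integral>t. cos (real_of_int k * t) \<partial>angle_measure) = 0"
proof -
  have "((\<lambda>t. cos (real_of_int k * t)) has_integral
      (sin (real_of_int k * (2 * pi)) / k - sin (real_of_int k * 0) / k)) {0..2 * pi}"
    using assms
    by (intro fundamental_theorem_of_calculus)
      (auto intro!: derivative_eq_intros simp flip: has_real_derivative_iff_has_vector_derivative)
  moreover have "sin (real_of_int k * (2 * pi)) = 0"
    by (metis mult.assoc mult.commute of_int_mult of_int_numeral sin_integer_2pi Ints_of_int)
  ultimately have "integral {0..2 * pi} (\<lambda>t. cos (real_of_int k * t)) = 0"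
    by (simp add: integral_unique)
  moreover have "set_integrable lborel {0..2*pi} (\<lambda>t. cos (real_of_int k * t))"
    by (rule borel_integrable_atLeastAtMost') (intro continuous_intros)
  ultimately have "(LBINT t:{0..2*pi}. cos (real_of_int k * t)) = 0"
    by (simp add: set_borel_integral_eq_integral)
  then have int: "(\<integral>t. indicator {0..2*pi} t * cos (real_of_int k * t) / (2 * pi) \<partial>lborel) = 0"
    by (simp add: set_lebesgue_integral_def)
  have dens: "angle_measure = density lborel (\<lambda>t. ennreal (indicator {0..2*pi} t / (2 * pi)))"
    unfolding angle_measure_def uniform_measure_def
    by (intro density_cong) (auto simp: divide_ennreal indicator_def simp flip: ennreal_1)
  show ?thesis unfolding dens by (subst integral_density) (use int in simp_all)
qed

lemma comps_add: "comps (\<lambda>q. f q + g q) x = comps f x + comps g x"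
  by (simp add: comps_def algebra_simps)

lemma comps_uminus: "comps (\<lambda>q. - f q) x = - comps f x"
  by (simp add: comps_def algebra_simps)

lemma comps_mult_right: "comps (\<lambda>q. f q * a) x = comps f x \<odot> (a, 0)"
  by (simp add: comps_def bmul_def algebra_simps)

text \<open>
  The inner factor of the pointwise star product conjugates the imaginary unit \<open>I\<close> by \<open>f q\<close>, so
  that \<open>f q * (f q)\<^sup>-\<^sup>1 I (f q) = I (f q)\<close>. In coordinates \<open>I\<close> therefore commutes with both factors and
  the star product becomes the product of the algebra.
\<close>

lemma comps_star:
  assumes f: "slice_function f" and g: "slice_function g" and x: "\<bar>x\<bar> \<le> 1"
  shows "comps (star_fun f g) x = comps f x \<odot> comps g x"
  unfolding bmul_def
proof (rule comps_eqI [OF x])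
  fix I assume I: "I \<in> im_units"
  define q where "q = of_real x + of_real (sqrt (1 - x\<^sup>2)) * I"
  let ?F = "comps f x" and ?G = "comps g x"
  have fq: "f q = fst ?F + I * snd ?F"
    unfolding q_def by (rule slice_comps [OF f x I])
  have "star_fun f g q = f q * fst ?G + I * f q * snd ?G"
  proof (cases "f q = 0")
    case False
    have "star_fun f g q = f q * g (of_real x + of_real (sqrt (1 - x\<^sup>2)) * (inverse (f q) * I * f q))"
      using False by (simp add: star_fun_def q_def conj_slice)
    also have "\<dots> = f q * (fst ?G + inverse (f q) * I * f q * snd ?G)"
      by (simp add: slice_comps [OF g x im_units_conj [OF I False]])
    also have "\<dots> = f q * fst ?G + (f q * inverse (f q)) * (I * f q * snd ?G)"
      by (simp only: distrib_left mult.assoc)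
    finally show ?thesis using False by simp
  qed (simp add: star_fun_def)
  then show "star_fun f g q = fst ?F * fst ?G - snd ?F * snd ?G
      + I * (fst ?F * snd ?G + snd ?F * fst ?G)"
    by (simp add: fq algebra_simps im_units_square_left I)
qed

lemma comps_qcnj:
  assumes f: "slice_function f" and x: "\<bar>x\<bar> \<le> 1"
  shows "comps (\<lambda>q. f (qcnj q)) x = (fst (comps f x), - snd (comps f x))"
proof (rule comps_eqI [OF x])
  fix I assume I: "I \<in> im_units"
  have "qcnj (of_real x + of_real (sqrt (1 - x\<^sup>2)) * I) = of_real x + of_real (sqrt (1 - x\<^sup>2)) * (- I)"
    using I by (simp add: quat_eq_iff im_units_iff of_real_def)
  then show "f (qcnj (of_real x + of_real (sqrt (1 - x\<^sup>2)) * I))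
      = fst (comps f x) + I * - snd (comps f x)"
    by (simp only: slice_comps [OF f x im_units_uminus [OF I]]) simp
qed

text \<open>
  The truncation to \<open>[- 1, 1]\<close> makes \<open>arccos\<close> continuous on the whole line, hence measurable.
\<close>

definition re_angle :: "real \<Rightarrow> real" where
  "re_angle x = arccos (max (- 1) (min 1 x))"

lemma re_angle_eq: "\<bar>x\<bar> \<le> 1 \<Longrightarrow> re_angle x = arccos x"
  by (simp add: re_angle_def abs_le_iff)

lemma measurable_re_angle [measurable]: "re_angle \<in> borel_measurable borel"
  unfolding re_angle_def by (intro borel_measurable_continuous_onI continuous_intros) auto

text \<open>
  The components of \<open>q\<^sup>n\<close>, that is \<open>exp (\<iota> n t)\<close> where \<open>x = cos t\<close>.
\<close>

definition unitary :: "int \<Rightarrow> real \<Rightarrow> biquat" where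
  "unitary n x = (of_real (cos (n * re_angle x)), of_real (sin (n * re_angle x)))"

lemma central_unitary: "central (unitary n x)"
  by (auto simp: central_def unitary_def)

lemma qexp_add: "I \<in> im_units \<Longrightarrow> qexp (s + t) I = qexp s I * qexp t I"
  unfolding qexp_def of_real_def by (simp add: cos_add sin_add algebra_simps im_units_square)

lemma qexp_powi: "I \<in> im_units \<Longrightarrow> qexp t I powi n = qexp (real_of_int n * t) I"
proof -
  assume I: "I \<in> im_units"
  have nat: "qexp t I ^ m = qexp (real m * t) I" for m t
  proof (induction m)
    case 0
    show ?case by (simp add: qexp_def)
  next
    case (Suc m)
    then show ?case by (simp add: qexp_add [OF I] distrib_right)
  qed
  have "qexp t I * qexp (- t) I = 1"
    by (simp add: qexp_add [OF I, symmetric]) (simp add: qexp_def)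
  then have inv: "inverse (qexp t I) = qexp (- t) I" by (simp add: inverse_unique)
  show ?thesis
  proof (cases "n \<ge> 0")
    case True
    then show ?thesis by (simp add: power_int_def nat)
  next
    case False
    then show ?thesis by (simp add: power_int_def inv nat)
  qed
qed

lemma comps_qmonom:
  assumes x: "\<bar>x\<bar> \<le> 1"
  shows "comps (\<lambda>q. q powi n * a) x = unitary n x \<odot> (a, 0)"
proof -
  have "comps (\<lambda>q. q powi n * a) x = (of_real (cos (n * arccos x)) * a, of_real (sin (n * arccos x)) * a)"
  proof (rule comps_eqI [OF x])
    fix I assume I: "I \<in> im_units"
    have "of_real x + of_real (sqrt (1 - x\<^sup>2)) * I = qexp (arccos x) I"
      using x by (simp add: qexp_def sin_arccos abs_le_iff)
    then show "(of_real x + of_real (sqrt (1 - x\<^sup>2)) * I) powi n * a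
        = of_real (cos (n * arccos x)) * a + I * (of_real (sin (n * arccos x)) * a)"
      by (simp add: qexp_powi I) (simp add: qexp_def algebra_simps of_real_quat_left_comm)
  qed
  then show ?thesis by (simp add: unitary_def bmul_def re_angle_eq x)
qed

text \<open>
  Both sides say that the difference has norm zero, and the norm can be computed on either side.
\<close>

lemma slice_AE_eq_iff_comps:
  assumes "slice_function f" "f \<in> borel_measurable sphere_measure"
    "slice_function g" "g \<in> borel_measurable sphere_measure"
  shows "(AE q in sphere_measure. f q = g q) \<longleftrightarrow> (AE x in re_law. comps f x = comps g x)"
proof -
  note [measurable] = assms(2,4)
  define d where "d q = f q + - g q" for q
  have d: "slice_function d" unfolding d_def by (intro slice_function_add slice_function_uminus assms)
  have [measurable]: "d \<in> borel_measurable sphere_measure" unfolding d_def by measurable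
  have cd: "comps d x = comps f x - comps g x" for x
    unfolding d_def by (simp only: comps_add comps_uminus) simp
  have [measurable]: "comps d \<in> borel_measurable re_law" by (simp add: measurable_re_law measurable_comps)
  have norm [measurable]: "(\<lambda>x. ennreal ((norm (comps d x))\<^sup>2)) \<in> borel_measurable re_law"
    by measurable
  have "(AE q in sphere_measure. f q = g q) \<longleftrightarrow> (\<integral>\<^sup>+ q. ennreal ((norm (d q))\<^sup>2) \<partial>sphere_measure) = 0"
    by (subst nn_integral_0_iff_AE) (auto simp: d_def)
  also have "\<dots> \<longleftrightarrow> (\<integral>\<^sup>+ x. ennreal ((norm (comps d x))\<^sup>2) \<partial>re_law) = 0"
    by (subst nn_integral_norm_comps [OF d]) auto
  also have "\<dots> \<longleftrightarrow> (AE x in re_law. comps f x = comps g x)"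
    by (subst nn_integral_0_iff_AE [OF norm]) (simp add: cd)
  finally show ?thesis .
qed

section \<open>Classes of slice functions in coordinates\<close>

text \<open>
  Components of a class are only determined almost everywhere, so they are introduced as a relation.
  Every operation on classes then has a rule that names components of its result.
\<close>

lift_definition has_comps :: "slice_class \<Rightarrow> (real \<Rightarrow> biquat) \<Rightarrow> bool" is
  "\<lambda>f F. F \<in> borel_measurable borel \<and> (AE x in re_law. comps f x = F x)"
proof (rule ext)
  fix f g :: "quat \<Rightarrow> quat" and F :: "real \<Rightarrow> biquat"
  assume "slice_rel f g"
  then have "AE x in re_law. comps f x = comps g x"
    using slice_AE_eq_iff_comps unfolding slice_rel_def by blast
  then show "(F \<in> borel_measurable borel \<and> (AE x in re_law. comps f x = F x))
    = (F \<in> borel_measurable borel \<and> (AE x in re_law. comps g x = F x))"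
    by (auto elim!: AE_mp)
qed

lemma has_comps_measurable: "has_comps f F \<Longrightarrow> F \<in> borel_measurable borel"
  by transfer simp

lemma has_comps_unique: "has_comps f F \<Longrightarrow> has_comps f G \<Longrightarrow> AE x in re_law. F x = G x"
  by transfer (auto elim!: AE_mp)

lemma has_comps_eqI:
  "has_comps f F \<Longrightarrow> has_comps g G \<Longrightarrow> AE x in re_law. F x = G x \<Longrightarrow> f = g"
proof transfer
  fix f F g G
  assume "slice_rel f f" "F \<in> borel_measurable borel \<and> (AE x in re_law. comps f x = F x)"
    "slice_rel g g" "G \<in> borel_measurable borel \<and> (AE x in re_law. comps g x = G x)"
    "AE x in re_law. F x = G x"
  moreover from this have "AE x in re_law. comps f x = comps g x"
    by (auto elim!: AE_mp)
  ultimately show "slice_rel f g"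
    using slice_AE_eq_iff_comps unfolding slice_rel_def by blast
qed

lemma ex_has_comps: "\<exists>F. has_comps f F"
proof transfer
  fix f assume "slice_rel f f"
  then show "\<exists>F. F \<in> borel_measurable borel \<and> (AE x in re_law. comps f x = F x)"
    by (intro exI [of _ "comps f"]) (simp add: slice_rel_def measurable_comps)
qed

text \<open>
  \<open>comps (slice_of F) = F\<close> holds on the open interval \<open>(- 1, 1)\<close>, whose complement is a null set.
\<close>

lemma ex_class_of_comps:
  assumes "F \<in> borel_measurable borel"
  shows "\<exists>f. has_comps f F"
  using assms
proof transfer
  fix F :: "real \<Rightarrow> biquat" assume F: "F \<in> borel_measurable borel"
  have "AE x in re_law. comps (slice_of F) x = F x"
    using AE_re_law_interior by eventually_elim (rule comps_slice_of)
  with F show "\<exists>f\<in>{x. slice_rel x x}. F \<in> borel_measurable borel \<and> (AE x in re_law. comps f x = F x)"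
    by (intro bexI [of _ "slice_of F"]) (auto simp: slice_rel_def slice_function_slice_of measurable_slice_of)
qed

lemma has_comps_0: "has_comps 0 (\<lambda>_. 0)"
  by transfer (simp add: comps_def zero_prod_def)

lemma has_comps_add: "has_comps f F \<Longrightarrow> has_comps g G \<Longrightarrow> has_comps (f + g) (\<lambda>x. F x + G x)"
  by transfer (auto simp: comps_add elim!: AE_mp)

lemma has_comps_uminus: "has_comps f F \<Longrightarrow> has_comps (- f) (\<lambda>x. - F x)"
  by transfer (auto simp: comps_uminus)

lemma has_comps_diff: "has_comps f F \<Longrightarrow> has_comps g G \<Longrightarrow> has_comps (f - g) (\<lambda>x. F x - G x)"
  using has_comps_add [OF _ has_comps_uminus, of f F g G] by simp

lemma has_comps_scale_right: "has_comps f F \<Longrightarrow> has_comps (scale_right f a) (\<lambda>x. F x \<odot> (a, 0))"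
  by transfer (auto simp: comps_mult_right intro!: measurable_bmul)

lemma measurable_unitary [measurable]: "unitary n \<in> borel_measurable borel"
  unfolding unitary_def of_real_def by (intro borel_measurable_Pair) measurable

lemma has_comps_qmonom: "has_comps (qmonom n a) (\<lambda>x. unitary n x \<odot> (a, 0))"
proof transfer
  fix n a
  have "AE x in re_law. comps (\<lambda>q. q powi n * a) x = unitary n x \<odot> (a, 0)"
    using AE_re_law_interior by eventually_elim (simp add: comps_qmonom)
  then show "(\<lambda>x. unitary n x \<odot> (a, 0)) \<in> borel_measurable borel \<and>
      (AE x in re_law. comps (\<lambda>q. q powi n * a) x = unitary n x \<odot> (a, 0))" by simp
qed

lemma has_comps_star: "has_comps f F \<Longrightarrow> has_comps g G \<Longrightarrow> has_comps (f \<star> g) (\<lambda>x. F x \<odot> G x)"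
proof transfer
  fix f F g G
  assume *: "slice_rel f f" "F \<in> borel_measurable borel \<and> (AE x in re_law. comps f x = F x)"
    "slice_rel g g" "G \<in> borel_measurable borel \<and> (AE x in re_law. comps g x = G x)"
  from *(2) have "AE x in re_law. comps f x = F x" by blast
  moreover from *(4) have "AE x in re_law. comps g x = G x" by blast
  ultimately have "AE x in re_law. comps (star_fun f g) x = F x \<odot> G x"
    using AE_re_law_interior by eventually_elim (use *(1,3) in \<open>simp add: comps_star slice_rel_def\<close>)
  with * show "(\<lambda>x. F x \<odot> G x) \<in> borel_measurable borel \<and>
    (AE x in re_law. comps (star_fun f g) x = F x \<odot> G x)" by auto
qed

lemma has_comps_tilde: "has_comps f F \<Longrightarrow> has_comps (tilde f) (\<lambda>x. (fst (F x), - snd (F x)))"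
proof transfer
  fix f F
  assume *: "slice_rel f f" "F \<in> borel_measurable borel \<and> (AE x in re_law. comps f x = F x)"
  from *(2) have "AE x in re_law. comps f x = F x" by blast
  then have "AE x in re_law. comps (\<lambda>q. f (qcnj q)) x = (fst (F x), - snd (F x))"
    using AE_re_law_interior by eventually_elim (use *(1) in \<open>simp add: comps_qcnj slice_rel_def\<close>)
  moreover have "continuous_on UNIV (\<lambda>z :: biquat. (fst z, - snd z))" by (intro continuous_intros)
  ultimately show "(\<lambda>x. (fst (F x), - snd (F x))) \<in> borel_measurable borel \<and>
    (AE x in re_law. comps (\<lambda>q. f (qcnj q)) x = (fst (F x), - snd (F x)))"
    using * by (auto intro: measurable_compose [OF _ borel_measurable_continuous_onI])
qed

lemma has_comps_sqnorm: "has_comps f F \<Longrightarrow> sqnorm f = (\<integral>\<^sup>+ x. ennreal ((norm (F x))\<^sup>2) \<partial>re_law)"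
proof transfer
  fix f F
  assume *: "slice_rel f f" "F \<in> borel_measurable borel \<and> (AE x in re_law. comps f x = F x)"
  then have "(\<integral>\<^sup>+ q. ennreal ((norm (f q))\<^sup>2) \<partial>sphere_measure)
    = (\<integral>\<^sup>+ x. ennreal ((norm (comps f x))\<^sup>2) \<partial>re_law)"
    by (intro nn_integral_norm_comps) (auto simp: slice_rel_def)
  also have "\<dots> = (\<integral>\<^sup>+ x. ennreal ((norm (F x))\<^sup>2) \<partial>re_law)"
    using * by (intro nn_integral_cong_AE) auto
  finally show "(\<integral>\<^sup>+ q. ennreal ((norm (f q))\<^sup>2) \<partial>sphere_measure)
    = (\<integral>\<^sup>+ x. ennreal ((norm (F x))\<^sup>2) \<partial>re_law)" .
qed

section \<open>The Hilbert space of square-integrable slice functions\<close>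

lemma integrable_inner_of_square:
  fixes F G :: "'a \<Rightarrow> 'b::euclidean_space"
  assumes [measurable]: "F \<in> borel_measurable M" "G \<in> borel_measurable M"
    and "integrable M (\<lambda>x. (norm (F x))\<^sup>2)" "integrable M (\<lambda>x. (norm (G x))\<^sup>2)"
  shows "integrable M (\<lambda>x. inner (F x) (G x))"
proof (rule Bochner_Integration.integrable_bound)
  show "integrable M (\<lambda>x. (norm (F x))\<^sup>2 + (norm (G x))\<^sup>2)" using assms by simp
  have "\<bar>inner u v\<bar> \<le> (norm u)\<^sup>2 + (norm v)\<^sup>2" for u v :: 'b
  proof -
    have "\<bar>inner u v\<bar> \<le> norm u * norm v" by (rule Cauchy_Schwarz_ineq2)
    also have "\<dots> \<le> (norm u)\<^sup>2 + (norm v)\<^sup>2"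
      using sum_squares_bound [of "norm u" "norm v"] mult_nonneg_nonneg [OF norm_ge_zero norm_ge_zero, of u v]
      by linarith
    finally show ?thesis .
  qed
  then show "AE x in M. norm (inner (F x) (G x)) \<le> norm ((norm (F x))\<^sup>2 + (norm (G x))\<^sup>2)"
    by simp
qed measurable

lemma L2s_iff_integrable:
  assumes "has_comps f F"
  shows "f \<in> L2s \<longleftrightarrow> integrable re_law (\<lambda>x. (norm (F x))\<^sup>2)"
proof -
  have [measurable]: "F \<in> borel_measurable re_law"
    using has_comps_measurable [OF assms] by (simp add: measurable_re_law)
  show ?thesis
    by (simp add: L2s_def has_comps_sqnorm [OF assms] integrable_iff_bounded)
qed

lemma L2s_add: "f \<in> L2s \<Longrightarrow> g \<in> L2s \<Longrightarrow> f + g \<in> L2s"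
proof -
  assume f: "f \<in> L2s" and g: "g \<in> L2s"
  obtain F G where F: "has_comps f F" and G: "has_comps g G" using ex_has_comps by metis
  have [measurable]: "F \<in> borel_measurable re_law" "G \<in> borel_measurable re_law"
    using F G by (auto simp: measurable_re_law has_comps_measurable)
  have "integrable re_law (\<lambda>x. (norm (F x))\<^sup>2 + 2 * inner (F x) (G x) + (norm (G x))\<^sup>2)"
    using f g integrable_inner_of_square [of F re_law G]
    by (simp add: L2s_iff_integrable [OF F] L2s_iff_integrable [OF G])
  also have "(\<lambda>x. (norm (F x))\<^sup>2 + 2 * inner (F x) (G x) + (norm (G x))\<^sup>2) = (\<lambda>x. (norm (F x + G x))\<^sup>2)"
    by (simp add: fun_eq_iff power2_norm_eq_inner inner_add_left inner_add_right inner_commute)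
  finally show ?thesis by (simp add: L2s_iff_integrable [OF has_comps_add [OF F G]])
qed

lemma L2s_dominated:
  assumes "has_comps f F" "has_comps g G" "f \<in> L2s" "AE x in re_law. norm (G x) \<le> c * norm (F x)"
  shows "g \<in> L2s"
proof -
  have [measurable]: "G \<in> borel_measurable re_law"
    using assms(2) by (auto simp: measurable_re_law has_comps_measurable)
  have "integrable re_law (\<lambda>x. (norm (G x))\<^sup>2)"
  proof (rule Bochner_Integration.integrable_bound)
    show "integrable re_law (\<lambda>x. c\<^sup>2 * (norm (F x))\<^sup>2)"
      using assms by (simp add: L2s_iff_integrable)
    show "AE x in re_law. norm ((norm (G x))\<^sup>2) \<le> norm (c\<^sup>2 * (norm (F x))\<^sup>2)"
      using assms(4)
    proof eventually_elim
      case (elim x)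
      then have "(norm (G x))\<^sup>2 \<le> (c * norm (F x))\<^sup>2" by (intro power_mono) auto
      then show ?case by (simp add: power_mult_distrib)
    qed
  qed measurable
  then show ?thesis using assms(2) by (simp add: L2s_iff_integrable)
qed

lemma norm_bmul_scalar: "norm (X \<odot> (a, 0)) = norm X * norm a"
proof -
  have "(norm (X \<odot> (a, 0)))\<^sup>2 = (norm X * norm a)\<^sup>2"
    by (simp add: norm_biquat_sq bmul_def norm_mult power_mult_distrib distrib_right)
  then show ?thesis by (simp add: power2_eq_iff_nonneg)
qed

lemma bmul_of_real: "X \<odot> (of_real r, 0) = r *\<^sub>R X"
  by (simp add: bmul_def prod_eq_iff scaleR_conv_of_real of_real_quat_comm)

lemma L2s_scale_right: "f \<in> L2s \<Longrightarrow> scale_right f a \<in> L2s"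
proof -
  assume f: "f \<in> L2s"
  obtain F where F: "has_comps f F" using ex_has_comps by metis
  show ?thesis
    by (rule L2s_dominated [OF F has_comps_scale_right [OF F] f, where c = "norm a"])
      (simp add: norm_bmul_scalar mult.commute)
qed

lemma L2s_uminus: "f \<in> L2s \<Longrightarrow> - f \<in> L2s"
proof -
  assume f: "f \<in> L2s"
  obtain F where F: "has_comps f F" using ex_has_comps by metis
  show ?thesis by (rule L2s_dominated [OF F has_comps_uminus [OF F] f, where c = 1]) simp
qed

lemma L2s_diff: "f \<in> L2s \<Longrightarrow> g \<in> L2s \<Longrightarrow> f - g \<in> L2s"
  using L2s_add [OF _ L2s_uminus, of f g] by simp

lemma L2s_0: "0 \<in> L2s"
  using L2s_iff_integrable [OF has_comps_0] by simp

text \<open>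
  As a type of its own, the space can be made an instance of \<^class>\<open>real_inner\<close> and
  \<^class>\<open>complete_space\<close>. Its real inner product is the real part of the quaternionic one; for right
  subspaces orthogonality has the same meaning for both.
\<close>

typedef slice_L2 = L2s morphisms class_of to_L2
  using L2s_0 by blast

setup_lifting type_definition_slice_L2

instantiation slice_L2 :: ab_group_add
begin
lift_definition zero_slice_L2 :: slice_L2 is 0 by (rule L2s_0)
lift_definition plus_slice_L2 :: "slice_L2 \<Rightarrow> slice_L2 \<Rightarrow> slice_L2" is "(+)" by (rule L2s_add)
lift_definition minus_slice_L2 :: "slice_L2 \<Rightarrow> slice_L2 \<Rightarrow> slice_L2" is "(-)" by (rule L2s_diff)
lift_definition uminus_slice_L2 :: "slice_L2 \<Rightarrow> slice_L2" is uminus by (rule L2s_uminus)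
instance by standard (transfer, simp add: algebra_simps)+
end

lift_definition L2_comps :: "slice_L2 \<Rightarrow> (real \<Rightarrow> biquat) \<Rightarrow> bool" is has_comps .

lemma ex_L2_comps: "\<exists>F. L2_comps f F"
  by transfer (rule ex_has_comps)

lemma L2_comps_measurable: "L2_comps f F \<Longrightarrow> F \<in> borel_measurable borel"
  by transfer (rule has_comps_measurable)

lemma L2_comps_eqI:
  "L2_comps f F \<Longrightarrow> L2_comps g G \<Longrightarrow> AE x in re_law. F x = G x \<Longrightarrow> f = g"
  by transfer (rule has_comps_eqI)

lemma L2_comps_unique: "L2_comps f F \<Longrightarrow> L2_comps f G \<Longrightarrow> AE x in re_law. F x = G x"
  by transfer (rule has_comps_unique)

lemma L2_comps_0: "L2_comps 0 (\<lambda>_. 0)"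
  by transfer (rule has_comps_0)

lemma L2_comps_add: "L2_comps f F \<Longrightarrow> L2_comps g G \<Longrightarrow> L2_comps (f + g) (\<lambda>x. F x + G x)"
  by transfer (rule has_comps_add)

lemma L2_comps_diff: "L2_comps f F \<Longrightarrow> L2_comps g G \<Longrightarrow> L2_comps (f - g) (\<lambda>x. F x - G x)"
  by transfer (rule has_comps_diff)

lemma L2_comps_square_integrable: "L2_comps f F \<Longrightarrow> integrable re_law (\<lambda>x. (norm (F x))\<^sup>2)"
  by transfer (simp add: L2s_iff_integrable)

lemma L2_comps_integrable_inner:
  assumes "L2_comps f F" "L2_comps g G"
  shows "integrable re_law (\<lambda>x. inner (F x) (G x))"
  using assms by (intro integrable_inner_of_square)
    (auto simp: measurable_re_law L2_comps_measurable L2_comps_square_integrable)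

instantiation slice_L2 :: real_vector
begin
lift_definition scaleR_slice_L2 :: "real \<Rightarrow> slice_L2 \<Rightarrow> slice_L2" is "\<lambda>r f. scale_right f (of_real r)"
  by (rule L2s_scale_right)

lemma L2_comps_scaleR: "L2_comps f F \<Longrightarrow> L2_comps (r *\<^sub>R f) (\<lambda>x. r *\<^sub>R F x)"
proof transfer
  fix f F r assume "has_comps f F"
  from has_comps_scale_right [OF this, of "of_real r"]
  show "has_comps (scale_right f (of_real r)) (\<lambda>x. r *\<^sub>R F x)" by (simp add: bmul_of_real)
qed

instance
proof
  fix a b :: real and x y :: slice_L2
  obtain X Y where X: "L2_comps x X" and Y: "L2_comps y Y" using ex_L2_comps by metis
  show "a *\<^sub>R (x + y) = a *\<^sub>R x + a *\<^sub>R y"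
    by (rule L2_comps_eqI [OF L2_comps_scaleR [OF L2_comps_add [OF X Y]]
          L2_comps_add [OF L2_comps_scaleR [OF X] L2_comps_scaleR [OF Y]]]) (simp add: scaleR_add_right)
  show "(a + b) *\<^sub>R x = a *\<^sub>R x + b *\<^sub>R x"
    by (rule L2_comps_eqI [OF L2_comps_scaleR [OF X]
          L2_comps_add [OF L2_comps_scaleR [OF X] L2_comps_scaleR [OF X]]]) (simp add: scaleR_add_left)
  show "a *\<^sub>R b *\<^sub>R x = (a * b) *\<^sub>R x"
    by (rule L2_comps_eqI [OF L2_comps_scaleR [OF L2_comps_scaleR [OF X]] L2_comps_scaleR [OF X]]) simp
  show "1 *\<^sub>R x = x"
    by (rule L2_comps_eqI [OF L2_comps_scaleR [OF X] X]) simp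
qed
end

definition some_comps :: "slice_L2 \<Rightarrow> real \<Rightarrow> biquat" where
  "some_comps f = (SOME F. L2_comps f F)"

lemma L2_comps_some: "L2_comps f (some_comps f)"
  unfolding some_comps_def by (rule someI_ex [OF ex_L2_comps])

instantiation slice_L2 :: real_inner
begin

definition inner_slice_L2 :: "slice_L2 \<Rightarrow> slice_L2 \<Rightarrow> real" where
  "inner f g = (\<integral>x. inner (some_comps f x) (some_comps g x) \<partial>re_law)"

definition norm_slice_L2 :: "slice_L2 \<Rightarrow> real" where "norm_slice_L2 f = sqrt (inner f f)"
definition sgn_slice_L2 :: "slice_L2 \<Rightarrow> slice_L2" where "sgn_slice_L2 f = f /\<^sub>R norm f"
definition dist_slice_L2 :: "slice_L2 \<Rightarrow> slice_L2 \<Rightarrow> real" where "dist_slice_L2 f g = norm (f - g)"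
definition [code del]:
  "(uniformity :: (slice_L2 \<times> slice_L2) filter) = (INF e\<in>{0 <..}. principal {(x, y). dist x y < e})"
definition [code del]:
  "open (U :: slice_L2 set) \<longleftrightarrow> (\<forall>x\<in>U. eventually (\<lambda>(x', y). x' = x \<longrightarrow> y \<in> U) uniformity)"

lemma inner_L2_eq:
  assumes "L2_comps f F" "L2_comps g G"
  shows "inner f g = (\<integral>x. inner (F x) (G x) \<partial>re_law)"
  unfolding inner_slice_L2_def
proof (rule integral_cong_AE)
  have [measurable]: "H \<in> borel_measurable re_law" if "L2_comps h H" for h H
    using that by (simp add: measurable_re_law L2_comps_measurable)
  note [measurable] = this [OF L2_comps_some] this [OF assms(1)] this [OF assms(2)]
  show "(\<lambda>x. inner (some_comps f x) (some_comps g x)) \<in> borel_measurable re_law"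
    "(\<lambda>x. inner (F x) (G x)) \<in> borel_measurable re_law" by measurable
  show "AE x in re_law. inner (some_comps f x) (some_comps g x) = inner (F x) (G x)"
    using L2_comps_unique [OF L2_comps_some assms(1)] L2_comps_unique [OF L2_comps_some assms(2)]
    by eventually_elim simp
qed

instance
proof
  fix f g h :: slice_L2 and r :: real
  obtain F G H where F: "L2_comps f F" and G: "L2_comps g G" and H: "L2_comps h H"
    using ex_L2_comps by metis
  show "dist f g = norm (f - g)" by (rule dist_slice_L2_def)
  show "sgn f = f /\<^sub>R norm f" by (rule sgn_slice_L2_def)
  show "uniformity = (INF e\<in>{0<..}. principal {(x, y :: slice_L2). dist x y < e})"
    by (rule uniformity_slice_L2_def)
  show "open U = (\<forall>x\<in>U. \<forall>\<^sub>F (x', y) in uniformity. x' = x \<longrightarrow> y \<in> U)" for U :: "slice_L2 set"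
    by (rule open_slice_L2_def)
  show "norm f = sqrt (inner f f)" by (rule norm_slice_L2_def)
  show "inner f g = inner g f"
    by (simp add: inner_L2_eq [OF F G] inner_L2_eq [OF G F] inner_commute)
  show "inner (f + g) h = inner f h + inner g h"
    by (simp add: inner_L2_eq [OF L2_comps_add [OF F G] H] inner_L2_eq [OF F H] inner_L2_eq [OF G H]
        inner_add_left L2_comps_integrable_inner [OF F H] L2_comps_integrable_inner [OF G H])
  show "inner (r *\<^sub>R f) g = r * inner f g"
    by (simp add: inner_L2_eq [OF L2_comps_scaleR [OF F] G] inner_L2_eq [OF F G])
  have ff: "inner f f = (\<integral>x. (norm (F x))\<^sup>2 \<partial>re_law)"
    by (simp add: inner_L2_eq [OF F F] power2_norm_eq_inner)
  then show "0 \<le> inner f f" by simp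
  show "inner f f = 0 \<longleftrightarrow> f = 0"
  proof
    assume "inner f f = 0"
    then have "AE x in re_law. (norm (F x))\<^sup>2 = 0"
      using integral_nonneg_eq_0_iff_AE [OF L2_comps_square_integrable [OF F]] ff by simp
    then show "f = 0" by (intro L2_comps_eqI [OF F L2_comps_0]) simp
  next
    assume "f = 0"
    then show "inner f f = 0" using inner_L2_eq [OF L2_comps_0 L2_comps_0] by simp
  qed
qed
end

lemma sqnorm_eq_norm: "sqnorm (class_of f) = ennreal ((norm f)\<^sup>2)"
proof -
  have F: "L2_comps f (some_comps f)" by (rule L2_comps_some)
  then have "has_comps (class_of f) (some_comps f)" by (simp add: L2_comps.rep_eq)
  then have "sqnorm (class_of f) = (\<integral>\<^sup>+ x. ennreal ((norm (some_comps f x))\<^sup>2) \<partial>re_law)"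
    by (rule has_comps_sqnorm)
  also have "\<dots> = ennreal (\<integral>x. (norm (some_comps f x))\<^sup>2 \<partial>re_law)"
    using L2_comps_square_integrable [OF F] by (intro nn_integral_eq_integral) auto
  also have "(\<integral>x. (norm (some_comps f x))\<^sup>2 \<partial>re_law) = (norm f)\<^sup>2"
    by (simp add: power2_norm_eq_inner inner_L2_eq [OF F F])
  finally show ?thesis .
qed

lemma Cauchy_fast_subseq:
  fixes X :: "nat \<Rightarrow> 'a::metric_space"
  assumes "Cauchy X"
  obtains r where "strict_mono r" "\<And>m n. n \<le> m \<Longrightarrow> dist (X (r n)) (X (r m)) < (1/2) ^ n"
proof -
  have "\<exists>N. \<forall>m\<ge>N. \<forall>k\<ge>N. dist (X m) (X k) < (1/2) ^ n" for n
    using metric_CauchyD [OF assms, of "(1/2) ^ n"] by simp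
  then obtain N where N: "\<And>n m k. m \<ge> N n \<Longrightarrow> k \<ge> N n \<Longrightarrow> dist (X m) (X k) < (1/2) ^ n"
    by metis
  define r where "r n = n + (\<Sum>i\<le>n. N i)" for n
  have "strict_mono r" unfolding strict_mono_Suc_iff by (simp add: r_def)
  have Nr: "N n \<le> r n" for n
    unfolding r_def using member_le_sum [of n "{..n}" N] by simp
  have "dist (X (r n)) (X (r m)) < (1/2) ^ n" if "n \<le> m" for m n
  proof (rule N)
    have "r n \<le> r m" using strict_mono_less_eq [OF \<open>strict_mono r\<close>] that by blast
    then show "N n \<le> r n" "N n \<le> r m" using Nr [of n] by auto
  qed
  with \<open>strict_mono r\<close> show thesis using that by blast
qed

text \<open>
  Completeness is inherited from functions of one variable, where every square-integrable pair of
  components belongs to a slice function.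
\<close>

instance slice_L2 :: complete_space
proof
  fix X :: "nat \<Rightarrow> slice_L2"
  assume "Cauchy X"
  then obtain r where r: "strict_mono r" "\<And>m n. n \<le> m \<Longrightarrow> dist (X (r n)) (X (r m)) < (1/2) ^ n"
    by (rule Cauchy_fast_subseq) blast
  define F where "F n = some_comps (X (r n))" for n
  have F: "L2_comps (X (r n)) (F n)" for n unfolding F_def by (rule L2_comps_some)
  have norm_eq: "(\<integral>\<^sup>+ x. ennreal ((norm (H x))\<^sup>2) \<partial>re_law) = ennreal ((norm h)\<^sup>2)" if "L2_comps h H" for h H
    using has_comps_sqnorm [of "class_of h" H] that by (simp add: L2_comps.rep_eq sqnorm_eq_norm)
  have Fm: "F n \<in> borel_measurable re_law" for n
    using L2_comps_measurable [OF F] by (simp add: measurable_re_law)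
  have fast: "(\<integral>\<^sup>+ x. ennreal ((norm (F n x - F m x))\<^sup>2) \<partial>re_law) \<le> ennreal ((1/4) ^ n)"
    if "n \<le> m" for m n
  proof -
    have "(norm (X (r n) - X (r m)))\<^sup>2 \<le> ((1/2) ^ n)\<^sup>2"
      using r(2) [OF that] by (intro power_mono) (auto simp: dist_norm)
    also have "\<dots> = (1/4) ^ n" by (simp add: power2_eq_square flip: power_mult_distrib)
    finally show ?thesis by (simp add: norm_eq [OF L2_comps_diff [OF F F]])
  qed
  obtain G where G: "G \<in> borel_measurable re_law" "AE x in re_law. (\<lambda>n. F n x) \<longlonglongrightarrow> G x"
    "\<And>n. (\<integral>\<^sup>+ x. ennreal ((norm (F n x - G x))\<^sup>2) \<partial>re_law) \<le> ennreal ((1/4) ^ n)"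
    by (rule L2_fast_Cauchy_limit [OF re_law.finite_measure_axioms Fm fast]) (assumption, rule that)
  have Gm: "G \<in> borel_measurable borel" using G(1) by (simp add: measurable_re_law)
  obtain g where g: "has_comps g G" using ex_class_of_comps [OF Gm] by blast
  obtain d where d: "has_comps d (\<lambda>x. F 0 x - G x)"
    using has_comps_diff [OF _ g] F by (metis L2_comps.rep_eq)
  have "d \<in> L2s" using has_comps_sqnorm [OF d] G(3) [of 0] by (auto simp: L2s_def intro: le_less_trans)
  have "g = class_of (X (r 0)) - d"
    using has_comps_diff [OF _ d] F [of 0] by (intro has_comps_eqI [OF g]) (auto simp: L2_comps.rep_eq)
  then have "g \<in> L2s" using \<open>d \<in> L2s\<close> class_of L2s_diff by blast
  then obtain l where l: "class_of l = g" by (metis to_L2_inverse)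
  then have lG: "L2_comps l G" using g by (simp add: L2_comps.rep_eq)
  have "norm (X (r n) - l) \<le> (1/2) ^ n" for n
  proof -
    have "ennreal ((norm (X (r n) - l))\<^sup>2) \<le> ennreal ((1/4) ^ n)"
      using G(3) [of n] by (simp only: norm_eq [OF L2_comps_diff [OF F lG]])
    then have "(norm (X (r n) - l))\<^sup>2 \<le> (1/4) ^ n" by (simp add: ennreal_le_iff)
    also have "(1/4::real) ^ n = ((1/2) ^ n)\<^sup>2" by (simp add: power2_eq_square flip: power_mult_distrib)
    finally show ?thesis by (rule power2_le_imp_le) simp
  qed
  then have "\<forall>\<^sub>F n in sequentially. norm (X (r n) - l) \<le> (1/2) ^ n" by simp
  moreover have "(\<lambda>n. (1/2 :: real) ^ n) \<longlonglongrightarrow> 0" by (intro LIMSEQ_realpow_zero) auto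
  ultimately have "(\<lambda>n. X (r n) - l) \<longlonglongrightarrow> 0" by (rule Lim_null_comparison)
  then have "(X \<circ> r) \<longlonglongrightarrow> l" by (simp add: LIM_zero_iff o_def)
  with \<open>Cauchy X\<close> r(1) have "X \<longlonglongrightarrow> l" by (rule Cauchy_converges_subseq)
  then show "convergent X" by (auto simp: convergent_def)
qed

lemma L2s_tendsto_iff: "L2s_tendsto (\<lambda>n. class_of (X n)) (class_of f) \<longleftrightarrow> X \<longlonglongrightarrow> f"
proof -
  have "sqnorm (class_of (X n) - class_of f) = ennreal ((norm (X n - f))\<^sup>2)" for n
    by (simp only: minus_slice_L2.rep_eq [symmetric] sqnorm_eq_norm)
  then have "L2s_tendsto (\<lambda>n. class_of (X n)) (class_of f) \<longleftrightarrow> (\<lambda>n. ennreal ((norm (X n - f))\<^sup>2)) \<longlonglongrightarrow> ennreal 0"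
    by (simp add: L2s_tendsto_def)
  also have "\<dots> \<longleftrightarrow> (\<lambda>n. (norm (X n - f))\<^sup>2) \<longlonglongrightarrow> 0"
    by (rule tendsto_ennreal_iff) auto
  also have "\<dots> \<longleftrightarrow> (\<lambda>n. norm (X n - f)) \<longlonglongrightarrow> 0"
    using tendsto_real_sqrt [of "\<lambda>n. (norm (X n - f))\<^sup>2" 0] tendsto_power [of "\<lambda>n. norm (X n - f)" 0 _ 2] by auto
  also have "\<dots> \<longleftrightarrow> X \<longlonglongrightarrow> f" by (simp add: tendsto_norm_zero_iff LIM_zero_iff)
  finally show ?thesis .
qed

section \<open>Fourier series\<close>

lemma re_angle_cos:
  assumes "t \<in> {0..2 * pi}"
  shows "cos (real_of_int k * re_angle (cos t)) = cos (real_of_int k * t)"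
proof (cases "t \<le> pi")
  case True
  then show ?thesis using assms by (simp add: re_angle_eq arccos_cos)
next
  case False
  have "re_angle (cos t) = arccos (cos (2 * pi - t))" by (simp add: re_angle_eq)
  also have "\<dots> = 2 * pi - t" using False assms by (intro arccos_cos) auto
  finally have "re_angle (cos t) = 2 * pi - t" .
  moreover have "real_of_int k * (2 * pi - t) = 2 * pi * real_of_int k - real_of_int k * t"
    by (simp add: algebra_simps)
  ultimately show ?thesis by (simp add: cos_diff)
qed

lemma emeasure_re_law: "emeasure re_law UNIV = 1"
  unfolding re_law_def by (subst emeasure_distr) (simp_all add: measurable_angle emeasure_angle_measure)

lemma integral_cos_re_angle:
  "(\<integral>x. cos (real_of_int k * re_angle x) \<partial>re_law) = (if k = 0 then 1 else 0)"
proof (cases "k = 0")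
  case True
  have "measure re_law UNIV = 1"
    by (simp add: measure_def emeasure_re_law)
  with True show ?thesis by simp
next
  case False
  have "(\<integral>x. cos (real_of_int k * re_angle x) \<partial>re_law)
    = (\<integral>t. cos (real_of_int k * re_angle (cos t)) \<partial>angle_measure)"
    unfolding re_law_def by (rule integral_distr) (simp_all add: measurable_angle)
  also have "\<dots> = (\<integral>t. cos (real_of_int k * t) \<partial>angle_measure)"
    by (rule integral_cong_AE)
      (auto simp: measurable_angle intro!: AE_angleI [of "{}"] re_angle_cos)
  also have "\<dots> = 0" by (rule integral_cos_angle [OF False])
  finally show ?thesis using False by simp
qed

lemma unitary_scalar: "unitary n x \<odot> (a, 0)
    = (cos (n * re_angle x) *\<^sub>R a, sin (n * re_angle x) *\<^sub>R a)"
  by (simp add: unitary_def bmul_def scaleR_conv_of_real)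

lemma norm_unitary_scalar: "norm (unitary n x \<odot> (a, 0)) = norm a"
proof -
  have "(norm (unitary n x \<odot> (a, 0)))\<^sup>2 = (norm a)\<^sup>2"
    by (simp add: unitary_scalar norm_biquat_sq power_mult_distrib flip: distrib_right)
  then show ?thesis by (simp add: power2_eq_iff_nonneg)
qed

lemma qmonom_L2s: "qmonom n a \<in> L2s"
proof -
  have "sqnorm (qmonom n a) = ennreal ((norm a)\<^sup>2) * emeasure re_law UNIV"
    by (simp add: has_comps_sqnorm [OF has_comps_qmonom] norm_unitary_scalar)
  also have "\<dots> < \<infinity>" by (simp add: emeasure_re_law)
  finally show ?thesis by (simp add: L2s_def)
qed

lift_definition monom_L2 :: "int \<Rightarrow> quat \<Rightarrow> slice_L2" is qmonom by (rule qmonom_L2s)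

lemma L2_comps_monom: "L2_comps (monom_L2 n a) (\<lambda>x. unitary n x \<odot> (a, 0))"
  by transfer (rule has_comps_qmonom)

lemma monom_L2_add: "monom_L2 n (a + b) = monom_L2 n a + monom_L2 n b"
  by (rule L2_comps_eqI [OF L2_comps_monom L2_comps_add [OF L2_comps_monom L2_comps_monom]])
    (simp add: unitary_scalar scaleR_add_right)

lemma monom_L2_scaleR: "monom_L2 n (r *\<^sub>R a) = r *\<^sub>R monom_L2 n a"
  by (rule L2_comps_eqI [OF L2_comps_monom L2_comps_scaleR [OF L2_comps_monom]])
    (simp add: unitary_scalar)

lemma linear_monom_L2: "linear (monom_L2 n)"
  by (rule linearI) (simp_all add: monom_L2_add monom_L2_scaleR)

lemma inner_monom_L2: "inner (monom_L2 n a) (monom_L2 m b) = (if n = m then inner a b else 0)"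
proof -
  have "inner (monom_L2 n a) (monom_L2 m b)
    = (\<integral>x. inner (unitary n x \<odot> (a, 0)) (unitary m x \<odot> (b, 0)) \<partial>re_law)"
    by (rule inner_L2_eq [OF L2_comps_monom L2_comps_monom])
  also have "\<dots> = (\<integral>x. cos (real_of_int (n - m) * re_angle x) * inner a b \<partial>re_law)"
    by (simp add: unitary_scalar cos_diff left_diff_distrib distrib_right algebra_simps)
  also have "\<dots> = (if n = m then inner a b else 0)"
    using integral_cos_re_angle [of "n - m"] by simp
  finally show ?thesis .
qed

text \<open>
  Uniqueness of Fourier coefficients for integrable functions. The frequencies \<open>n\<close> and \<open>- n\<close> together
  separate the cosine integrals of the first component from the sine integrals of the second one. The
  recursion \<open>2 x cos n t = cos (n + 1) t + cos (n - 1) t\<close> with \<open>x = cos t\<close>, and the same one for sines,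
  then makes all moments in \<open>x\<close> of the first component and of \<open>sin t\<close> times the second one vanish.
  Integrability is enough, which matters because products of square-integrable functions are tested.
\<close>

lemma fourier_unique:
  assumes H: "integrable re_law H"
    and zero: "\<And>n a. (\<integral>x. inner (H x) (unitary n x \<odot> (a, 0)) \<partial>re_law) = 0"
  shows "AE x in re_law. H x = 0"
proof -
  define c where "c n x = cos (real_of_int n * re_angle x)" for n x
  define s where "s n x = sin (real_of_int n * re_angle x)" for n x
  have meas [measurable]: "c n \<in> borel_measurable re_law" "s n \<in> borel_measurable re_law" for n
    unfolding c_def s_def by (simp_all add: measurable_re_law)
  have [measurable]: "(\<lambda>x. x) \<in> borel_measurable re_law" by (simp add: measurable_re_law)
  have cs_le: "\<bar>c n x\<bar> \<le> 1" "\<bar>s n x\<bar> \<le> 1" for n x unfolding c_def s_def by simp_all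
  have supp: "AE x in re_law. x \<in> {-1..1}"
    using AE_re_law_interior by eventually_elim auto
  have rec: "x * c n x = (c (n + 1) x + c (n - 1) x) / 2" "x * s n x = (s (n + 1) x + s (n - 1) x) / 2"
    if "x \<in> {-1..1}" for n x
  proof -
    have "cos (re_angle x) = x" using that by (simp add: re_angle_eq abs_le_iff)
    then show "x * c n x = (c (n + 1) x + c (n - 1) x) / 2" "x * s n x = (s (n + 1) x + s (n - 1) x) / 2"
      by (simp_all add: c_def s_def distrib_right left_diff_distrib cos_add cos_diff sin_add sin_diff)
  qed
  have bnd: "integrable re_law (\<lambda>x. g x * h x)"
    if "integrable re_law h" "g \<in> borel_measurable re_law" "\<And>x. x \<in> {-1..1} \<Longrightarrow> \<bar>g x\<bar> \<le> 1"
    for g h :: "real \<Rightarrow> real"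
  proof (rule Bochner_Integration.integrable_bound [OF that(1)])
    show "AE x in re_law. norm (g x * h x) \<le> norm (h x)"
      using supp by eventually_elim (use that(3) in \<open>auto simp: abs_mult intro!: mult_left_le_one_le\<close>)
    show "(\<lambda>x. g x * h x) \<in> borel_measurable re_law" using that(1,2) by measurable
  qed
  have powers: "(\<integral>x. x ^ k * (e n x * h x) \<partial>re_law) = 0"
    if h: "integrable re_law h" and e: "e = c \<or> e = s" and "\<And>n. (\<integral>x. e n x * h x \<partial>re_law) = 0"
    for e k n h
  proof (induction k arbitrary: n)
    case 0
    show ?case using that(3) by simp
  next
    case (Suc k)
    have [measurable]: "h \<in> borel_measurable re_law" using h by simp
    have em [measurable]: "e n \<in> borel_measurable re_law" for n using e meas by auto
    have e_le: "\<bar>e n x\<bar> \<le> 1" for n x using e cs_le by auto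
    have rec: "x * e n x = (e (n + 1) x + e (n - 1) x) / 2" if "x \<in> {-1..1}" for n x
      using rec [OF that] e by auto
    have int: "integrable re_law (\<lambda>x. x ^ k * (e n x * h x))" for n
      unfolding mult.assoc [symmetric]
    proof (rule bnd [OF h])
      fix x :: real assume "x \<in> {-1..1}"
      then have "\<bar>x\<bar> ^ k \<le> 1" by (intro power_le_one) auto
      then show "\<bar>x ^ k * e n x\<bar> \<le> 1"
        using e_le [of n x] by (simp add: abs_mult power_abs mult_le_one)
    qed measurable
    have "(\<integral>x. x ^ Suc k * (e n x * h x) \<partial>re_law)
      = (\<integral>x. x ^ k * (e (n + 1) x * h x) / 2 + x ^ k * (e (n - 1) x * h x) / 2 \<partial>re_law)"
    proof (rule integral_cong_AE)
      show "AE x in re_law. x ^ Suc k * (e n x * h x)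
          = x ^ k * (e (n + 1) x * h x) / 2 + x ^ k * (e (n - 1) x * h x) / 2"
        using supp
      proof eventually_elim
        case (elim x)
        have "x ^ Suc k * (e n x * h x) = x ^ k * (x * e n x) * h x" by (simp add: mult_ac)
        then show ?case by (simp add: rec [OF elim] field_simps)
      qed
    qed measurable
    also have "\<dots> = 0" using int Suc.IH by simp
    finally show ?case .
  qed
  have H_basis: "AE x in re_law. inner (fst (H x)) b = 0 \<and> inner (snd (H x)) b = 0" for b :: quat
  proof -
    define h1 where "h1 x = inner (fst (H x)) b" for x
    define h2 where "h2 x = inner (snd (H x)) b" for x
    have "bounded_linear (\<lambda>z :: biquat. inner (fst z) b)" "bounded_linear (\<lambda>z :: biquat. inner (snd z) b)"
      by (intro bounded_linear_compose [OF bounded_linear_inner_left] bounded_linear_fst bounded_linear_snd)+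
    from this [THEN integrable_bounded_linear, OF H]
    have h: "integrable re_law h1" "integrable re_law h2" by (simp_all add: h1_def [abs_def] h2_def [abs_def])
    have ch: "integrable re_law (\<lambda>x. c n x * h1 x)" and sh: "integrable re_law (\<lambda>x. s n x * h2 x)" for n
      using h cs_le by (auto intro: bnd)
    have sum: "(\<integral>x. c n x * h1 x \<partial>re_law) + (\<integral>x. s n x * h2 x \<partial>re_law) = 0" for n
    proof -
      have "(\<integral>x. c n x * h1 x \<partial>re_law) + (\<integral>x. s n x * h2 x \<partial>re_law)
        = (\<integral>x. inner (H x) (unitary n x \<odot> (b, 0)) \<partial>re_law)"
        using ch [of n] sh [of n]
        by (simp add: unitary_scalar inner_prod_def c_def s_def h1_def h2_def flip: Bochner_Integration.integral_add)
      then show ?thesis by (simp add: zero)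
    qed
    have "c (- n) = c n" "s (- n) x = - s n x" for n x by (auto simp: c_def s_def)
    then have diff: "(\<integral>x. c n x * h1 x \<partial>re_law) - (\<integral>x. s n x * h2 x \<partial>re_law) = 0" for n
      using sum [of "- n"] by simp
    have c0: "(\<integral>x. c n x * h1 x \<partial>re_law) = 0" and s0: "(\<integral>x. s n x * h2 x \<partial>re_law) = 0" for n
      using sum [of n] diff [of n] by linarith+
    \<comment> \<open>The starting frequencies are 0 and 1: \<open>c 0\<close> is constant, and \<open>s 1\<close> has no zero in \<open>(- 1, 1)\<close>.\<close>
    have "AE x in re_law. h1 x = 0"
    proof (rule integrable_moments_zero [OF re_law.finite_measure_axioms sets_re_law supp h(1)])
      show "(\<integral>x. x ^ k * h1 x \<partial>re_law) = 0" for k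
        using powers [OF h(1), of c k 0] c0 by (simp add: c_def)
    qed
    moreover have "AE x in re_law. s 1 x * h2 x = 0"
      by (rule integrable_moments_zero [OF re_law.finite_measure_axioms sets_re_law supp sh])
        (rule powers [OF h(2)], use s0 in auto)
    then have "AE x in re_law. h2 x = 0"
      using AE_re_law_interior
    proof eventually_elim
      case (elim x)
      then have "s 1 x \<noteq> 0" using sin_arccos_nonzero [of x] by (simp add: s_def re_angle_eq)
      with elim show ?case by simp
    qed
    ultimately show ?thesis by (simp add: h1_def h2_def)
  qed
  have "AE x in re_law. \<forall>b\<in>Basis. inner (fst (H x)) b = 0 \<and> inner (snd (H x)) b = 0"
    using H_basis by (intro AE_finite_allI) auto
  then show ?thesis
    by eventually_elim (auto simp: prod_eq_iff intro!: euclidean_eqI [where 'a = quat])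
qed

lemma L2_comps_integrable: "L2_comps f F \<Longrightarrow> integrable re_law F"
proof -
  assume F: "L2_comps f F"
  have [measurable]: "F \<in> borel_measurable re_law"
    using L2_comps_measurable [OF F] by (simp add: measurable_re_law)
  show ?thesis
  proof (rule Bochner_Integration.integrable_bound)
    show "integrable re_law (\<lambda>x. 1 + (norm (F x))\<^sup>2)"
      using L2_comps_square_integrable [OF F] by simp
    have "norm z \<le> 1 + (norm z)\<^sup>2" for z :: biquat
      using sum_squares_bound [of 1 "norm z"] norm_ge_zero [of z] unfolding power_one by linarith
    then show "AE x in re_law. norm (F x) \<le> norm (1 + (norm (F x))\<^sup>2)" by simp
  qed measurable
qed

lemma orthogonal_to_monoms_zero:
  assumes "\<And>n a. inner f (monom_L2 n a) = 0"
  shows "f = 0"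
proof -
  obtain F where F: "L2_comps f F" using ex_L2_comps by blast
  have "AE x in re_law. F x = 0"
    using assms by (intro fourier_unique L2_comps_integrable [OF F]) (simp add: inner_L2_eq [OF F L2_comps_monom])
  then show ?thesis by (rule L2_comps_eqI [OF F L2_comps_0])
qed

definition fourier_coeff :: "slice_L2 \<Rightarrow> int \<Rightarrow> quat" where
  "fourier_coeff f n = (\<Sum>b\<in>Basis. inner f (monom_L2 n b) *\<^sub>R b)"

text \<open>
  Quaternion-valued coefficients are split along the real basis, since the expansion lemma is one for
  real Hilbert spaces. The limit of the series is \<open>f\<close> because the difference is orthogonal to all
  monomials.
\<close>

lemma fourier_series_converges:
  "(\<lambda>N. \<Sum>n = - int N..int N. monom_L2 n (fourier_coeff f n)) \<longlonglongrightarrow> f"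
proof -
  let ?A = "\<lambda>N. {- int N..int N} \<times> (Basis :: quat set)"
  obtain g where g: "(\<lambda>N. \<Sum>i\<in>?A N. inner f (case_prod monom_L2 i) *\<^sub>R case_prod monom_L2 i) \<longlonglongrightarrow> g"
    "\<And>N i. i \<in> ?A N \<Longrightarrow> inner (f - g) (case_prod monom_L2 i) = 0"
  proof (rule orthonormal_expansion [where e = "case_prod monom_L2" and A = ?A and f = f])
    show "inner (case_prod monom_L2 i) (case_prod monom_L2 j) = (if i = j then 1 else 0)"
      if "i \<in> ?A N" "j \<in> ?A N" for N i j
      using that by (auto simp: inner_monom_L2 inner_Basis split: if_splits)
    show "incseq ?A" by (auto simp: incseq_def)
  qed auto
  have "(\<Sum>i\<in>?A N. inner f (case_prod monom_L2 i) *\<^sub>R case_prod monom_L2 i)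
    = (\<Sum>n = - int N..int N. monom_L2 n (fourier_coeff f n))" for N
    by (simp add: sum.cartesian_product' fourier_coeff_def linear_sum [OF linear_monom_L2] linear_scale [OF linear_monom_L2])
  with g(1) have lim: "(\<lambda>N. \<Sum>n = - int N..int N. monom_L2 n (fourier_coeff f n)) \<longlonglongrightarrow> g" by simp
  have "f - g = 0"
  proof (rule orthogonal_to_monoms_zero)
    fix n a
    have "n \<in> {- int (nat \<bar>n\<bar>)..int (nat \<bar>n\<bar>)}" by auto
    then have b: "inner (f - g) (monom_L2 n b) = 0" if "b \<in> Basis" for b
      using g(2) [of "(n, b)" "nat \<bar>n\<bar>"] that by simp
    have "monom_L2 n a = (\<Sum>b\<in>Basis. inner a b *\<^sub>R monom_L2 n b)"
      using linear_sum [OF linear_monom_L2, of n "\<lambda>b. inner a b *\<^sub>R b" Basis]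
      by (simp add: euclidean_representation linear_scale [OF linear_monom_L2])
    then show "inner (f - g) (monom_L2 n a) = 0" by (simp add: inner_sum_right b)
  qed
  with lim show ?thesis by simp
qed

lemma class_of_sum: "class_of (\<Sum>n\<in>A. X n) = (\<Sum>n\<in>A. class_of (X n))"
  by (induction A rule: infinite_finite_induct) (simp_all add: zero_slice_L2.rep_eq plus_slice_L2.rep_eq)

lemma has_coeffs_iff:
  "has_coeffs (class_of f) a \<longleftrightarrow> (\<lambda>N. \<Sum>n = - int N..int N. monom_L2 n (a n)) \<longlonglongrightarrow> f"
  unfolding has_coeffs_def L2s_tendsto_iff [symmetric] class_of_sum monom_L2.rep_eq ..

lemma has_coeffs_L2s:
  assumes "has_coeffs f a"
  obtains g where "f = class_of g"
proof -
  let ?S = "\<lambda>N. \<Sum>n = - int N..int N. qmonom n (a n)"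
  have "(\<lambda>N. sqnorm (?S N - f)) \<longlonglongrightarrow> 0" using assms by (simp add: has_coeffs_def L2s_tendsto_def)
  then have "\<forall>\<^sub>F N in sequentially. sqnorm (?S N - f) < 1" by (rule order_tendstoD) simp
  then obtain N where "sqnorm (?S N - f) < 1" by (auto simp: eventually_sequentially)
  then have "?S N - f \<in> L2s" by (auto simp: L2s_def intro: less_trans)
  moreover have "?S N = class_of (\<Sum>n = - int N..int N. monom_L2 n (a n))"
    by (simp add: class_of_sum monom_L2.rep_eq)
  then have "?S N \<in> L2s" using class_of by simp
  ultimately have "?S N - (?S N - f) \<in> L2s" by (rule L2s_diff [rotated])
  then have "f \<in> L2s" by simp
  then show thesis using that by (metis to_L2_inverse)
qed

lemma has_coeffs_unique:
  assumes "has_coeffs (class_of f) a"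
  shows "a = fourier_coeff f"
proof
  fix m
  have lim: "(\<lambda>N. \<Sum>n = - int N..int N. monom_L2 n (a n)) \<longlonglongrightarrow> f"
    using assms by (simp add: has_coeffs_iff)
  have coeff: "inner (a m) b = inner f (monom_L2 m b)" for b
  proof (rule LIMSEQ_unique)
    show "(\<lambda>N. inner (\<Sum>n = - int N..int N. monom_L2 n (a n)) (monom_L2 m b)) \<longlonglongrightarrow> inner f (monom_L2 m b)"
      by (intro tendsto_intros lim)
    have "\<forall>\<^sub>F N in sequentially. inner (\<Sum>n = - int N..int N. monom_L2 n (a n)) (monom_L2 m b) = inner (a m) b"
      using eventually_ge_at_top [of "nat \<bar>m\<bar>"]
    proof eventually_elim
      case (elim N)
      then have "m \<in> {- int N..int N}" by auto
      then show ?case by (simp add: inner_sum_left inner_monom_L2 sum.delta)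
    qed
    then show "(\<lambda>N. inner (\<Sum>n = - int N..int N. monom_L2 n (a n)) (monom_L2 m b)) \<longlonglongrightarrow> inner (a m) b"
      by (rule tendsto_eventually)
  qed
  show "a m = fourier_coeff f m"
    unfolding fourier_coeff_def coeff [symmetric] by (rule euclidean_representation [symmetric])
qed

section \<open>Conjugation of coefficients\<close>

text \<open>
  Quaternionic conjugation extended linearly in \<open>\<iota>\<close>; it differs from \<open>badj\<close> by \<open>\<iota> \<mapsto> - \<iota>\<close>, and it
  reverses products as well.
\<close>

definition bconj :: "biquat \<Rightarrow> biquat" where
  "bconj X = (qcnj (fst X), qcnj (snd X))"

lemma norm_bconj: "norm (bconj X) = norm X"
  by (simp add: bconj_def norm_prod_def)

lemma bconj_diff: "bconj (X - Y) = bconj X - bconj Y"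
  by (simp add: bconj_def qcnj_minus)

lemma bconj_0: "bconj 0 = 0" and bconj_add: "bconj (X + Y) = bconj X + bconj Y"
  by (simp_all add: bconj_def qcnj_add prod_eq_iff)

lemma bconj_sum: "bconj (\<Sum>i\<in>A. X i) = (\<Sum>i\<in>A. bconj (X i))"
  by (induction A rule: infinite_finite_induct) (simp_all add: bconj_0 bconj_add)

lemma bconj_unitary_scalar: "bconj (unitary n x \<odot> (a, 0)) = unitary n x \<odot> (qcnj a, 0)"
  by (simp add: bconj_def unitary_scalar qcnj_scaleR)

lemma measurable_bconj [measurable]: "bconj \<in> borel_measurable borel"
  unfolding bconj_def
  by (intro borel_measurable_continuous_onI continuous_intros
      continuous_on_compose2 [OF continuous_on_qcnj [of UNIV]]) auto

lemma L2_comps_sum: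
  "(\<And>i. L2_comps (X i) (F i)) \<Longrightarrow> L2_comps (\<Sum>i\<in>A. X i) (\<lambda>x. \<Sum>i\<in>A. F i x)"
  by (induction A rule: infinite_finite_induct) (simp_all add: L2_comps_0 L2_comps_add)

text \<open>
  The pointwise operation \<open>bconj\<close> is an isometry that turns \<open>q\<^sup>n a\<close> into \<open>q\<^sup>n\<close> times the conjugate of
  \<open>a\<close>. It therefore carries the Fourier series of \<open>f\<close> to a convergent series with conjugate
  coefficients, whose sum is the only candidate in the definition of the conjugate.
\<close>

lemma has_comps_slice_conj:
  assumes F: "has_comps f F" and f: "f \<in> L2s"
  shows "has_comps (slice_conj f) (\<lambda>x. bconj (F x))"
proof -
  obtain f' where f': "f = class_of f'" using f by (metis to_L2_inverse)
  have F': "L2_comps f' F" using F f' by (simp add: L2_comps.rep_eq)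
  have "(\<lambda>x. bconj (F x)) \<in> borel_measurable borel"
    using has_comps_measurable [OF F] by measurable
  then obtain g where g: "has_comps g (\<lambda>x. bconj (F x))" using ex_class_of_comps by blast
  have "g \<in> L2s" by (rule L2s_dominated [OF F g f, where c = 1]) (simp add: norm_bconj)
  then obtain g' where g': "g = class_of g'" by (metis to_L2_inverse)
  have G': "L2_comps g' (\<lambda>x. bconj (F x))" using g g' by (simp add: L2_comps.rep_eq)
  let ?a = "fourier_coeff f'"
  have norm_eq: "norm k = norm l" if "L2_comps k K" "L2_comps l (\<lambda>x. bconj (K x))" for k l K
  proof -
    have "(norm k)\<^sup>2 = (norm l)\<^sup>2"
      by (simp add: power2_norm_eq_inner inner_L2_eq [OF that(1) that(1)] inner_L2_eq [OF that(2) that(2)])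
        (simp add: norm_bconj flip: power2_norm_eq_inner)
    then show ?thesis by (simp add: power2_eq_iff_nonneg)
  qed
  have "norm ((\<Sum>n = - int N..int N. monom_L2 n (?a n)) - f')
    = norm ((\<Sum>n = - int N..int N. monom_L2 n (qcnj (?a n))) - g')" for N
  proof (rule norm_eq)
    show "L2_comps ((\<Sum>n = - int N..int N. monom_L2 n (?a n)) - f')
      (\<lambda>x. (\<Sum>n = - int N..int N. unitary n x \<odot> (?a n, 0)) - F x)"
      by (intro L2_comps_diff L2_comps_sum L2_comps_monom F')
    have "L2_comps ((\<Sum>n = - int N..int N. monom_L2 n (qcnj (?a n))) - g')
      (\<lambda>x. (\<Sum>n = - int N..int N. unitary n x \<odot> (qcnj (?a n), 0)) - bconj (F x))"
      by (intro L2_comps_diff L2_comps_sum L2_comps_monom G')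
    then show "L2_comps ((\<Sum>n = - int N..int N. monom_L2 n (qcnj (?a n))) - g')
      (\<lambda>x. bconj ((\<Sum>n = - int N..int N. unitary n x \<odot> (?a n, 0)) - F x))"
      by (simp add: bconj_diff bconj_sum bconj_unitary_scalar)
  qed
  then have "(\<lambda>N. \<Sum>n = - int N..int N. monom_L2 n (qcnj (?a n))) \<longlonglongrightarrow> g'"
    using fourier_series_converges [of f']
    by (simp add: tendsto_iff dist_norm)
  then have cg: "has_coeffs g (\<lambda>n. qcnj (?a n))" by (simp add: g' has_coeffs_iff)
  have cf: "has_coeffs f ?a" using fourier_series_converges by (simp add: f' has_coeffs_iff)
  have "slice_conj f = g"
    unfolding slice_conj_def
  proof (rule the_equality)
    show "\<exists>a. has_coeffs f a \<and> has_coeffs g (\<lambda>n. qcnj (a n))" using cf cg by blast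
    fix k assume "\<exists>a. has_coeffs f a \<and> has_coeffs k (\<lambda>n. qcnj (a n))"
    then obtain a where a: "has_coeffs f a" "has_coeffs k (\<lambda>n. qcnj (a n))" by blast
    from a(1) have "a = ?a" using has_coeffs_unique f' by blast
    with a(2) have k: "has_coeffs k (\<lambda>n. qcnj (?a n))" by simp
    then obtain k' where k': "k = class_of k'" by (rule has_coeffs_L2s)
    then have "k' = g'" using k cg LIMSEQ_unique by (auto simp: g' has_coeffs_iff)
    then show "k = g" by (simp add: k' g')
  qed
  then show ?thesis using g by simp
qed

section \<open>The star product and powers of the variable\<close>

lemma unitary_add: "unitary n x \<odot> unitary m x = unitary (n + m) x"
  by (simp add: unitary_def bmul_def distrib_right cos_add sin_add)

lemma unitary_0: "unitary 0 x = (1, 0)"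
  by (simp add: unitary_def)

lemma norm_unitary: "norm (unitary n x) = 1"
  using norm_unitary_scalar [of n x 1] by simp

lemma has_comps_shift: "has_comps f F \<Longrightarrow> has_comps (qmonom n 1 \<star> f) (\<lambda>x. unitary n x \<odot> F x)"
  using has_comps_star [OF has_comps_qmonom [of n 1]] by simp

lemma shift_shift: "qmonom n 1 \<star> (qmonom m 1 \<star> f) = qmonom (n + m) 1 \<star> f"
proof -
  obtain F where F: "has_comps f F" using ex_has_comps by blast
  show ?thesis
    by (rule has_comps_eqI [OF has_comps_shift [OF has_comps_shift [OF F]] has_comps_shift [OF F]])
      (simp add: unitary_add flip: bmul_assoc)
qed

lemma shift_0: "qmonom 0 1 \<star> f = f"
proof -
  obtain F where F: "has_comps f F" using ex_has_comps by blast
  show ?thesis by (rule has_comps_eqI [OF has_comps_shift [OF F] F]) (simp add: unitary_0)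
qed

text \<open>
  The powers of \<open>q\<close> are central for the star product.
\<close>

lemma shift_star: "qmonom n 1 \<star> (f \<star> g) = f \<star> (qmonom n 1 \<star> g)"
proof -
  obtain F G where F: "has_comps f F" and G: "has_comps g G" using ex_has_comps by metis
  have "unitary n x \<odot> (F x \<odot> G x) = F x \<odot> (unitary n x \<odot> G x)" for x
    by (simp only: bmul_assoc [symmetric] central_bmul_commute [OF central_unitary, of n x "F x"])
  then show ?thesis
    by (intro has_comps_eqI [OF has_comps_shift [OF has_comps_star [OF F G]]
          has_comps_star [OF F has_comps_shift [OF G]]]) simp
qed

lemma shift_L2s: "f \<in> L2s \<Longrightarrow> qmonom n 1 \<star> f \<in> L2s"
proof -
  assume f: "f \<in> L2s"
  obtain F where F: "has_comps f F" using ex_has_comps by blast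
  show ?thesis
    using norm_bmul_le [of "unitary n _"]
    by (intro L2s_dominated [OF F has_comps_shift [OF F] f, where c = 4]) (simp add: norm_unitary)
qed

lemma star_qmonom: "f \<star> qmonom n a = scale_right (qmonom n 1 \<star> f) a"
proof -
  obtain F where F: "has_comps f F" using ex_has_comps by blast
  have "F x \<odot> (unitary n x \<odot> (a, 0)) = unitary n x \<odot> F x \<odot> (a, 0)" for x
    by (simp only: bmul_assoc [symmetric] central_bmul_commute [OF central_unitary, of n x "F x"])
  then show ?thesis
    by (intro has_comps_eqI [OF has_comps_star [OF F has_comps_qmonom]
          has_comps_scale_right [OF has_comps_shift [OF F]]]) simp
qed

lemma star_one: "f \<star> qmonom 0 1 = f"
proof -
  obtain F where F: "has_comps f F" using ex_has_comps by blast
  show ?thesis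
    by (rule has_comps_eqI [OF has_comps_star [OF F has_comps_qmonom] F]) (simp add: unitary_0)
qed

lemma star_assoc: "f \<star> g \<star> h = f \<star> (g \<star> h)"
proof -
  obtain F G H where FGH: "has_comps f F" "has_comps g G" "has_comps h H" using ex_has_comps by metis
  show ?thesis
    by (rule has_comps_eqI [OF has_comps_star [OF has_comps_star [OF FGH(1,2)] FGH(3)]
          has_comps_star [OF FGH(1) has_comps_star [OF FGH(2,3)]]]) (simp add: bmul_assoc)
qed

lemma star_diff_right: "f \<star> (g - h) = f \<star> g - f \<star> h"
proof -
  obtain F G H where FGH: "has_comps f F" "has_comps g G" "has_comps h H" using ex_has_comps by metis
  show ?thesis
    by (rule has_comps_eqI [OF has_comps_star [OF FGH(1) has_comps_diff [OF FGH(2,3)]]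
          has_comps_diff [OF has_comps_star [OF FGH(1,2)] has_comps_star [OF FGH(1,3)]]])
      (simp add: bmul_diff_right)
qed

lemma star_add_right: "f \<star> (g + h) = f \<star> g + f \<star> h"
proof -
  obtain F G H where FGH: "has_comps f F" "has_comps g G" "has_comps h H" using ex_has_comps by metis
  show ?thesis
    by (rule has_comps_eqI [OF has_comps_star [OF FGH(1) has_comps_add [OF FGH(2,3)]]
          has_comps_add [OF has_comps_star [OF FGH(1,2)] has_comps_star [OF FGH(1,3)]]])
      (simp add: bmul_add_right)
qed

lemma star_0_right: "f \<star> 0 = 0"
  using star_diff_right [of f 0 0] by simp

lemma star_sum_right: "f \<star> (\<Sum>i\<in>A. g i) = (\<Sum>i\<in>A. f \<star> g i)"
  by (induction A rule: infinite_finite_induct) (simp_all add: star_0_right star_add_right)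

section \<open>Projections\<close>

text \<open>
  Almost every value is an orthogonal projection of the matrix algebra.
\<close>

definition is_projection :: "slice_class \<Rightarrow> bool" where
  "is_projection f \<longleftrightarrow> (\<exists>P. has_comps f P \<and> (AE x in re_law. P x \<odot> badj (P x) = P x))"

lemma is_projectionD:
  assumes "is_projection f" "has_comps f P"
  shows "AE x in re_law. P x \<odot> badj (P x) = P x"
proof -
  obtain Q where "has_comps f Q" and Q: "AE x in re_law. Q x \<odot> badj (Q x) = Q x"
    using assms(1) by (auto simp: is_projection_def)
  then have "AE x in re_law. P x = Q x" using has_comps_unique assms(2) by blast
  with Q show ?thesis by eventually_elim simp
qed

text \<open>
  Passing from \<open>f\<close> to \<open>tilde f\<close> is the automorphism \<open>\<iota> \<mapsto> - \<iota>\<close>. It maps \<open>badj\<close> to \<open>bconj\<close>, so the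
  condition on \<open>f\<close> is the image of \<open>P P\<^sup>* = P\<close> under this automorphism.
\<close>

lemma tilde_star_conj_iff_projection:
  assumes f: "f \<in> L2s"
  shows "tilde f \<star> slice_conj f = tilde f \<longleftrightarrow> is_projection f"
proof -
  obtain P where P: "has_comps f P" using ex_has_comps by blast
  have flip: "(fst X, - snd X) \<odot> bconj X = (fst (X \<odot> badj X), - snd (X \<odot> badj X))" for X
    by (simp add: bmul_def bconj_def badj_def)
  have *: "(fst X, - snd X) \<odot> bconj X = (fst X, - snd X) \<longleftrightarrow> X \<odot> badj X = X" for X
    unfolding flip by (auto simp: prod_eq_iff)
  have L: "has_comps (tilde f \<star> slice_conj f) (\<lambda>x. (fst (P x), - snd (P x)) \<odot> bconj (P x))"
    by (rule has_comps_star [OF has_comps_tilde [OF P] has_comps_slice_conj [OF P f]])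
  have R: "has_comps (tilde f) (\<lambda>x. (fst (P x), - snd (P x)))"
    by (rule has_comps_tilde [OF P])
  show ?thesis
  proof
    assume "tilde f \<star> slice_conj f = tilde f"
    with L have "has_comps (tilde f) (\<lambda>x. (fst (P x), - snd (P x)) \<odot> bconj (P x))" by simp
    from has_comps_unique [OF this R]
    have "AE x in re_law. (fst (P x), - snd (P x)) \<odot> bconj (P x) = (fst (P x), - snd (P x))" .
    then show "is_projection f" unfolding * using P by (auto simp: is_projection_def)
  next
    assume "is_projection f"
    from is_projectionD [OF this P] show "tilde f \<star> slice_conj f = tilde f"
      by (intro has_comps_eqI [OF L R]) (simp add: *)
  qed
qed

lemma projection_idempotent:
  assumes "is_projection f"
  shows "f \<star> f = f"
proof -
  obtain P where P: "has_comps f P" using ex_has_comps by blast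
  have "AE x in re_law. P x \<odot> P x = P x"
    using is_projectionD [OF assms P] by eventually_elim (rule projection_self_adjoint)
  then show ?thesis by (rule has_comps_eqI [OF has_comps_star [OF P P] P])
qed

text \<open>
  Two orthogonal projections with the same range are equal: taking adjoints in \<open>Q P = P\<close> gives
  \<open>P Q = P\<close>, while \<open>P Q = Q\<close> by the other hypothesis.
\<close>

lemma projection_eqI:
  assumes f: "is_projection f" and g: "is_projection g" and "f \<star> g = g" "g \<star> f = f"
  shows "f = g"
proof -
  obtain P Q where P: "has_comps f P" and Q: "has_comps g Q" using ex_has_comps by metis
  have "AE x in re_law. P x \<odot> Q x = Q x"
    using has_comps_unique [OF has_comps_star [OF P Q]] Q assms(3) by simp
  moreover have "AE x in re_law. Q x \<odot> P x = P x"
    using has_comps_unique [OF has_comps_star [OF Q P]] P assms(4) by simp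
  ultimately have "AE x in re_law. P x = Q x"
    using is_projectionD [OF f P] is_projectionD [OF g Q]
  proof eventually_elim
    case (elim x)
    have "P x = badj (Q x \<odot> P x)"
      using elim(2) projection_self_adjoint(1) [OF elim(3)] by simp
    also have "\<dots> = P x \<odot> Q x"
      using projection_self_adjoint(1) [OF elim(3)] projection_self_adjoint(1) [OF elim(4)]
      by (simp add: badj_bmul)
    finally show ?case using elim(1) by simp
  qed
  then show ?thesis by (rule has_comps_eqI [OF P Q])
qed

text \<open>
  Projections have bounded components, so star multiplication by one is continuous, unlike star
  multiplication by a general element of the space.
\<close>

lemma sqnorm_projection_star_le:
  assumes "is_projection f"
  shows "sqnorm (f \<star> g) \<le> 16 * sqnorm g"
proof -
  obtain P G where P: "has_comps f P" and G: "has_comps g G" using ex_has_comps by metis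
  have [measurable]: "G \<in> borel_measurable re_law"
    using has_comps_measurable [OF G] by (simp add: measurable_re_law)
  have "sqnorm (f \<star> g) = (\<integral>\<^sup>+ x. ennreal ((norm (P x \<odot> G x))\<^sup>2) \<partial>re_law)"
    by (rule has_comps_sqnorm [OF has_comps_star [OF P G]])
  also have "\<dots> \<le> (\<integral>\<^sup>+ x. 16 * ennreal ((norm (G x))\<^sup>2) \<partial>re_law)"
  proof (rule nn_integral_mono_AE)
    show "AE x in re_law. ennreal ((norm (P x \<odot> G x))\<^sup>2) \<le> 16 * ennreal ((norm (G x))\<^sup>2)"
      using is_projectionD [OF assms P]
    proof eventually_elim
      case (elim x)
      have "norm (P x \<odot> G x) \<le> 4 * (norm (P x) * norm (G x))" by (rule norm_bmul_le)
      also have "\<dots> \<le> 4 * (1 * norm (G x))"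
        using projection_norm_le [OF elim] by (intro mult_left_mono mult_right_mono) auto
      finally have "(norm (P x \<odot> G x))\<^sup>2 \<le> (4 * norm (G x))\<^sup>2" by (intro power_mono) auto
      then have "ennreal ((norm (P x \<odot> G x))\<^sup>2) \<le> ennreal (16 * (norm (G x))\<^sup>2)"
        by (intro ennreal_leI) (simp add: power_mult_distrib)
      then show ?case by (simp add: ennreal_mult)
    qed
  qed
  also have "\<dots> = 16 * (\<integral>\<^sup>+ x. ennreal ((norm (G x))\<^sup>2) \<partial>re_law)" by (rule nn_integral_cmult) measurable
  also have "\<dots> = 16 * sqnorm g" by (simp add: has_comps_sqnorm [OF G])
  finally show ?thesis .
qed

lemma ex_has_coeffs: "f \<in> L2s \<Longrightarrow> \<exists>a. has_coeffs f a"
  by (metis fourier_series_converges has_coeffs_iff to_L2_inverse)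

lemma right_subspace_sum:
  assumes "right_subspace K" "\<And>i. i \<in> A \<Longrightarrow> f i \<in> K"
  shows "(\<Sum>i\<in>A. f i) \<in> K"
  using assms(2) assms(1) unfolding right_subspace_def
  by (induction A rule: infinite_finite_induct) auto

section \<open>Doubly invariant subspaces\<close>

text \<open>
  For a polynomial \<open>f\<close> in \<open>q\<close> and its inverse this is the invariance of \<open>K\<close>, as the product of \<open>p\<close> with
  \<open>q\<^sup>n a\<close> is \<open>(q\<^sup>n p) a\<close>. The general case follows from Fourier series, by continuity of the multiplication by \<open>p\<close>.
\<close>

lemma projection_star_mem:
  assumes K: "right_subspace K" "L2s_closed K" and shift: "\<And>n g. g \<in> K \<Longrightarrow> qmonom n 1 \<star> g \<in> K"
    and p: "p \<in> K" "is_projection p" and f: "f \<in> L2s"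
  shows "p \<star> f \<in> K"
proof -
  obtain a where a: "has_coeffs f a" using ex_has_coeffs [OF f] by blast
  define S where "S N = (\<Sum>n = - int N..int N. qmonom n (a n))" for N
  have SK: "p \<star> S N \<in> K" for N
    unfolding S_def star_sum_right star_qmonom
    using K(1) shift [OF p(1)] by (intro right_subspace_sum K(1)) (auto simp: right_subspace_def)
  have pf: "p \<star> f \<in> L2s"
    using le_less_trans [OF sqnorm_projection_star_le [OF p(2)], of f] f
    by (simp add: L2s_def ennreal_mult_less_top)
  have "(\<lambda>N. sqnorm (p \<star> S N - p \<star> f)) \<longlonglongrightarrow> 0"
  proof (rule tendsto_sandwich [OF _ _ tendsto_const])
    have "(\<lambda>N. 16 * sqnorm (S N - f)) \<longlonglongrightarrow> 16 * 0"
      using a by (intro ennreal_tendsto_cmult) (auto simp: has_coeffs_def L2s_tendsto_def S_def)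
    then show "(\<lambda>N. 16 * sqnorm (S N - f)) \<longlonglongrightarrow> 0" by simp
    show "\<forall>\<^sub>F N in sequentially. sqnorm (p \<star> S N - p \<star> f) \<le> 16 * sqnorm (S N - f)"
      using sqnorm_projection_star_le [OF p(2)] by (simp flip: star_diff_right)
  qed simp
  then show ?thesis
    using K(2) SK pf unfolding L2s_closed_def L2s_tendsto_def by (elim allE [of _ "\<lambda>N. p \<star> S N"]) blast
qed

text \<open>
  Surjectivity of \<open>Mq\<close> on \<open>K\<close> provides the negative powers, as \<open>Mq\<close> is injective on the whole space.
\<close>

lemma doubly_invariant_shift:
  assumes "Mq ` K = K" "g \<in> K"
  shows "qmonom n 1 \<star> g \<in> K"
proof (induction n rule: int_induct [of _ 0])
  case base
  show ?case using assms(2) by (simp add: shift_0)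
next
  case (step1 n)
  have "qmonom (n + 1) 1 \<star> g = Mq (qmonom n 1 \<star> g)"
    by (simp add: Mq_eq_star shift_shift add.commute)
  with step1 show ?case using assms(1) by blast
next
  case (step2 n)
  then obtain h where h: "h \<in> K" "qmonom n 1 \<star> g = qmonom 1 1 \<star> h"
    using assms(1) unfolding Mq_eq_star by blast
  have "h = qmonom (- 1) 1 \<star> (qmonom 1 1 \<star> h)" by (simp only: shift_shift) (simp add: shift_0)
  also have "\<dots> = qmonom (n - 1) 1 \<star> g" by (simp add: shift_shift flip: h(2))
  finally show ?case using h(1) by simp
qed

text \<open>
  The generator is the orthogonal projection \<open>p\<close> of the constant 1 on \<open>K\<close>. For \<open>g\<close> in \<open>K\<close> all \<open>q\<^sup>n g a\<close>
  are in \<open>K\<close>, hence orthogonal to \<open>1 - p\<close>; with \<open>P\<close> and \<open>G\<close> for the components of \<open>p\<close> and \<open>g\<close>, this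
  says that every Fourier coefficient of \<open>G\<^sup>* (1 - P)\<close> vanishes. Hence \<open>G\<^sup>* = G\<^sup>* P\<close>. For \<open>g = p\<close> this is
  \<open>P\<^sup>* = P\<^sup>* P\<close>, which makes \<open>P\<close> an orthogonal projection, and then in general \<open>G = P\<^sup>* G = P G\<close>.
\<close>

lemma ex_projection_onto:
  assumes K: "K \<subseteq> L2s" "right_subspace K" "L2s_closed K"
    and shift: "\<And>n g. g \<in> K \<Longrightarrow> qmonom n 1 \<star> g \<in> K"
  obtains p where "p \<in> K" "is_projection p" "\<And>g. g \<in> K \<Longrightarrow> p \<star> g = g"
proof -
  define V where "V = {f. class_of f \<in> K}"
  have "subspace V"
    using K(2) unfolding V_def right_subspace_def
    by (intro subspaceI) (auto simp: zero_slice_L2.rep_eq plus_slice_L2.rep_eq scaleR_slice_L2.rep_eq)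
  moreover have "closed V"
    unfolding closed_sequential_limits
  proof (intro allI impI)
    fix X l assume "(\<forall>n. X n \<in> V) \<and> X \<longlonglongrightarrow> l"
    then have "\<forall>n. class_of (X n) \<in> K" "L2s_tendsto (\<lambda>n. class_of (X n)) (class_of l)" "class_of l \<in> L2s"
      using class_of by (auto simp: V_def L2s_tendsto_iff)
    then have "class_of l \<in> K"
      using K(3) [unfolded L2s_closed_def, rule_format, of "\<lambda>n. class_of (X n)" "class_of l"] by blast
    then show "l \<in> V" by (simp add: V_def)
  qed
  ultimately obtain p where p: "p \<in> V" "\<And>h. h \<in> V \<Longrightarrow> inner (monom_L2 0 1 - p) h = 0"
    using orthogonal_projection_exists by metis
  obtain P where P: "L2_comps p P" using ex_L2_comps by blast
  then have pP: "has_comps (class_of p) P" by (simp add: L2_comps.rep_eq)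
  have one_P: "L2_comps (monom_L2 0 1 - p) (\<lambda>x. (1, 0) - P x)"
    using L2_comps_diff [OF L2_comps_monom P, of 0 1] by (simp add: unitary_0)
  have ann: "AE x in re_law. badj (G x) \<odot> ((1, 0) - P x) = 0" if g: "g \<in> K" "has_comps g G" for g G
  proof (rule fourier_unique)
    have G: "integrable re_law (\<lambda>x. (norm (G x))\<^sup>2)"
      using g K(1) by (auto simp: L2s_iff_integrable)
    have [measurable]: "G \<in> borel_measurable re_law" "P \<in> borel_measurable re_law"
      using has_comps_measurable [OF g(2)] has_comps_measurable [OF pP] by (simp_all add: measurable_re_law)
    show "integrable re_law (\<lambda>x. badj (G x) \<odot> ((1, 0) - P x))"
    proof (rule Bochner_Integration.integrable_bound)
      show "integrable re_law (\<lambda>x. 4 * ((norm (G x))\<^sup>2 + (norm ((1, 0) - P x))\<^sup>2))"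
        using G L2_comps_square_integrable [OF one_P] by simp
      have "norm (badj X \<odot> Y) \<le> 4 * ((norm X)\<^sup>2 + (norm Y)\<^sup>2)" for X Y
      proof -
        have "norm (badj X \<odot> Y) \<le> 4 * (norm X * norm Y)"
          using norm_bmul_le [of "badj X" Y] by (simp add: badj_def norm_prod_def)
        also have "norm X * norm Y \<le> (norm X)\<^sup>2 + (norm Y)\<^sup>2"
          using sum_squares_bound [of "norm X" "norm Y"] mult_nonneg_nonneg [OF norm_ge_zero norm_ge_zero, of X Y]
          by linarith
        finally show ?thesis by simp
      qed
      then show "AE x in re_law. norm (badj (G x) \<odot> ((1, 0) - P x))
          \<le> norm (4 * ((norm (G x))\<^sup>2 + (norm ((1, 0) - P x))\<^sup>2))" by simp
    qed measurable
    fix n a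
    have gK: "scale_right (qmonom n 1 \<star> g) a \<in> K"
      using shift [OF g(1)] K(2) by (auto simp: right_subspace_def)
    then obtain h where h: "class_of h = scale_right (qmonom n 1 \<star> g) a"
      using K(1) by (metis subsetD to_L2_inverse)
    then have hV: "h \<in> V" using gK by (simp add: V_def)
    have hH: "L2_comps h (\<lambda>x. unitary n x \<odot> G x \<odot> (a, 0))"
      using has_comps_scale_right [OF has_comps_shift [OF g(2)]] h by (simp add: L2_comps.rep_eq)
    have "G x \<odot> (unitary n x \<odot> (a, 0)) = unitary n x \<odot> G x \<odot> (a, 0)" for x
      by (simp only: bmul_assoc [symmetric] central_bmul_commute [OF central_unitary, of n x "G x"])
    then have "(\<integral>x. inner (badj (G x) \<odot> ((1, 0) - P x)) (unitary n x \<odot> (a, 0)) \<partial>re_law)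
      = (\<integral>x. inner ((1, 0) - P x) (unitary n x \<odot> G x \<odot> (a, 0)) \<partial>re_law)"
      by (simp add: inner_bmul_left)
    also have "\<dots> = 0" using p(2) [OF hV] by (simp add: inner_L2_eq [OF one_P hH])
    finally show "(\<integral>x. inner (badj (G x) \<odot> ((1, 0) - P x)) (unitary n x \<odot> (a, 0)) \<partial>re_law) = 0" .
  qed
  have pK: "class_of p \<in> K" using p(1) by (simp add: V_def)
  have self: "AE x in re_law. badj (P x) = P x \<and> P x \<odot> badj (P x) = P x"
    using ann [OF pK pP]
  proof eventually_elim
    case (elim x)
    then have 1: "badj (P x) \<odot> P x = badj (P x)" by (simp add: bmul_diff_right)
    from arg_cong [OF 1, of badj] have 2: "badj (P x) \<odot> P x = P x" by (simp add: badj_bmul)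
    from 1 2 have 3: "badj (P x) = P x" by (rule trans [OF sym])
    from 2 have "P x \<odot> badj (P x) = P x" by (simp only: 3)
    with 3 show ?case ..
  qed
  show thesis
  proof
    show "class_of p \<in> K" by (rule pK)
    show "is_projection (class_of p)" using pP self by (auto simp: is_projection_def)
    fix g assume g: "g \<in> K"
    obtain G where G: "has_comps g G" using ex_has_comps by blast
    have "AE x in re_law. P x \<odot> G x = G x"
      using ann [OF g G] self
    proof eventually_elim
      case (elim x)
      from elim(1) have "badj (G x) \<odot> P x = badj (G x)" by (simp add: bmul_diff_right)
      from arg_cong [OF this, of badj] show ?case using elim(2) by (simp add: badj_bmul)
    qed
    then show "class_of p \<star> g = g" by (rule has_comps_eqI [OF has_comps_star [OF pP G] G])
  qed
qed

theorem theorem1p1: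
  fixes K :: "slice_class set"
  assumes "K \<subseteq> L2s" and "right_subspace K" and "L2s_closed K"
  shows "Mq ` K = K \<longleftrightarrow>
    (\<exists>!\<phi>. \<phi> \<in> L2s \<and> K = {\<phi> \<star> f | f. f \<in> L2s} \<and> tilde \<phi> \<star> slice_conj \<phi> = tilde \<phi>)"
proof
  assume inv: "Mq ` K = K"
  obtain p where p: "p \<in> K" "is_projection p" "\<And>g. g \<in> K \<Longrightarrow> p \<star> g = g"
    using ex_projection_onto [OF assms doubly_invariant_shift [OF inv]] by blast
  have K: "K = {p \<star> f | f. f \<in> L2s}"
  proof (intro equalityI subsetI)
    fix g assume "g \<in> K"
    then show "g \<in> {p \<star> f | f. f \<in> L2s}" using p(3) assms(1) by force
  next
    fix g assume "g \<in> {p \<star> f | f. f \<in> L2s}"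
    then show "g \<in> K"
      using projection_star_mem [OF assms(2,3) doubly_invariant_shift [OF inv] p(1,2)] by blast
  qed
  show "\<exists>!\<phi>. \<phi> \<in> L2s \<and> K = {\<phi> \<star> f | f. f \<in> L2s} \<and> tilde \<phi> \<star> slice_conj \<phi> = tilde \<phi>"
  proof (rule ex1I [of _ p])
    have "p \<in> L2s" using p(1) assms(1) by blast
    then show "p \<in> L2s \<and> K = {p \<star> f | f. f \<in> L2s} \<and> tilde p \<star> slice_conj p = tilde p"
      using K p(2) tilde_star_conj_iff_projection by blast
    fix \<psi> assume \<psi>: "\<psi> \<in> L2s \<and> K = {\<psi> \<star> f | f. f \<in> L2s} \<and> tilde \<psi> \<star> slice_conj \<psi> = tilde \<psi>"
    then have proj: "is_projection \<psi>" using tilde_star_conj_iff_projection by blast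
    have "\<psi> \<star> qmonom 0 1 \<in> K" using \<psi> qmonom_L2s by blast
    then have "\<psi> \<in> K" by (simp add: star_one)
    then have "p \<star> \<psi> = \<psi>" by (rule p(3))
    moreover obtain f where "p = \<psi> \<star> f" using p(1) \<psi> by blast
    then have "\<psi> \<star> p = p" by (simp add: projection_idempotent [OF proj] flip: star_assoc)
    ultimately show "\<psi> = p" using projection_eqI [OF proj p(2)] by blast
  qed
next
  assume "\<exists>!\<phi>. \<phi> \<in> L2s \<and> K = {\<phi> \<star> f | f. f \<in> L2s} \<and> tilde \<phi> \<star> slice_conj \<phi> = tilde \<phi>"
  then obtain \<phi> where K: "K = {\<phi> \<star> f | f. f \<in> L2s}" by blast
  show "Mq ` K = K"
  proof (intro equalityI subsetI)
    fix g assume "g \<in> Mq ` K"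
    then obtain f where f: "f \<in> L2s" "g = \<phi> \<star> (qmonom 1 1 \<star> f)"
      by (auto simp: K Mq_eq_star shift_star)
    then show "g \<in> K" unfolding K using shift_L2s by blast
  next
    fix g assume "g \<in> K"
    then obtain f where f: "f \<in> L2s" "g = \<phi> \<star> f" by (auto simp: K)
    have "qmonom 1 1 \<star> (qmonom (- 1) 1 \<star> f) = f" by (simp only: shift_shift) (simp add: shift_0)
    then have "g = Mq (\<phi> \<star> (qmonom (- 1) 1 \<star> f))" by (simp only: f(2) Mq_eq_star shift_star [of 1 \<phi>])
    moreover have "\<phi> \<star> (qmonom (- 1) 1 \<star> f) \<in> K" unfolding K using shift_L2s f(1) by blast
    ultimately show "g \<in> Mq ` K" by blast
  qed
qed

end
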